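(* Let $\Lambda=\mathcal K Q/\langle\rho\rangle$ be a string algebra with $Q_1\neq\emptyset$, and let $\mathfrak x$ be a string over $\Lambda$ that is either finite, or infinite and aperiodic. Then the (direct sum) string module $M(\mathfrak x)$ is a brick if and only if every word in the class $\Phi(\widetilde{\mathsf W}(\mathfrak x))$ of words over the multi-entry inverse automaton $\mathsf M_{\Lambda\delta}$ over the alphabet $\{0\}$ (so with input letters $0$ and $1=0^{-1}$) is a brick word over $\mathsf M_{\Lambda\delta}$.
   Context: $\mathcal K$ is an algebraically closed field. **String algebras.** $Q=(Q_0,Q_1,s,t)$ is a finite quiver; a path $\alpha\beta$ requires $t(\alpha)=s(\beta)$. A string algebra is $\mathcal KQ/\langle\rho\rangle$, $\rho$ a finite set of paths of length $\ge 2$, such that: (I) each vertex is the source of at most two arrows and the target of at most two arrows; (II) for each $\alpha\in Q_1$ there is at most one arrow $\gamma$ such that $\alpha\gamma$ is a path not in $\rho$, and at most one arrow $\gamma'$ such that $\gamma'\alpha$ is a path not in $\rho$; (III) there is a bound on the lengths of paths having no subpath in $\rho$. Fix maps $\varsigma,\varepsilon:Q_1\to\{-1,1\}$ with: (a) $\alpha\ne\beta$, $s(\alpha)=s(\beta)$ imply $\varsigma(\alpha)=-\varsigma(\beta)$; (b) $\alpha\ne\beta$, $t(\alpha)=t(\beta)$ imply $\varepsilon(\alpha)=-\varepsilon(\beta)$; (c) $t(\alpha)=s(\beta)$, $\alpha\beta\notin\rho$ imply $\varepsilon(\alpha)=-\varsigma(\beta)$. **Strings.** Each arrow $\alpha$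 has a formal inverse $\alpha^{-1}$, with $(\alpha^{-1})^{-1}=\alpha$, $s(\alpha^{-1})=t(\alpha)$, $t(\alpha^{-1})=s(\alpha)$, $\varsigma(\alpha^{-1})=\varepsilon(\alpha)$, $\varepsilon(\alpha^{-1})=\varsigma(\alpha)$. Elements of $Q_1\sqcup Q_1^{-1}$ are syllables. A finite string of length $k\ge1$ is a sequence of syllables $\alpha_1\cdots\alpha_k$ with $t(\alpha_i)=s(\alpha_{i+1})$, $\alpha_i\ne\alpha_{i+1}^{-1}$, and neither $\alpha_i\cdots\alpha_{i+j}$ nor $\alpha_{i+j}^{-1}\cdots\alpha_i^{-1}$ in $\rho$ for all $1\le i\le i+j\le k$. For each $v\in Q_0$ there are also two zero-length strings $1_{(v,1)},1_{(v,-1)}$ with source and target $v$, $1_{(v,i)}^{-1}=1_{(v,-i)}$, $\varsigma(1_{(v,i)})=-i$, $\varepsilon(1_{(v,i)})=i$. Set $\varsigma(\alpha_1\cdots\alpha_k)=\varsigma(\alpha_1)$, $\varepsilon(\alpha_1\cdots\alpha_k)=\varepsilon(\alpha_k)$, and similarly for source and target. $\mathfrak x1_{(v,i)}$ is defined (and equals $\mathfrak x$) iff $t(\mathfrak x)=v,\varepsilon(\mathfrak x)=i$; $1_{(v,i)}\mathfrak x$ is defined (and equals $\mathfrak x$) iff $s(\mathfrak x)=v,\varsigma(\mathfrak x)=-i$. Infinite strings are sequences of syllables indexed by $\mathbb N$ (right $\mathbb N$-strings $\alpha_1\alpha_2\cdots$), by $\mathbb N^{op}$ (left $\mathbb N$-strings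 $\cdots\alpha_2\alpha_1$), or by $\mathbb Z$ ($\mathbb Z$-strings, taken up to shift of the index), all of whose finite consecutive subsequences are strings. $\mathfrak{St}(\Lambda)$ is the set of all finite and infinite strings. A (left, right) substring is a consecutive (initial, final) part, written $\sqsubseteq$ ($\sqsubseteq_l,\sqsubseteq_r$); $\sqsubset,\sqsubset_l,\sqsubset_r$ denote the proper versions. The same notation is used for words over an alphabet. **Aperiodicity** (for strings and words). A right-infinite sequence is almost periodic if it has a periodic tail (i.e. it is eventually periodic), and aperiodic otherwise; a left-infinite sequence is aperiodic if its inverse is; a bi-infinite sequence is aperiodic if neither its right-infinite half nor its left-infinite half is almost periodic. Finite sequences count as aperiodic. **String modules, bricks.** Modules are viewed as representations of $(Q,\rho)$. $M(\mathfrak x)$ has a $\mathcal K$-basis indexed by the gaps of $\mathfrak x$ (the positions before, between and after syllables), each basis vector placed at the corresponding vertex. If a syllable lies between gaps $p$ (on its left) and $p'$ (on its right) then, if it is an arrow $\alpha$, $\alpha$ sends $z_p$ to $z_{p'}$, and if it is $\beta^{-1}$ with $\beta\in Q_1$, $\beta$ sends $z_{p'}$ to $z_p$; all other actions of arrows on basis vectors are zero. For zero-length $\mathfrak x$ this is the simple module. A brick is a module whose endomorphism algebra is isomorphic to $\mathcal K$. **Multi-entry inverse automaton (MIA).** A tuple $\mathsf M=(\mathsf M_0,\mathsf I,\mathsf e,(-)^{-1},\mathsf A,\mathsf t)$ with $\mathsf M_0$ a finite set of states, $\mathsf I\subseteq\mathsf M_0$ the initial states, $\mathsf e:\mathsf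 M_0\to\mathsf I$, $(-)^{-1}:\mathsf I\to\mathsf I$, $\mathsf A$ a finite alphabet with $\mathsf A^\pm=\mathsf A\sqcup\mathsf A^{-1}$ (formal inverses), and a partial function $\mathsf t:\mathsf M_0\times\mathsf A^\pm\rightharpoonup\mathsf M_0$ such that: (1) $(-)^{-1}$ is an involution without fixed points; (2) $\mathsf e(v)=v$ for $v\in\mathsf I$; (3) if $\mathsf t(v,\mathsf b)$ is defined then $\mathsf t(\mathsf e(v),\mathsf b)$ is defined and $\mathsf e(\mathsf t(v,\mathsf b))=\mathsf e(\mathsf t(\mathsf e(v),\mathsf b))$. $\widetilde{\mathsf t}$ is the extension of $\mathsf t$ to finite words: $\widetilde{\mathsf t}(v,\epsilon)=v$ for the empty word $\epsilon$, $\widetilde{\mathsf t}(v,\mathsf w'\mathsf b)=\mathsf t(\widetilde{\mathsf t}(v,\mathsf w'),\mathsf b)$. **Words over an MIA.** Words are finite, right-infinite, left-infinite or bi-infinite sequences over $\mathsf A^\pm$; the inverse of a word reverses the order and inverts each letter. A right word is $(v,\mathsf w)$ with $v\in\mathsf I$ and $\mathsf w$ finite or right-infinite such that $\widetilde{\mathsf t}(v,\mathsf w')$ is defined for all finite $\mathsf w'\sqsubseteq_l\mathsf w$. A left word is $(\mathsf w,v)$ such that $(v^{-1},\mathsf w^{-1})$ is a right word. A word over $\mathsf M$ is a triple $(\mathsf w^l,v,\mathsf w^r)$ with $v\in\mathsf I$, $(\mathsf w^l,v)$ a left word, $(v,\mathsf w^r)$ a right word, and $(\mathsf w^l\mathsf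 w',\mathsf e(\widetilde{\mathsf t}(v,\mathsf w')))$ a left word for each finite $\mathsf w'\sqsubseteq_l\mathsf w^r$. $\mathsf W(\mathsf M)$ is the set of words over $\mathsf M$. The inverse of a word is $(\mathsf w^l,v,\mathsf w^r)^{-1}=((\mathsf w^r)^{-1},v^{-1},(\mathsf w^l)^{-1})$. The relation $\sim$ on $\mathsf W(\mathsf M)$ is the symmetric closure of: $(\mathsf w_1^l,v_1,\mathsf w_1^r)\sim(\mathsf w_2^l,v_2,\mathsf w_2^r)$ if there is a finite word $\overline{\mathsf w}$ with $\mathsf w_1^l=\mathsf w_2^l\overline{\mathsf w}$, $\mathsf w_2^r=\overline{\mathsf w}\mathsf w_1^r$ and $\mathsf e(\widetilde{\mathsf t}(v_2,\overline{\mathsf w}))=v_1$. **Subwords.** $\mathsf w_1=(\mathsf w_1^l,v_1,\mathsf w_1^r)$ is a subword of $\mathsf w_2$, $\mathsf w_1\sqsubseteq\mathsf w_2$, if there is $\mathsf w_3=(\mathsf w_3^l,v_1,\mathsf w_3^r)\sim\mathsf w_2$ with $\mathsf w_1^l\sqsubseteq_r\mathsf w_3^l$ and $\mathsf w_1^r\sqsubseteq_l\mathsf w_3^r$. It is proper, $\mathsf w_1\sqsubset\mathsf w_2$, if moreover $\mathsf w_1\not\sim\mathsf w_2$. It is a factor subword if for some such $\mathsf w_3$ one of the following holds: $\mathsf w_1=\mathsf w_3$; or $\mathsf w_1^l=\mathsf w_3^l$ and $\mathsf w_1^r\mathsf b\sqsubseteq_l\mathsf w_3^r$ for some $\mathsf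 b\in\mathsf A$; or $\mathsf w_1^r=\mathsf w_3^r$ and $\mathsf b^{-1}\mathsf w_1^l\sqsubseteq_r\mathsf w_3^l$ for some $\mathsf b\in\mathsf A$; or $\mathsf b^{-1}\mathsf w_1^l\sqsubseteq_r\mathsf w_3^l$ and $\mathsf w_1^r\mathsf b'\sqsubseteq_l\mathsf w_3^r$ for some $\mathsf b,\mathsf b'\in\mathsf A$. An image subword is defined in the same way with $\mathsf b^{-1}$ (left side) replaced by $\mathsf b$, and $\mathsf b$, $\mathsf b'$ (right side) replaced by $\mathsf b^{-1}$, $\mathsf b'^{-1}$. **Brick words.** $\mathsf w=(\mathsf w^l,v,\mathsf w^r)\in\mathsf W(\mathsf M)$ is a brick word if $\mathsf w^l\mathsf w^r$ is aperiodic and there are no word $\overline{\mathsf w}\in\mathsf W(\mathsf M)$ and $\mathsf u\in\{\mathsf w,\mathsf w^{-1}\}$ such that $\overline{\mathsf w}$ is a factor subword of $\mathsf w$, an image subword of $\mathsf u$, and at least one of $\overline{\mathsf w}\sqsubset\mathsf w$, $\overline{\mathsf w}\sqsubset\mathsf u$ holds. **The MIA $\mathsf M_\Lambda$.** Its alphabet is $Q_1$; its initial states are the zero-length strings, with $(-)^{-1}$ given by $1_{(v,i)}^{-1}=1_{(v,-i)}$; its states are the zero-length strings, all syllables in $Q_1\sqcup Q_1^{-1}$, and all strings $\mathfrak y$ that are proper left substrings of some $\mathfrak r$ with $\mathfrak r\in\rho$ or $\mathfrak r^{-1}\in\rho$; $\mathsf t_\Lambda(\mathfrak x,\mathsf b)$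 is defined iff $\mathfrak x\mathsf b\in\mathfrak{St}(\Lambda)$, and then it is the maximal right substring of $\mathfrak x\mathsf b$ that is a state; $\mathsf e_\Lambda(\mathfrak x)=1_{(t(\mathfrak x),\varepsilon(\mathfrak x))}$. **The class $\widetilde{\mathsf W}(\mathfrak x)$.** For a string $\mathfrak x$, $\widetilde{\mathsf W}(\mathfrak x)$ is the $\sim$-class in $\mathsf W(\mathsf M_\Lambda)$ of all words $(\mathsf w^l,v,\mathsf w^r)$ with $\mathsf w^l\mathsf w^r=\mathfrak x$ (if $\mathfrak x=1_{(u,i)}$ it is the class of $(\epsilon,1_{(u,i)},\epsilon)$). **The MIA $\mathsf M_{\Lambda\delta}$.** Let $\delta:Q_1\to\{0\}$ be the constant map, write $1:=0^{-1}$, and let $\delta^\pm:Q_1\sqcup Q_1^{-1}\to\{0,1\}$ be the induced map ($\delta^\pm(\alpha)=0$, $\delta^\pm(\alpha^{-1})=1$ for $\alpha\in Q_1$). For each state $\mathfrak x$ of $\mathsf M_\Lambda$, $\delta^\pm$ is injective on $\{\mathsf b:\mathsf t_\Lambda(\mathfrak x,\mathsf b)\text{ defined}\}$. $\mathsf M_{\Lambda\delta}$ has the same states, initial states, $\mathsf e$ and $(-)^{-1}$ as $\mathsf M_\Lambda$, alphabet $\{0\}$, and transition function $\mathsf t'(\mathfrak x,\delta^\pm(\mathsf b))=\mathsf t_\Lambda(\mathfrak x,\mathsf b)$ whenever the latter is defined. $\Phi:\mathsf W(\mathsf M_\Lambda)\to\mathsf W(\mathsf M_{\Lambda\delta})$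 sends $(\mathsf w^l,v,\mathsf w^r)$ to the triple obtained by applying $\delta^\pm$ letterwise to $\mathsf w^l$ and $\mathsf w^r$. *)

theory Defs
  imports
    "Graph_Theory.Arc_Walk"
    "HOL-Library.Sublist"
    "HOL-Library.Stream"
    "HOL-Library.Poly_Mapping"
    "HOL-Computational_Algebra.Polynomial"
    "HOL-Algebra.QuotRing"
    "HOL-Algebra.Module"
begin

section \<open>Letters, words and half words\<close>

text \<open>The signed alphabet: letters \<open>Dir a\<close> and their formal inverses \<open>Inv a\<close>.\<close>

datatype 'a letter = Dir 'a | Inv 'a

fun linv :: "'a letter \<Rightarrow> 'a letter" where
  "linv (Dir a) = Inv a"
| "linv (Inv a) = Dir a"

definition signed :: "'a set \<Rightarrow> 'a letter set" where
  "signed A = Dir ` A \<union> Inv ` A"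

text \<open>
  Finite, right-infinite, left-infinite and bi-infinite sequences. \<open>Right s\<close> is
  \<open>s 0, s 1, \<dots>\<close>, whereas \<open>Left s\<close> is \<open>\<dots>, s 1, s 0\<close>. Bi-infinite
  sequences are to be read up to a shift of the index, see \<open>same_word\<close>.
\<close>

datatype 'b word =
    Finite "'b list"
  | Right "'b stream"
  | Left "'b stream"
  | Bi "int \<Rightarrow> 'b"

fun same_word :: "'b word \<Rightarrow> 'b word \<Rightarrow> bool" where
  "same_word (Bi f) (Bi g) \<longleftrightarrow> (\<exists>k. \<forall>i. g i = f (i + k))"
| "same_word w w' \<longleftrightarrow> w = w'"

text \<open>
  \<open>letter_at w p\<close> is the letter between the gaps \<open>p\<close> and \<open>p + 1\<close>, if there is one. The gaps of a word
  are indexed by \<open>{0..k}\<close> for a finite word of length \<open>k\<close>, by the nonnegative (nonpositive)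
  integers for right-infinite (left-infinite) words, and by all integers for bi-infinite ones.
\<close>

fun letter_at :: "'b word \<Rightarrow> int \<Rightarrow> 'b option" where
  "letter_at (Finite ws) p = (if 0 \<le> p \<and> p < int (length ws) then Some (ws ! nat p) else None)"
| "letter_at (Right s) p = (if 0 \<le> p then Some (s !! nat p) else None)"
| "letter_at (Left s) p = (if p < 0 then Some (s !! nat (- p - 1)) else None)"
| "letter_at (Bi f) p = Some (f p)"

definition almost_periodic :: "'b stream \<Rightarrow> bool" where
  "almost_periodic s \<longleftrightarrow> (\<exists>n us. us \<noteq> [] \<and> sdrop n s = cycle us)"

fun aperiodic :: "'a letter word \<Rightarrow> bool" where
  "aperiodic (Finite ws) \<longleftrightarrow> True"
| "aperiodic (Right s) \<longleftrightarrow> \<not> almost_periodic s"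
| "aperiodic (Left s) \<longleftrightarrow> \<not> almost_periodic (smap linv s)"
| "aperiodic (Bi f) \<longleftrightarrow>
     \<not> almost_periodic (smap (\<lambda>n. f (int n)) (siterate Suc 0)) \<and>
     \<not> almost_periodic (smap (\<lambda>n. linv (f (- int n - 1))) (siterate Suc 0))"

text \<open>
  A half word is a finite or infinite sequence listed outwards from a base point. To the right of
  the base point this is the reading order; a word \<open>\<dots> b\<^sub>2 b\<^sub>1\<close> to the left of the base point is
  represented by the half word \<open>b\<^sub>1, b\<^sub>2, \<dots>\<close>. Thus, on the left, a right subword becomes a prefix,
  multiplication by \<open>us\<close> on the right becomes \<open>happend (rev us)\<close>, and the inverse
  of a word to one side of the base point is the half word of inverse letters on the other side.
\<close>

datatype 'b hword = HFin "'b list" | HInf "'b stream"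

fun happend :: "'b list \<Rightarrow> 'b hword \<Rightarrow> 'b hword" where
  "happend us (HFin ws) = HFin (us @ ws)"
| "happend us (HInf s) = HInf (us @- s)"

definition hprefix :: "'b hword \<Rightarrow> 'b hword \<Rightarrow> bool" where
  "hprefix h k \<longleftrightarrow> h = k \<or> (\<exists>us k'. h = HFin us \<and> k = happend us k')"

text \<open>Inside \<open>k\<close>, the half word \<open>h\<close> is followed, going outwards, by the letter \<open>c\<close>.\<close>

definition hnext :: "'b hword \<Rightarrow> 'b \<Rightarrow> 'b hword \<Rightarrow> bool" where
  "hnext h c k \<longleftrightarrow> (\<exists>us. h = HFin us \<and> hprefix (HFin (us @ [c])) k)"

text \<open>The concatenation of a word to the left of a base point with one to the right of it.\<close>

fun glue :: "'b hword \<Rightarrow> 'b hword \<Rightarrow> 'b word" where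
  "glue (HFin us) (HFin ws) = Finite (rev us @ ws)"
| "glue (HFin us) (HInf s) = Right (rev us @- s)"
| "glue (HInf s) (HFin ws) = Left (rev ws @- s)"
| "glue (HInf s) (HInf s') = Bi (\<lambda>i. if 0 \<le> i then s' !! nat i else s !! nat (- i - 1))"


section \<open>Multi-entry inverse automata\<close>

record ('q, 'a) mia =
  states :: "'q set"
  initial :: "'q set"
  entry :: "'q \<Rightarrow> 'q"
  bar :: "'q \<Rightarrow> 'q"
  alphabet :: "'a set"
  trans :: "'q \<Rightarrow> 'a letter \<Rightarrow> 'q option"

locale mia =
  fixes M :: "('q, 'a) mia"
  assumes finite_states: "finite (states M)"
    and initial_states: "initial M \<subseteq> states M"
    and entry_initial: "v \<in> states M \<Longrightarrow> entry M v \<in> initial M"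
    and bar_initial: "v \<in> initial M \<Longrightarrow> bar M v \<in> initial M"
    and finite_alphabet: "finite (alphabet M)"
    and trans_states: "trans M v b = Some v' \<Longrightarrow> v \<in> states M \<and> b \<in> signed (alphabet M) \<and> v' \<in> states M"
    and bar_bar: "v \<in> initial M \<Longrightarrow> bar M (bar M v) = v"
    and bar_neq: "v \<in> initial M \<Longrightarrow> bar M v \<noteq> v"
    and entry_id: "v \<in> initial M \<Longrightarrow> entry M v = v"
    and trans_entry: "trans M v b = Some v' \<Longrightarrow>
      \<exists>v''. trans M (entry M v) b = Some v'' \<and> entry M v' = entry M v''"

definition run :: "('q, 'a) mia \<Rightarrow> 'q \<Rightarrow> 'a letter list \<Rightarrow> 'q option" where
  "run M v ws = foldl (\<lambda>q b. Option.bind q (\<lambda>u. trans M u b)) (Some v) ws"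

text \<open>A triple \<open>(w\<^sup>l, v, w\<^sup>r)\<close>, both parts being listed outwards from the base point.\<close>

type_synonym ('q, 'a) mword = "'a letter hword \<times> 'q \<times> 'a letter hword"

definition right_word :: "('q, 'a) mia \<Rightarrow> 'q \<Rightarrow> 'a letter hword \<Rightarrow> bool" where
  "right_word M v r \<longleftrightarrow> v \<in> initial M \<and> (\<forall>us. hprefix (HFin us) r \<longrightarrow> run M v us \<noteq> None)"

definition left_word :: "('q, 'a) mia \<Rightarrow> 'a letter hword \<Rightarrow> 'q \<Rightarrow> bool" where
  "left_word M l v \<longleftrightarrow> v \<in> initial M \<and> right_word M (bar M v) (map_hword linv l)"

definition words :: "('q, 'a) mia \<Rightarrow> ('q, 'a) mword set" where
  "words M = {(l, v, r). v \<in> initial M \<and> left_word M l v \<and> right_word M v r \<and>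
     (\<forall>us. hprefix (HFin us) r \<longrightarrow>
        left_word M (happend (rev us) l) (entry M (the (run M v us))))}"

fun mword_inv :: "('q, 'a) mia \<Rightarrow> ('q, 'a) mword \<Rightarrow> ('q, 'a) mword" where
  "mword_inv M (l, v, r) = (map_hword linv r, bar M v, map_hword linv l)"

text \<open>\<open>move M w\<^sub>1 w\<^sub>2\<close>: the base point of \<open>w\<^sub>1\<close> is reached from that of \<open>w\<^sub>2\<close> by reading the word \<open>us\<close>.\<close>

fun move :: "('q, 'a) mia \<Rightarrow> ('q, 'a) mword \<Rightarrow> ('q, 'a) mword \<Rightarrow> bool" where
  "move M (l1, v1, r1) (l2, v2, r2) \<longleftrightarrow>
     (\<exists>us. l1 = happend (rev us) l2 \<and> r2 = happend us r1 \<and>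
           map_option (entry M) (run M v2 us) = Some v1)"

definition sim :: "('q, 'a) mia \<Rightarrow> ('q, 'a) mword \<Rightarrow> ('q, 'a) mword \<Rightarrow> bool" where
  "sim M w1 w2 \<longleftrightarrow> w1 \<in> words M \<and> w2 \<in> words M \<and> (move M w1 w2 \<or> move M w2 w1)"

text \<open>\<open>w\<^sub>3\<close> witnesses that \<open>w\<^sub>1\<close> is a subword of \<open>w\<^sub>2\<close>.\<close>

definition occurs_as :: "('q, 'a) mia \<Rightarrow> ('q, 'a) mword \<Rightarrow> ('q, 'a) mword \<Rightarrow> ('q, 'a) mword \<Rightarrow> bool" where
  "occurs_as M w1 w2 w3 \<longleftrightarrow> sim M w3 w2 \<and>
     (case (w1, w3) of ((l1, v1, r1), (l3, v3, r3)) \<Rightarrow> v3 = v1 \<and> hprefix l1 l3 \<and> hprefix r1 r3)"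

definition subword :: "('q, 'a) mia \<Rightarrow> ('q, 'a) mword \<Rightarrow> ('q, 'a) mword \<Rightarrow> bool" where
  "subword M w1 w2 \<longleftrightarrow> (\<exists>w3. occurs_as M w1 w2 w3)"

definition proper_subword :: "('q, 'a) mia \<Rightarrow> ('q, 'a) mword \<Rightarrow> ('q, 'a) mword \<Rightarrow> bool" where
  "proper_subword M w1 w2 \<longleftrightarrow> subword M w1 w2 \<and> \<not> sim M w1 w2"

definition factor_subword :: "('q, 'a) mia \<Rightarrow> ('q, 'a) mword \<Rightarrow> ('q, 'a) mword \<Rightarrow> bool" where
  "factor_subword M w1 w2 \<longleftrightarrow> (\<exists>w3. occurs_as M w1 w2 w3 \<and>
     (case (w1, w3) of ((l1, v1, r1), (l3, v3, r3)) \<Rightarrow>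
        w1 = w3
      \<or> (l1 = l3 \<and> (\<exists>b \<in> alphabet M. hnext r1 (Dir b) r3))
      \<or> (r1 = r3 \<and> (\<exists>b \<in> alphabet M. hnext l1 (Inv b) l3))
      \<or> ((\<exists>b \<in> alphabet M. hnext l1 (Inv b) l3) \<and> (\<exists>b' \<in> alphabet M. hnext r1 (Dir b') r3))))"

definition image_subword :: "('q, 'a) mia \<Rightarrow> ('q, 'a) mword \<Rightarrow> ('q, 'a) mword \<Rightarrow> bool" where
  "image_subword M w1 w2 \<longleftrightarrow> (\<exists>w3. occurs_as M w1 w2 w3 \<and>
     (case (w1, w3) of ((l1, v1, r1), (l3, v3, r3)) \<Rightarrow>
        w1 = w3
      \<or> (l1 = l3 \<and> (\<exists>b \<in> alphabet M. hnext r1 (Inv b) r3))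
      \<or> (r1 = r3 \<and> (\<exists>b \<in> alphabet M. hnext l1 (Dir b) l3))
      \<or> ((\<exists>b \<in> alphabet M. hnext l1 (Dir b) l3) \<and> (\<exists>b' \<in> alphabet M. hnext r1 (Inv b') r3))))"

definition brick_word :: "('q, 'a) mia \<Rightarrow> ('q, 'a) mword \<Rightarrow> bool" where
  "brick_word M w \<longleftrightarrow> w \<in> words M \<and>
     (case w of (l, v, r) \<Rightarrow> aperiodic (glue l r)) \<and>
     \<not> (\<exists>w' \<in> words M. \<exists>u \<in> {w, mword_inv M w}.
          factor_subword M w' w \<and> image_subword M w' u \<and>
          (proper_subword M w' w \<or> proper_subword M w' u))"


section \<open>String algebras and strings\<close>

text \<open>
  A presentation \<open>(Q, \<rho>)\<close> together with a fixed choice of the sign maps. An arrow starts at its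
  \<open>tail\<close> and ends at its \<open>head\<close>; paths are written from left to right.
\<close>

record ('v, 'e) string_data =
  quiver :: "('v, 'e) pre_digraph"
  rels :: "'e list set"
  start_sign :: "'e \<Rightarrow> int"
  end_sign :: "'e \<Rightarrow> int"

locale string_algebra = fin_digraph "quiver L" for L :: "('v, 'e) string_data" +
  assumes finite_rels: "finite (rels L)"
    and rels_paths: "r \<in> rels L \<Longrightarrow> 2 \<le> length r \<and> (\<exists>u v. awalk u r v)"
    and max_two_out: "v \<in> verts (quiver L) \<Longrightarrow> card {a \<in> arcs (quiver L). tail (quiver L) a = v} \<le> 2"
    and max_two_in: "v \<in> verts (quiver L) \<Longrightarrow> card {a \<in> arcs (quiver L). head (quiver L) a = v} \<le> 2"
    and right_unique: "a \<in> arcs (quiver L) \<Longrightarrow>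
      card {c \<in> arcs (quiver L). head (quiver L) a = tail (quiver L) c \<and> [a, c] \<notin> rels L} \<le> 1"
    and left_unique: "a \<in> arcs (quiver L) \<Longrightarrow>
      card {c \<in> arcs (quiver L). head (quiver L) c = tail (quiver L) a \<and> [c, a] \<notin> rels L} \<le> 1"
    and bounded_paths: "\<exists>N. \<forall>u p v. awalk u p v \<and> \<not> (\<exists>r \<in> rels L. sublist r p) \<longrightarrow> length p \<le> N"
    and signs: "a \<in> arcs (quiver L) \<Longrightarrow> start_sign L a \<in> {-1, 1} \<and> end_sign L a \<in> {-1, 1}"
    and start_sign_neq: "\<lbrakk>a \<in> arcs (quiver L); b \<in> arcs (quiver L); a \<noteq> b;
      tail (quiver L) a = tail (quiver L) b\<rbrakk> \<Longrightarrow> start_sign L a = - start_sign L b"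
    and end_sign_neq: "\<lbrakk>a \<in> arcs (quiver L); b \<in> arcs (quiver L); a \<noteq> b;
      head (quiver L) a = head (quiver L) b\<rbrakk> \<Longrightarrow> end_sign L a = - end_sign L b"
    and end_start_sign: "\<lbrakk>a \<in> arcs (quiver L); b \<in> arcs (quiver L);
      head (quiver L) a = tail (quiver L) b; [a, b] \<notin> rels L\<rbrakk> \<Longrightarrow> end_sign L a = - start_sign L b"

fun src :: "('v, 'e) string_data \<Rightarrow> 'e letter \<Rightarrow> 'v" where
  "src L (Dir a) = tail (quiver L) a"
| "src L (Inv a) = head (quiver L) a"

fun tgt :: "('v, 'e) string_data \<Rightarrow> 'e letter \<Rightarrow> 'v" where
  "tgt L (Dir a) = head (quiver L) a"
| "tgt L (Inv a) = tail (quiver L) a"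

fun lstart :: "('v, 'e) string_data \<Rightarrow> 'e letter \<Rightarrow> int" where
  "lstart L (Dir a) = start_sign L a"
| "lstart L (Inv a) = end_sign L a"

fun lend :: "('v, 'e) string_data \<Rightarrow> 'e letter \<Rightarrow> int" where
  "lend L (Dir a) = end_sign L a"
| "lend L (Inv a) = start_sign L a"

definition syllables :: "('v, 'e) string_data \<Rightarrow> 'e letter set" where
  "syllables L = signed (arcs (quiver L))"

definition finite_string :: "('v, 'e) string_data \<Rightarrow> 'e letter list \<Rightarrow> bool" where
  "finite_string L ws \<longleftrightarrow> ws \<noteq> [] \<and> set ws \<subseteq> syllables L \<and>
     successively (\<lambda>b c. tgt L b = src L c \<and> b \<noteq> linv c) ws \<and>
     (\<forall>us. sublist us ws \<longrightarrow> us \<notin> map Dir ` rels L \<and> rev (map linv us) \<notin> map Dir ` rels L)"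

text \<open>\<open>Triv v i\<close> is the zero-length string \<open>1\<^bsub>(v,i)\<^esub>\<close>; \<open>Seq\<close> is for strings with at least one syllable.\<close>

datatype ('v, 'e) qstring = Triv 'v int | Seq "'e letter word"

definition trivial_strings :: "('v, 'e) string_data \<Rightarrow> ('v, 'e) qstring set" where
  "trivial_strings L = {Triv v i | v i. v \<in> verts (quiver L) \<and> i \<in> {-1, 1}}"

definition infinite_word :: "'b word \<Rightarrow> bool" where
  "infinite_word w \<longleftrightarrow> (\<forall>ws. w \<noteq> Finite ws)"

definition strings :: "('v, 'e) string_data \<Rightarrow> ('v, 'e) qstring set" where
  "strings L = trivial_strings L
     \<union> {Seq (Finite ws) | ws. finite_string L ws}
     \<union> {Seq w | w. infinite_word w \<and>
          (\<forall>p us. us \<noteq> [] \<and> (\<forall>k < length us. letter_at w (p + int k) = Some (us ! k)) \<longrightarrow> finite_string L us)}"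

fun is_finite :: "('v, 'e) qstring \<Rightarrow> bool" where
  "is_finite (Triv v i) \<longleftrightarrow> True"
| "is_finite (Seq w) \<longleftrightarrow> \<not> infinite_word w"

fun aperiodic_string :: "('v, 'e) qstring \<Rightarrow> bool" where
  "aperiodic_string (Triv v i) \<longleftrightarrow> True"
| "aperiodic_string (Seq w) \<longleftrightarrow> aperiodic w"


section \<open>Representations, string modules and bricks\<close>

text \<open>
  A representation is given by subspaces \<open>space V v\<close> of an ambient vector space with scalar
  multiplication \<open>scl V\<close>, and by maps \<open>act V a\<close> between them.
\<close>

record ('k, 'v, 'e, 'm) quiver_rep =
  scl :: "'k \<Rightarrow> 'm \<Rightarrow> 'm"
  space :: "'v \<Rightarrow> 'm set"
  act :: "'e \<Rightarrow> 'm \<Rightarrow> 'm"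

definition linear_between :: "('k \<Rightarrow> 'm \<Rightarrow> 'm) \<Rightarrow> 'm set \<Rightarrow> 'm set \<Rightarrow> ('m::ab_group_add \<Rightarrow> 'm) \<Rightarrow> bool" where
  "linear_between s X Y f \<longleftrightarrow> f ` X \<subseteq> Y \<and>
     (\<forall>x \<in> X. \<forall>y \<in> X. f (x + y) = f x + f y) \<and> (\<forall>c. \<forall>x \<in> X. f (s c x) = s c (f x))"

definition representation ::
    "('v, 'e) string_data \<Rightarrow> ('k::field, 'v, 'e, 'm::ab_group_add) quiver_rep \<Rightarrow> bool" where
  "representation L V \<longleftrightarrow> vector_space (scl V) \<and>
     (\<forall>v \<in> verts (quiver L). Modules.module.subspace (scl V) (space V v)) \<and>
     (\<forall>a \<in> arcs (quiver L).
        linear_between (scl V) (space V (tail (quiver L) a)) (space V (head (quiver L) a)) (act V a)) \<and>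
     (\<forall>r \<in> rels L. \<forall>x \<in> space V (tail (quiver L) (hd r)). fold (act V) r x = 0)"

definition endomorphisms ::
    "('v, 'e) string_data \<Rightarrow> ('k::field, 'v, 'e, 'm::ab_group_add) quiver_rep \<Rightarrow> ('v \<Rightarrow> 'm \<Rightarrow> 'm) set" where
  "endomorphisms L V = {f \<in> (\<Pi>\<^sub>E v \<in> verts (quiver L). space V v \<rightarrow>\<^sub>E space V v).
     (\<forall>v \<in> verts (quiver L). linear_between (scl V) (space V v) (space V v) (f v)) \<and>
     (\<forall>a \<in> arcs (quiver L). \<forall>x \<in> space V (tail (quiver L) a).
        f (head (quiver L) a) (act V a x) = act V a (f (tail (quiver L) a) x))}"

definition endomorphism_algebra ::
    "('v, 'e) string_data \<Rightarrow> ('k::field, 'v, 'e, 'm::ab_group_add) quiver_rep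
      \<Rightarrow> ('k, 'v \<Rightarrow> 'm \<Rightarrow> 'm) module" where
  "endomorphism_algebra L V =
     \<lparr> carrier = endomorphisms L V,
       monoid.mult = (\<lambda>f g. \<lambda>v \<in> verts (quiver L). \<lambda>x \<in> space V v. f v (g v x)),
       one = (\<lambda>v \<in> verts (quiver L). \<lambda>x \<in> space V v. x),
       zero = (\<lambda>v \<in> verts (quiver L). \<lambda>x \<in> space V v. 0),
       add = (\<lambda>f g. \<lambda>v \<in> verts (quiver L). \<lambda>x \<in> space V v. f v x + g v x),
       smult = (\<lambda>c f. \<lambda>v \<in> verts (quiver L). \<lambda>x \<in> space V v. scl V c (f v x)) \<rparr>"

definition ground_algebra :: "('k::field, 'k) module" where
  "ground_algebra =
     \<lparr> carrier = UNIV, monoid.mult = (*), one = 1, zero = 0, add = (+), smult = (*) \<rparr>"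

definition algebra_isomorphic :: "('k, 'a) module \<Rightarrow> ('k, 'b) module \<Rightarrow> bool" where
  "algebra_isomorphic A B \<longleftrightarrow>
     (\<exists>h \<in> ring_iso A B. \<forall>c. \<forall>x \<in> carrier A. h (smult A c x) = smult B c (h x))"

definition brick ::
    "('v, 'e) string_data \<Rightarrow> ('k::field, 'v, 'e, 'm::ab_group_add) quiver_rep \<Rightarrow> bool" where
  "brick L V \<longleftrightarrow> representation L V \<and> algebra_isomorphic (endomorphism_algebra L V) ground_algebra"

fun syllable_at :: "('v, 'e) qstring \<Rightarrow> int \<Rightarrow> 'e letter option" where
  "syllable_at (Triv v i) p = None"
| "syllable_at (Seq w) p = letter_at w p"

fun gaps_over :: "('v, 'e) string_data \<Rightarrow> ('v, 'e) qstring \<Rightarrow> 'v \<Rightarrow> int set" where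
  "gaps_over L (Triv u i) v = (if v = u then {0} else {})"
| "gaps_over L (Seq w) v =
     {p. (\<exists>b. letter_at w p = Some b \<and> src L b = v) \<or> (\<exists>b. letter_at w (p - 1) = Some b \<and> tgt L b = v)}"

text \<open>The basis vector at the gap \<open>p\<close> is \<open>Poly_Mapping.single p 1\<close>.\<close>

definition basis_act :: "('v, 'e) qstring \<Rightarrow> 'e \<Rightarrow> int \<Rightarrow> int \<Rightarrow>\<^sub>0 'k::field" where
  "basis_act x a p =
     (if syllable_at x p = Some (Dir a) then Poly_Mapping.single (p + 1) 1
      else if syllable_at x (p - 1) = Some (Inv a) then Poly_Mapping.single (p - 1) 1
      else 0)"

definition pscale :: "'k::field \<Rightarrow> (int \<Rightarrow>\<^sub>0 'k) \<Rightarrow> (int \<Rightarrow>\<^sub>0 'k)" where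
  "pscale c = Poly_Mapping.map ((*) c)"

definition string_module ::
    "('v, 'e) string_data \<Rightarrow> ('v, 'e) qstring \<Rightarrow> ('k::field, 'v, 'e, int \<Rightarrow>\<^sub>0 'k) quiver_rep" where
  "string_module L x =
     \<lparr> scl = pscale,
       space = (\<lambda>v. {f. Poly_Mapping.keys f \<subseteq> gaps_over L x v}),
       act = (\<lambda>a f. \<Sum>p \<in> Poly_Mapping.keys f. pscale (Poly_Mapping.lookup f p) (basis_act x a p)) \<rparr>"


section \<open>The automata of a string algebra\<close>

text \<open>States are finite strings; \<open>letters\<close> is only applied to these.\<close>

fun letters :: "('v, 'e) qstring \<Rightarrow> 'e letter list" where
  "letters (Triv v i) = []"
| "letters (Seq (Finite ws)) = ws"

definition aut_states :: "('v, 'e) string_data \<Rightarrow> ('v, 'e) qstring set" where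
  "aut_states L = trivial_strings L
     \<union> {Seq (Finite [b]) | b. b \<in> syllables L}
     \<union> {Seq (Finite ys) | ys. finite_string L ys \<and>
          (\<exists>r \<in> rels L. strict_prefix ys (map Dir r) \<or> strict_prefix ys (rev (map Inv r)))}"

fun extendable :: "('v, 'e) string_data \<Rightarrow> ('v, 'e) qstring \<Rightarrow> 'e letter \<Rightarrow> bool" where
  "extendable L (Triv v i) b \<longleftrightarrow> finite_string L [b] \<and> src L b = v \<and> lstart L b = - i"
| "extendable L (Seq (Finite ws)) b \<longleftrightarrow> finite_string L (ws @ [b])"
| "extendable L _ b \<longleftrightarrow> False"

definition aut_trans ::
    "('v, 'e) string_data \<Rightarrow> ('v, 'e) qstring \<Rightarrow> 'e letter \<Rightarrow> ('v, 'e) qstring option" where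
  "aut_trans L x b =
     (if x \<in> aut_states L \<and> extendable L x b
      then Some (Seq (Finite (ARG_MAX length ys.
             suffix ys (letters x @ [b]) \<and> Seq (Finite ys) \<in> aut_states L)))
      else None)"

fun aut_entry :: "('v, 'e) string_data \<Rightarrow> ('v, 'e) qstring \<Rightarrow> ('v, 'e) qstring" where
  "aut_entry L (Triv v i) = Triv v i"
| "aut_entry L (Seq (Finite ws)) = Triv (tgt L (last ws)) (lend L (last ws))"

fun aut_bar :: "('v, 'e) qstring \<Rightarrow> ('v, 'e) qstring" where
  "aut_bar (Triv v i) = Triv v (- i)"

definition string_mia :: "('v, 'e) string_data \<Rightarrow> (('v, 'e) qstring, 'e) mia" where
  "string_mia L =
     \<lparr> states = aut_states L, initial = trivial_strings L, entry = aut_entry L, bar = aut_bar,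
       alphabet = arcs (quiver L), trans = aut_trans L \<rparr>"

text \<open>
  \<open>represents L W x\<close> says that the two parts of \<open>W\<close> multiply to \<open>x\<close>; zero-length strings, which
  have no syllables, are told apart by the base point.
\<close>

fun represents :: "('v, 'e) string_data \<Rightarrow> (('v, 'e) qstring, 'e) mword \<Rightarrow> ('v, 'e) qstring \<Rightarrow> bool" where
  "represents L (l, q, r) (Triv v i) \<longleftrightarrow> (l, q, r) = (HFin [], Triv v i, HFin [])"
| "represents L (l, q, r) (Seq w) \<longleftrightarrow> same_word (glue l r) w"

definition word_class ::
    "('v, 'e) string_data \<Rightarrow> ('v, 'e) qstring \<Rightarrow> (('v, 'e) qstring, 'e) mword set" where
  "word_class L x = {W. \<exists>W' \<in> words (string_mia L). represents L W' x \<and> sim (string_mia L) W W'}"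

text \<open>The letter \<open>0\<close> is \<open>Dir 0\<close>, and \<open>1 = 0\<inverse>\<close> is \<open>Inv 0\<close>.\<close>

definition delta :: "'e \<Rightarrow> nat" where
  "delta a = 0"

definition delta_mia :: "('v, 'e) string_data \<Rightarrow> (('v, 'e) qstring, nat) mia" where
  "delta_mia L =
     \<lparr> states = aut_states L, initial = trivial_strings L, entry = aut_entry L, bar = aut_bar,
       alphabet = {0},
       trans = (\<lambda>x c.
         if \<exists>b. aut_trans L x b \<noteq> None \<and> map_letter delta b = c
         then aut_trans L x (THE b. aut_trans L x b \<noteq> None \<and> map_letter delta b = c)
         else None) \<rparr>"

fun Phi :: "('q, 'e) mword \<Rightarrow> ('q, nat) mword" where
  "Phi (l, v, r) = (map_hword (map_letter delta) l, v, map_hword (map_letter delta) r)"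

text \<open>The two automata are indeed multi-entry inverse automata.\<close>

lemma linv_linv [simp]: "linv (linv b) = b"
  by (cases b) auto

lemma extendable_entry:
  assumes "string_algebra L" "x \<in> aut_states L" "extendable L x b"
  shows "b \<in> syllables L"
    and "aut_entry L x \<in> trivial_strings L"
    and "extendable L (aut_entry L x) b"
proof -
  interpret string_algebra L by fact
  have "b \<in> syllables L \<and> aut_entry L x \<in> trivial_strings L \<and> extendable L (aut_entry L x) b"
  proof (cases x)
    case (Triv v i)
    then show ?thesis
      using assms by (auto simp: aut_states_def finite_string_def trivial_strings_def)
  next
    case (Seq w)
    then obtain ws where x: "x = Seq (Finite ws)"
      using assms(3) by (cases w) auto
    have ne: "ws \<noteq> []"
      using assms(2) by (auto simp: x aut_states_def trivial_strings_def finite_string_def)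
    then obtain us c where ws: "ws = us @ [c]"
      by (cases ws rule: rev_cases) auto
    have fs: "finite_string L (us @ [c, b])"
      using assms(3) by (simp add: x ws)
    then have cb: "c \<in> syllables L" "b \<in> syllables L"
      by (auto simp: finite_string_def)
    have 1: "tgt L c = src L b" "c \<noteq> linv b"
      using fs by (auto simp: finite_string_def successively_append_iff)
    have sub: "sublist [c, b] (us @ [c, b])" "sublist [b] (us @ [c, b])"
      by (auto simp: sublist_def intro: exI[of _ "us @ [c]"])
    have avoid: "zs \<notin> map Dir ` rels L \<and> rev (map linv zs) \<notin> map Dir ` rels L"
      if "sublist zs (us @ [c, b])" for zs
      using fs that unfolding finite_string_def by blast
    have nr: "[c, b] \<notin> map Dir ` rels L" "[linv b, linv c] \<notin> map Dir ` rels L"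
      using avoid[OF sub(1)] by simp_all
    have "zs \<notin> map Dir ` rels L \<and> rev (map linv zs) \<notin> map Dir ` rels L" if "sublist zs [b]" for zs
    proof -
      have "length zs < 2"
        using sublist_length_le[OF that] by simp
      moreover have "2 \<le> length us" if "us \<in> map Dir ` rels L" for us
        using that rels_paths by auto
      ultimately show ?thesis
        by (metis length_map length_rev not_le)
    qed
    then have fb: "finite_string L [b]"
      using cb by (simp add: finite_string_def)
    have "lend L c = - lstart L b"
    proof (cases c; cases b)
      fix a a' assume "c = Dir a" "b = Dir a'"
      then show ?thesis
        using 1 cb nr(1) imageI[of "[a, a']" "rels L" "map Dir"]
        by (auto simp: syllables_def signed_def intro!: end_start_sign)
    next
      fix a a' assume "c = Dir a" "b = Inv a'"
      then show ?thesis
        using 1 cb by (auto simp: syllables_def signed_def intro!: end_sign_neq)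
    next
      fix a a' assume "c = Inv a" "b = Dir a'"
      then show ?thesis
        using 1 cb by (auto simp: syllables_def signed_def intro!: start_sign_neq)
    next
      fix a a' assume "c = Inv a" "b = Inv a'"
      then have "end_sign L a' = - start_sign L a"
        using 1 cb nr(2) imageI[of "[a', a]" "rels L" "map Dir"]
        by (auto simp: syllables_def signed_def intro!: end_start_sign)
      then show ?thesis
        using \<open>c = Inv a\<close> \<open>b = Inv a'\<close> by simp
    qed
    moreover have "Triv (tgt L c) (lend L c) \<in> trivial_strings L"
      using cb(1) signs
      by (cases c) (auto simp: syllables_def signed_def trivial_strings_def)
    ultimately show ?thesis
      using cb 1 fb by (simp add: x ws)
  qed
  then show "b \<in> syllables L" "aut_entry L x \<in> trivial_strings L" "extendable L (aut_entry L x) b"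
    by auto
qed

lemma aut_trans_SomeD:
  assumes "string_algebra L" "aut_trans L x b = Some y"
  shows "y \<in> aut_states L" and "aut_entry L y = Triv (tgt L b) (lend L b)"
proof -
  have x: "x \<in> aut_states L" "extendable L x b"
    using assms(2) by (auto simp: aut_trans_def split: if_splits)
  define P where "P ys \<longleftrightarrow> suffix ys (letters x @ [b]) \<and> Seq (Finite ys) \<in> aut_states L" for ys
  have y: "y = Seq (Finite (ARG_MAX length ys. P ys))"
    using assms(2) by (auto simp: aut_trans_def P_def split: if_splits)
  have "b \<in> syllables L"
    using extendable_entry[OF assms(1) x] by blast
  then have "P [b]"
    by (auto simp: P_def aut_states_def)
  moreover have "\<forall>ys. P ys \<longrightarrow> length ys < Suc (length (letters x @ [b]))"
    by (auto simp: P_def dest: suffix_length_le)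
  ultimately have "P (ARG_MAX length ys. P ys)"
    by (rule arg_max_natI)
  moreover have "Seq (Finite []) \<notin> aut_states L"
    by (auto simp: aut_states_def trivial_strings_def finite_string_def)
  ultimately obtain ys where ys: "y = Seq (Finite ys)" "ys \<noteq> []" "suffix ys (letters x @ [b])"
      "Seq (Finite ys) \<in> aut_states L"
    unfolding P_def y by fastforce
  from ys(2,3) have "last ys = b"
    by (auto simp: suffix_def dest!: arg_cong[where f = last])
  then show "y \<in> aut_states L" "aut_entry L y = Triv (tgt L b) (lend L b)"
    using ys by simp_all
qed

lemma finite_aut_states:
  assumes "string_algebra L"
  shows "finite (aut_states L)"
proof -
  interpret string_algebra L by fact
  have "finite (trivial_strings L)"
    unfolding trivial_strings_def
    by (rule finite_subset[of _ "case_prod Triv ` (verts (quiver L) \<times> {-1, 1})"]) auto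
  moreover have "finite (syllables L)"
    by (auto simp: syllables_def signed_def)
  then have "finite {Seq (Finite [b]) | b. b \<in> syllables L}"
    by (simp add: setcompr_eq_image)
  moreover have "finite ((\<lambda>ys. Seq (Finite ys)) ` (\<Union>r \<in> rels L.
      set (prefixes (map Dir r)) \<union> set (prefixes (rev (map Inv r)))))"
    using finite_rels by auto
  then have "finite {Seq (Finite ys) | ys. finite_string L ys \<and>
      (\<exists>r \<in> rels L. strict_prefix ys (map Dir r) \<or> strict_prefix ys (rev (map Inv r)))}"
    by (rule finite_subset[rotated]) (auto simp: image_iff strict_prefix_def)
  ultimately show ?thesis
    by (auto simp: aut_states_def)
qed

lemma aut_entry_initial:
  assumes "string_algebra L" "x \<in> aut_states L"
  shows "aut_entry L x \<in> trivial_strings L"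
proof -
  interpret string_algebra L by fact
  have "Triv (tgt L b) (lend L b) \<in> trivial_strings L" if "b \<in> syllables L" for b
    using that signs by (cases b) (auto simp: syllables_def signed_def trivial_strings_def)
  moreover have "last ys \<in> syllables L" if "finite_string L ys" for ys
    using that last_in_set[of ys] by (auto simp: finite_string_def)
  ultimately show ?thesis
    using assms(2) by (auto simp: aut_states_def trivial_strings_def)
qed

lemma aut_trans_entry:
  assumes "string_algebra L" "aut_trans L x b = Some y"
  shows "\<exists>y'. aut_trans L (aut_entry L x) b = Some y' \<and> aut_entry L y = aut_entry L y'"
proof -
  have x: "x \<in> aut_states L" "extendable L x b"
    using assms(2) by (auto simp: aut_trans_def split: if_splits)
  have "aut_entry L x \<in> aut_states L" "extendable L (aut_entry L x) b"
    using extendable_entry[OF assms(1) x] by (auto simp: aut_states_def)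
  then obtain y' where y': "aut_trans L (aut_entry L x) b = Some y'"
    by (auto simp: aut_trans_def)
  then show ?thesis
    using aut_trans_SomeD(2)[OF assms] aut_trans_SomeD(2)[OF assms(1) y'] by simp
qed

lemma mia_string_mia:
  assumes "string_algebra L"
  shows "mia (string_mia L)"
proof -
  interpret string_algebra L by fact
  show ?thesis
  proof
    fix x b y
    assume "trans (string_mia L) x b = Some y"
    then have *: "aut_trans L x b = Some y"
      by (simp add: string_mia_def)
    then have x: "x \<in> aut_states L" "extendable L x b"
      by (auto simp: aut_trans_def split: if_splits)
    show "x \<in> states (string_mia L) \<and> b \<in> signed (alphabet (string_mia L)) \<and> y \<in> states (string_mia L)"
      using x extendable_entry(1)[OF assms x] aut_trans_SomeD[OF assms *]
      by (auto simp: string_mia_def syllables_def)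
    show "\<exists>y'. trans (string_mia L) (entry (string_mia L) x) b = Some y' \<and>
        entry (string_mia L) y = entry (string_mia L) y'"
      using aut_trans_entry[OF assms *] by (simp add: string_mia_def)
  qed (use finite_aut_states[OF assms] aut_entry_initial[OF assms] in
      \<open>auto simp: string_mia_def aut_states_def trivial_strings_def\<close>)
qed

lemma delta_inj:
  assumes "string_algebra L"
  shows "inj_on (map_letter delta) {b. aut_trans L x b \<noteq> None}"
proof (rule inj_onI, clarsimp)
  interpret string_algebra L by fact
  fix b c y z
  assume *: "aut_trans L x b = Some y" "aut_trans L x c = Some z"
    and eq: "map_letter delta b = map_letter delta c"
  from * have x: "x \<in> aut_states L" "extendable L x b" "extendable L x c"
    by (auto simp: aut_trans_def split: if_splits)
  note b = extendable_entry[OF assms x(1,2)] and c = extendable_entry[OF assms x(1,3)]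
  from b(2) obtain v i where e: "aut_entry L x = Triv v i"
    by (auto simp: trivial_strings_def)
  have s: "src L b = src L c" "lstart L b = lstart L c" "b \<in> syllables L" "c \<in> syllables L"
    using b c by (auto simp: e)
  show "b = c"
  proof (cases b; cases c)
    fix a a' assume bc: "b = Dir a" "c = Dir a'"
    then have a: "a \<in> arcs (quiver L)" "a' \<in> arcs (quiver L)"
      using s by (auto simp: syllables_def signed_def)
    have "a = a'"
    proof (rule ccontr)
      assume "a \<noteq> a'"
      then have "start_sign L a = - start_sign L a'"
        using s bc start_sign_neq[OF a] by simp
      then show False
        using s bc signs[OF a(2)] by auto
    qed
    then show ?thesis
      using bc by simp
  next
    fix a a' assume bc: "b = Inv a" "c = Inv a'"
    then have a: "a \<in> arcs (quiver L)" "a' \<in> arcs (quiver L)"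
      using s by (auto simp: syllables_def signed_def)
    have "a = a'"
    proof (rule ccontr)
      assume "a \<noteq> a'"
      then have "end_sign L a = - end_sign L a'"
        using s bc end_sign_neq[OF a] by simp
      then show False
        using s bc signs[OF a(2)] by auto
    qed
    then show ?thesis
      using bc by simp
  qed (use eq in auto)
qed

lemma delta_trans:
  assumes "string_algebra L"
  shows "trans (delta_mia L) x c = Some y \<longleftrightarrow> (\<exists>b. map_letter delta b = c \<and> aut_trans L x b = Some y)"
proof -
  have the: "(THE b. aut_trans L x b \<noteq> None \<and> map_letter delta b = c) = b"
    if "aut_trans L x b \<noteq> None" "map_letter delta b = c" for b
    using that inj_onD[OF delta_inj[OF assms, of x]] by (intro the_equality) auto
  show ?thesis
  proof (cases "\<exists>b. aut_trans L x b \<noteq> None \<and> map_letter delta b = c")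
    case True
    then obtain b where b: "aut_trans L x b \<noteq> None" "map_letter delta b = c"
      by blast
    have "trans (delta_mia L) x c = aut_trans L x b"
      unfolding delta_mia_def mia.select_convs if_P[OF True] the[OF b] ..
    moreover have "b' = b" if "aut_trans L x b' \<noteq> None" "map_letter delta b' = c" for b'
      using the[OF b] the[OF that] by argo
    ultimately show ?thesis
      using b by (metis option.distinct(1))
  next
    case False
    then have "trans (delta_mia L) x c = None"
      unfolding delta_mia_def mia.select_convs by (rule if_not_P)
    then show ?thesis
      using False by (metis option.distinct(1))
  qed
qed

lemma mia_delta_mia:
  assumes "string_algebra L"
  shows "mia (delta_mia L)"
proof -
  interpret S: mia "string_mia L"
    by (rule mia_string_mia) fact
  show ?thesis
  proof
    fix x c y
    assume "trans (delta_mia L) x c = Some y"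
    then obtain b where b: "map_letter delta b = c" "aut_trans L x b = Some y"
      using delta_trans[OF assms] by blast
    then show "x \<in> states (delta_mia L) \<and> c \<in> signed (alphabet (delta_mia L)) \<and> y \<in> states (delta_mia L)"
      using S.trans_states[of x b y]
      by (cases b) (auto simp: string_mia_def delta_mia_def signed_def delta_def)
    obtain y' where "aut_trans L (aut_entry L x) b = Some y'" "aut_entry L y = aut_entry L y'"
      using aut_trans_entry[OF assms b(2)] by blast
    then show "\<exists>y'. trans (delta_mia L) (entry (delta_mia L) x) c = Some y' \<and>
        entry (delta_mia L) y = entry (delta_mia L) y'"
      using b(1) delta_trans[OF assms] by (auto simp: delta_mia_def)
  qed (use finite_aut_states[OF assms] aut_entry_initial[OF assms] in
      \<open>auto simp: delta_mia_def aut_states_def trivial_strings_def\<close>)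
qed

end

theory Submission
  imports Defs
begin

text \<open>
Why the theorem holds. A word \<open>(w\<^sup>l, v, w\<^sup>r)\<close> over either automaton marks a gap of a string: the
base point \<open>v\<close> records the vertex at the gap and a sign that orients the string there. By the sign
conditions, \<open>v\<close> together with the direction (direct or inverse) of the next letter determines this
letter, so nothing is lost when letters are replaced by \<open>0\<close> and \<open>1\<close>. For this reason the words in
\<open>\<Phi>(W(x))\<close> are exactly the marked gaps of \<open>x\<close>, and the relation \<open>\<sim>\<close> only moves the mark
(\<open>sim_based_iff\<close>, \<open>word_class_eq\<close>).

Both sides of the theorem are compared with one combinatorial notion. An overlap of two lines of
letters is an interval of gaps of the first line and a shift \<open>d\<close> that carries it to an interval
of gaps of the second line with the same base points and the same letters, such that no arrow of
the first line enters the interval from outside and no arrow of the second line leaves its copy.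
The claim is that \<open>M(x)\<close> is a brick, and that the words of \<open>x\<close> are brick words, exactly if \<open>x\<close> has neither an
overlap with itself with \<open>d \<noteq> 0\<close> nor an overlap with its inverse.

For words (\<open>brick_word_based_iff\<close>), an overlap is literally a common factor subword and image
subword. What has to be excluded is that it is the whole word on both sides. A string is never
equal to its inverse, since the middle letter or the middle gap would be inverse to itself; and a
shift \<open>d \<noteq> 0\<close> that moves an unbounded interval would make an end of the string periodic.
Aperiodicity is passed to the words over \<open>{0}\<close> by the pigeonhole principle for base points
(\<open>eventually_periodic_delta\<close>).

For modules (\<open>brick_iff_no_overlap\<close>), an overlap yields an endomorphism that sends the basis vectors
of the interval to those of its copy and the other ones to \<open>0\<close>, and this is not a scalar. In the
other direction, let \<open>c q p\<close> be the matrix coefficients of an endomorphism. Commuting with the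
arrows says that \<open>c q p\<close> does not change when both gaps are moved along the same arrow, and that it
vanishes if some arrow ends at \<open>p\<close> but not at \<open>q\<close>, or starts at \<open>q\<close> but not at \<open>p\<close>. If the endomorphism
is not a scalar, then some \<open>c q p\<close> with \<open>p \<noteq> q\<close> is nonzero; the largest interval around \<open>p\<close> on
which the letters agree with those around \<open>q\<close> is then an overlap (\<open>overlap_of_coefficients\<close>).
\<close>

section \<open>Half words\<close>

text \<open>
Half words are compared letter by letter through this partial function. Infinite and finite half
words then need no separate treatment, because all relations between half words have a pointwise
description.
\<close>

fun hnth :: "'b hword \<Rightarrow> nat \<Rightarrow> 'b option" where
  "hnth (HFin us) n = (if n < length us then Some (us ! n) else None)"
| "hnth (HInf s) n = Some (s !! n)"

lemma hword_eqI:
  assumes "\<And>n. hnth h n = hnth k n"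
  shows "h = k"
proof (cases h; cases k)
  fix us ws assume *: "h = HFin us" "k = HFin ws"
  have eq: "(if n < length us then Some (us ! n) else None) =
      (if n < length ws then Some (ws ! n) else None)" for n
    using assms[of n] by (simp add: *)
  have "length us = length ws"
    using eq[of "length us"] eq[of "length ws"] by (auto split: if_splits)
  moreover have "us ! n = ws ! n" if "n < length us" for n
    using eq[of n] that \<open>length us = length ws\<close> by simp
  ultimately show ?thesis
    by (simp add: * list_eq_iff_nth_eq)
next
  fix us s assume "h = HFin us" "k = HInf s"
  then show ?thesis
    using assms[of "length us"] by simp
next
  fix us s assume "h = HInf s" "k = HFin us"
  then show ?thesis
    using assms[of "length us"] by simp
next
  fix s t assume *: "h = HInf s" "k = HInf t"
  have "(!!) s = (!!) t"
    using assms * by (intro ext) simp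
  then show ?thesis
    using * stream_smap_nats[of s] stream_smap_nats[of t] by simp
qed

lemma hnth_None_mono: "hnth h m = None \<Longrightarrow> m \<le> n \<Longrightarrow> hnth h n = None"
  by (cases h) (auto split: if_splits)

lemma hnth_happend:
  "hnth (happend us h) n = (if n < length us then Some (us ! n) else hnth h (n - length us))"
  by (cases h) (auto simp: nth_append shift_snth)

lemma hnth_map: "hnth (map_hword f h) n = map_option f (hnth h n)"
  by (cases h) auto

lemma hprefix_iff: "hprefix h k \<longleftrightarrow> (\<forall>n. hnth h n \<noteq> None \<longrightarrow> hnth k n = hnth h n)"
proof
  assume "hprefix h k"
  then show "\<forall>n. hnth h n \<noteq> None \<longrightarrow> hnth k n = hnth h n"
    by (auto simp: hprefix_def hnth_happend)
next
  assume *: "\<forall>n. hnth h n \<noteq> None \<longrightarrow> hnth k n = hnth h n"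
  show "hprefix h k"
  proof (cases h)
    case (HInf s)
    then have "h = k"
      using * by (intro hword_eqI) auto
    then show ?thesis
      by (simp add: hprefix_def)
  next
    case (HFin us)
    have len: "n < length us \<Longrightarrow> hnth k n = Some (us ! n)" for n
      using * by (simp add: HFin)
    have "\<exists>k'. k = happend us k'"
    proof (cases k)
      case k: (HFin ws)
      have "length us \<le> length ws"
      proof (rule ccontr)
        assume "\<not> length us \<le> length ws"
        then show False
          using len[of "length ws"] by (simp add: k)
      qed
      moreover have "us ! n = ws ! n" if "n < length us" for n
        using len[OF that] that by (simp add: k split: if_splits)
      ultimately have "ws = us @ drop (length us) ws"
        by (intro nth_equalityI) (auto simp: nth_append)
      then have "k = happend us (HFin (drop (length us) ws))"
        by (simp add: k)
      then show ?thesis ..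
    next
      case k: (HInf s)
      have "us = stake (length us) s"
        using len by (intro nth_equalityI) (auto simp: k)
      then have "s = us @- sdrop (length us) s"
        by (metis stake_sdrop)
      then have "k = happend us (HInf (sdrop (length us) s))"
        by (simp add: k)
      then show ?thesis ..
    qed
    then show ?thesis
      by (auto simp: hprefix_def HFin)
  qed
qed

text \<open>
This characterises the length \<open>n\<close> of a finite half word by the values of \<open>hnth\<close> alone; no \<open>n\<close>
satisfies it for an infinite half word.
\<close>

definition hend :: "'b hword \<Rightarrow> nat \<Rightarrow> bool" where
  "hend h n \<longleftrightarrow> (\<forall>m. hnth h m = None \<longleftrightarrow> n \<le> m)"

lemma hend_HFin [simp]: "hend (HFin us) n \<longleftrightarrow> n = length us"
proof
  assume *: "hend (HFin us) n"
  have "length us \<le> m \<longleftrightarrow> n \<le> m" for m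
    using *[unfolded hend_def, rule_format, of m] by (auto split: if_splits)
  then show "n = length us"
    by (meson le_antisym le_refl)
qed (auto simp: hend_def)

lemma hend_HInf [simp]: "\<not> hend (HInf s) n"
  by (auto simp: hend_def)

lemma hnext_iff: "hnext h c k \<longleftrightarrow> hprefix h k \<and> (\<exists>n. hend h n \<and> hnth k n = Some c)"
proof (cases h)
  case (HFin us)
  have "hprefix (HFin (us @ [c])) k \<longleftrightarrow> hprefix (HFin us) k \<and> hnth k (length us) = Some c"
    unfolding hprefix_iff by (auto simp: nth_append less_Suc_eq)
  then show ?thesis
    by (simp add: hnext_def HFin)
qed (simp add: hnext_def)

lemma hprefix_eq_iff:
  assumes "hprefix h k"
  shows "h = k \<longleftrightarrow> (\<forall>n. hend h n \<longrightarrow> hnth k n = None)"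
proof
  assume *: "\<forall>n. hend h n \<longrightarrow> hnth k n = None"
  show "h = k"
  proof (rule hword_eqI)
    fix m
    show "hnth h m = hnth k m"
    proof (cases "hnth h m")
      case None
      then obtain us where us: "h = HFin us" "length us \<le> m"
        by (cases h) (auto split: if_splits)
      then have "hnth k (length us) = None"
        using * by simp
      then show ?thesis
        using None us hnth_None_mono by metis
    qed (use assms in \<open>auto simp: hprefix_iff\<close>)
  qed
qed (auto simp: hend_def)

text \<open>
The definitions of factor and image subwords distinguish whether the smaller word reaches the end
of the larger one or stops in front of a letter of the right kind. In terms of \<open>hnth\<close> this is a
single condition on the first letter left out.
\<close>

lemma stops_iff:
  assumes "hprefix h k"
  shows "h = k \<or> (\<exists>b \<in> A. hnext h (D b) k) \<longleftrightarrow>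
    (\<forall>n. hend h n \<longrightarrow> hnth k n = None \<or> (\<exists>b \<in> A. hnth k n = Some (D b)))"
proof -
  have "n = m" if "hend h n" "hend h m" for n m
    using that by (cases h) auto
  then show ?thesis
    using assms unfolding hnext_iff hprefix_eq_iff[OF assms] by fastforce
qed

definition hword_of :: "(nat \<Rightarrow> 'b option) \<Rightarrow> 'b hword" where
  "hword_of g = (if \<exists>n. g n = None then HFin (map (the \<circ> g) [0..<LEAST n. g n = None])
     else HInf (smap (the \<circ> g) nats))"

lemma hnth_hword_of:
  assumes "\<And>m n. g m = None \<Longrightarrow> m \<le> n \<Longrightarrow> g n = None"
  shows "hnth (hword_of g) n = g n"
proof (cases "\<exists>n. g n = None")
  case True
  define m where "m = (LEAST n. g n = None)"
  have "g m = None"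
    unfolding m_def using True by (rule LeastI_ex)
  moreover have "\<exists>y. g n = Some y" if "n < m" for n
    using that not_less_Least unfolding m_def by fastforce
  ultimately show ?thesis
    using True assms[of m n] unfolding hword_of_def m_def[symmetric]
    by (cases "n < m") auto
next
  case False
  have "hword_of g = HInf (smap (the \<circ> g) nats)"
    unfolding hword_of_def by (rule if_not_P) (rule False)
  moreover obtain b where "g n = Some b"
    using False by (metis not_None_eq)
  ultimately show ?thesis
    by simp
qed

text \<open>
The four cases of the definition are the products of two independent conditions, one for each side.
\<close>

lemma factor_subword_iff:
  "factor_subword M (l, v, r) w \<longleftrightarrow> (\<exists>l' r'. sim M (l', v, r') w \<and> hprefix l l' \<and> hprefix r r' \<and>
     (\<forall>n. hend l n \<longrightarrow> hnth l' n = None \<or> (\<exists>b \<in> alphabet M. hnth l' n = Some (Inv b))) \<and>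
     (\<forall>n. hend r n \<longrightarrow> hnth r' n = None \<or> (\<exists>b \<in> alphabet M. hnth r' n = Some (Dir b))))"
proof -
  have "factor_subword M (l, v, r) w \<longleftrightarrow> (\<exists>l' r'. sim M (l', v, r') w \<and> hprefix l l' \<and> hprefix r r' \<and>
     (l = l' \<or> (\<exists>b \<in> alphabet M. hnext l (Inv b) l')) \<and>
     (r = r' \<or> (\<exists>b \<in> alphabet M. hnext r (Dir b) r')))"
    unfolding factor_subword_def occurs_as_def
    by (simp, intro ex_cong1) blast
  then show ?thesis
    by (simp add: stops_iff cong: conj_cong)
qed

lemma image_subword_iff:
  "image_subword M (l, v, r) w \<longleftrightarrow> (\<exists>l' r'. sim M (l', v, r') w \<and> hprefix l l' \<and> hprefix r r' \<and>
     (\<forall>n. hend l n \<longrightarrow> hnth l' n = None \<or> (\<exists>b \<in> alphabet M. hnth l' n = Some (Dir b))) \<and>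
     (\<forall>n. hend r n \<longrightarrow> hnth r' n = None \<or> (\<exists>b \<in> alphabet M. hnth r' n = Some (Inv b))))"
proof -
  have "image_subword M (l, v, r) w \<longleftrightarrow> (\<exists>l' r'. sim M (l', v, r') w \<and> hprefix l l' \<and> hprefix r r' \<and>
     (l = l' \<or> (\<exists>b \<in> alphabet M. hnext l (Dir b) l')) \<and>
     (r = r' \<or> (\<exists>b \<in> alphabet M. hnext r (Inv b) r')))"
    unfolding image_subword_def occurs_as_def
    by (simp, intro ex_cong1) blast
  then show ?thesis
    by (simp add: stops_iff cong: conj_cong)
qed

text \<open>
Factor and image subwords are subwords, so properness only concerns the relation \<open>\<sim>\<close>.
\<close>

lemma brick_word_iff:
  "brick_word M w \<longleftrightarrow> w \<in> words M \<and> aperiodic (glue (fst w) (snd (snd w))) \<and>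
     \<not> (\<exists>w' \<in> words M. \<exists>u \<in> {w, mword_inv M w}.
          factor_subword M w' w \<and> image_subword M w' u \<and> \<not> (sim M w' w \<and> sim M w' u))"
proof -
  have "factor_subword M w' u \<Longrightarrow> subword M w' u" "image_subword M w' u \<Longrightarrow> subword M w' u" for w' u
    unfolding subword_def factor_subword_def image_subword_def by blast+
  then have "factor_subword M w' w \<and> image_subword M w' u \<and> (proper_subword M w' w \<or> proper_subword M w' u)
    \<longleftrightarrow> factor_subword M w' w \<and> image_subword M w' u \<and> \<not> (sim M w' w \<and> sim M w' u)" for w' u
    unfolding proper_subword_def by blast
  then show ?thesis
    unfolding brick_word_def by (simp add: case_prod_beta)
qed

section \<open>Strings and the automata that read them\<close>

lemma successively_sym_rev:
  assumes "successively P us" "\<And>x y. P x y \<Longrightarrow> Q (g y) (g x)"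
  shows "successively Q (rev (map g us))"
  using assms(1)
  by (induction us rule: induct_list012) (auto simp: successively_append_iff assms(2))

lemma finite_string_inverse:
  assumes "finite_string L us"
  shows "finite_string L (rev (map linv us))"
proof -
  have inv: "rev (map linv (rev (map linv zs))) = zs" for zs :: "'b letter list"
    by (simp add: rev_map o_def)
  have syl: "linv b \<in> syllables L" if "b \<in> syllables L" for b
    using that by (auto simp: syllables_def signed_def)
  have "successively (\<lambda>b c. tgt L b = src L c \<and> b \<noteq> linv c) (rev (map linv us))"
  proof (rule successively_sym_rev)
    show "successively (\<lambda>b c. tgt L b = src L c \<and> b \<noteq> linv c) us"
      using assms by (simp add: finite_string_def)
    show "tgt L (linv c) = src L (linv b) \<and> linv c \<noteq> linv (linv b)"
      if "tgt L b = src L c \<and> b \<noteq> linv c" for b c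
      using that by (cases b; cases c) auto
  qed
  moreover have "zs \<notin> map Dir ` rels L \<and> rev (map linv zs) \<notin> map Dir ` rels L"
    if "sublist zs (rev (map linv us))" for zs
  proof -
    have "sublist (map linv zs) (rev us)"
      using map_mono_sublist[OF that, of linv] by (simp add: rev_map o_def)
    then have "sublist (rev (map linv zs)) us"
      by (simp add: sublist_rev_right)
    moreover have "ws \<notin> map Dir ` rels L \<and> rev (map linv ws) \<notin> map Dir ` rels L" if "sublist ws us" for ws
      using assms that unfolding finite_string_def by blast
    ultimately have "rev (map linv zs) \<notin> map Dir ` rels L"
        "rev (map linv (rev (map linv zs))) \<notin> map Dir ` rels L"
      by blast+
    then show ?thesis
      by (simp only: inv simp_thms)
  qed
  ultimately show ?thesis
    using assms syl unfolding finite_string_def by (auto simp: subset_iff)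
qed

lemma finite_string_sublist:
  assumes "finite_string L us" "sublist zs us" "zs \<noteq> []"
  shows "finite_string L zs"
proof -
  obtain xs ys where us: "us = xs @ zs @ ys"
    using assms(2) by (auto simp: sublist_def)
  have "set zs \<subseteq> syllables L"
    using assms(1) by (auto simp: finite_string_def us)
  moreover have "successively (\<lambda>b c. tgt L b = src L c \<and> b \<noteq> linv c) zs"
    using assms(1) by (auto simp: finite_string_def us successively_append_iff)
  moreover have "sublist ws us" if "sublist ws zs" for ws
    using that assms(2) by (rule sublist_order.order.trans)
  ultimately show ?thesis
    using assms(1,3) unfolding finite_string_def by blast
qed

context string_algebra
begin

text \<open>
The reason why the letters \<open>0\<close> and \<open>1\<close> suffice: two arrows that start at the same vertex with the same
sign are equal.
\<close>

lemma letter_eqI_src: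
  assumes "b \<in> syllables L" "c \<in> syllables L"
    and "src L b = src L c" "lstart L b = lstart L c" "map_letter delta b = map_letter delta c"
  shows "b = c"
proof (cases b; cases c)
  fix a a' assume bc: "b = Dir a" "c = Dir a'"
  then have a: "a \<in> arcs (quiver L)" "a' \<in> arcs (quiver L)"
    using assms by (auto simp: syllables_def signed_def)
  have "a = a'"
  proof (rule ccontr)
    assume "a \<noteq> a'"
    then have "start_sign L a = - start_sign L a'"
      using assms bc start_sign_neq[OF a] by simp
    then show False
      using assms bc signs[OF a(2)] by auto
  qed
  then show ?thesis
    using bc by simp
next
  fix a a' assume bc: "b = Inv a" "c = Inv a'"
  then have a: "a \<in> arcs (quiver L)" "a' \<in> arcs (quiver L)"
    using assms by (auto simp: syllables_def signed_def)
  have "a = a'"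
  proof (rule ccontr)
    assume "a \<noteq> a'"
    then have "end_sign L a = - end_sign L a'"
      using assms bc end_sign_neq[OF a] by simp
    then show False
      using assms bc signs[OF a(2)] by auto
  qed
  then show ?thesis
    using bc by simp
qed (use assms in auto)

lemma letter_eqI_tgt:
  assumes "b \<in> syllables L" "c \<in> syllables L"
    and "tgt L b = tgt L c" "lend L b = lend L c" "map_letter delta b = map_letter delta c"
  shows "b = c"
proof -
  have "linv b = linv c"
  proof (rule letter_eqI_src)
    show "map_letter delta (linv b) = map_letter delta (linv c)"
      using assms(5) by (cases b; cases c) auto
  qed (use assms in \<open>cases b; cases c; auto simp: syllables_def signed_def\<close>)+
  then show ?thesis
    by (metis linv_linv)
qed

end

lemma aut_trans_suffix:
  assumes "string_algebra L" "x \<in> aut_states L" "extendable L x b"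
  obtains ys where "aut_trans L x b = Some (Seq (Finite ys))" "ys \<noteq> []"
    "suffix ys (letters x @ [b])" "Seq (Finite ys) \<in> aut_states L"
proof -
  define P where "P ys \<longleftrightarrow> suffix ys (letters x @ [b]) \<and> Seq (Finite ys) \<in> aut_states L" for ys
  have "b \<in> syllables L"
    using extendable_entry[OF assms] by blast
  then have "P [b]"
    by (auto simp: P_def aut_states_def)
  moreover have "\<forall>ys. P ys \<longrightarrow> length ys < Suc (length (letters x @ [b]))"
    by (auto simp: P_def dest: suffix_length_le)
  ultimately have "P (ARG_MAX length ys. P ys)"
    by (rule arg_max_natI)
  then have max: "suffix (ARG_MAX length ys. P ys) (letters x @ [b])"
      "Seq (Finite (ARG_MAX length ys. P ys)) \<in> aut_states L"
    by (simp_all add: P_def)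
  moreover have "Seq (Finite []) \<notin> aut_states L"
    by (auto simp: aut_states_def trivial_strings_def finite_string_def)
  then have "(ARG_MAX length ys. P ys) \<noteq> []"
    using max(2) by metis
  moreover have "aut_trans L x b = Some (Seq (Finite (ARG_MAX length ys. P ys)))"
    using assms(2,3) by (simp add: aut_trans_def P_def)
  ultimately show ?thesis
    by (intro that)
qed

text \<open>
The automaton of the string algebra and its image under \<open>\<delta>\<close> differ only in the names \<open>f b\<close> of
their letters. Everything about words and their base points is proved for both of them at once.
\<close>

locale reader =
  fixes L :: "('v, 'e) string_data" and M :: "(('v, 'e) qstring, 'c) mia"
    and f :: "'e letter \<Rightarrow> 'c letter"
  assumes alg: "string_algebra L"
    and trans_iff: "trans M x c = Some y \<longleftrightarrow> (\<exists>b. f b = c \<and> aut_trans L x b = Some y)"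
    and M_entry: "entry M = aut_entry L"
    and M_bar: "bar M = aut_bar"
    and M_initial: "initial M = trivial_strings L"
    and f_linv: "f (linv b) = linv (f b)"
    and f_delta: "f b = f b' \<Longrightarrow> map_letter delta b = map_letter delta b'"

lemma reader_string_mia:
  assumes "string_algebra L"
  shows "reader L (string_mia L) id"
  by (rule reader.intro[OF assms]) (auto simp: string_mia_def)

lemma reader_delta_mia:
  assumes "string_algebra L"
  shows "reader L (delta_mia L) (map_letter delta)"
proof (rule reader.intro[OF assms])
  show "map_letter delta (linv b) = linv (map_letter delta b)" for b :: "'b letter"
    by (cases b) auto
  show "trans (delta_mia L) x c = Some y \<longleftrightarrow> (\<exists>b. map_letter delta b = c \<and> aut_trans L x b = Some y)" for x c y
    by (rule delta_trans[OF assms])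
qed (auto simp: delta_mia_def)

lemma run_Nil [simp]: "run M v [] = Some v"
  by (simp add: run_def)

lemma run_snoc: "run M v (us @ [b]) = Option.bind (run M v us) (\<lambda>u. trans M u b)"
  by (simp add: run_def)

sublocale reader \<subseteq> string_algebra L
  by (rule alg)

context reader
begin

text \<open>
The state reached is a suffix \<open>ys\<close> of what has been read. So \<open>ys @ [b]\<close> is a part of a string and
hence a string whenever \<open>b\<close> is the next letter, and the automaton can read on.
\<close>

lemma run_finite_string:
  assumes "finite_string L us" "v = Triv (src L (hd us)) (- lstart L (hd us))"
  shows "\<exists>ys. run M v (map f us) = Some (Seq (Finite ys)) \<and> ys \<noteq> [] \<and> suffix ys us \<and>
    Seq (Finite ys) \<in> aut_states L"
  using assms
proof (induction us rule: rev_induct)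
  case (snoc b us)
  have "\<exists>x. run M v (map f us) = Some x \<and> x \<in> aut_states L \<and> extendable L x b \<and>
      suffix (letters x) us"
  proof (cases "us = []")
    case True
    then have "b \<in> syllables L"
      using snoc.prems by (simp add: finite_string_def)
    then have "v \<in> aut_states L"
      using signs snoc.prems True
      by (cases b) (auto simp: syllables_def signed_def aut_states_def trivial_strings_def)
    then show ?thesis
      using snoc.prems True by simp
  next
    case False
    have "finite_string L us"
      using snoc.prems(1) by (rule finite_string_sublist) (auto simp: False)
    then obtain ys where ys: "run M v (map f us) = Some (Seq (Finite ys))" "ys \<noteq> []" "suffix ys us"
        "Seq (Finite ys) \<in> aut_states L"
      using snoc.IH snoc.prems(2) False by auto
    obtain zs where zs: "us = zs @ ys"
      using ys(3) by (auto simp: suffix_def)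
    have "finite_string L (ys @ [b])"
      using snoc.prems(1) by (rule finite_string_sublist) (auto simp: zs)
    then show ?thesis
      using ys by simp
  qed
  then obtain x where x: "run M v (map f us) = Some x" "x \<in> aut_states L" "extendable L x b"
      "suffix (letters x) us"
    by blast
  from aut_trans_suffix[OF alg x(2,3)] obtain ys where ys:
      "aut_trans L x b = Some (Seq (Finite ys))" "ys \<noteq> []"
      "suffix ys (letters x @ [b])" "Seq (Finite ys) \<in> aut_states L" .
  have "trans M x (f b) = Some (Seq (Finite ys))"
    using ys(1) by (auto simp: trans_iff)
  moreover have "suffix ys (us @ [b])"
  proof -
    obtain zs ws where "us = zs @ letters x" "letters x @ [b] = ws @ ys"
      using ys(3) x(4) by (auto simp: suffix_def)
    then have "us @ [b] = (zs @ ws) @ ys"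
      by simp
    then show ?thesis
      by (auto simp only: suffix_def)
  qed
  ultimately show ?case
    using x(1) ys by (auto simp: run_snoc)
qed (simp add: finite_string_def)

end

section \<open>Lines of letters\<close>

text \<open>
A two-sided sequence \<open>s\<close> has the letter \<open>s p\<close> between the gaps \<open>p\<close> and \<open>p + 1\<close>. The two halves at a
gap are listed outwards, as in the words over an automaton.
\<close>

definition rhalf :: "(int \<Rightarrow> 'b option) \<Rightarrow> int \<Rightarrow> 'b hword" where
  "rhalf s p = hword_of (\<lambda>n. s (p + int n))"

definition lhalf :: "(int \<Rightarrow> 'b option) \<Rightarrow> int \<Rightarrow> 'b hword" where
  "lhalf s p = hword_of (\<lambda>n. s (p - 1 - int n))"

text \<open>
A string of any of the four shapes, laid out along the integers, with set of gaps \<open>G\<close> and the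
zero-length string \<open>\<beta> p\<close> at each gap \<open>p\<close>. The last two assumptions say that \<open>\<beta>\<close> is determined by either
letter next to the gap; it carries additional information only for a single gap without letters.
\<close>

locale string_line = string_algebra L for L :: "('v, 'e) string_data" +
  fixes s :: "int \<Rightarrow> 'e letter option" and G :: "int set" and \<beta> :: "int \<Rightarrow> ('v, 'e) qstring"
  assumes gaps_ne: "G \<noteq> {}"
    and convex: "\<lbrakk>p \<in> G; q \<in> G; p \<le> r; r \<le> q\<rbrakk> \<Longrightarrow> r \<in> G"
    and defined_iff: "s p \<noteq> None \<longleftrightarrow> p \<in> G \<and> p + 1 \<in> G"
    and segment_string: "\<lbrakk>us \<noteq> []; \<And>k. k < length us \<Longrightarrow> s (p + int k) = Some (us ! k)\<rbrakk> \<Longrightarrow> finite_string L us"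
    and base_trivial: "p \<in> G \<Longrightarrow> \<beta> p \<in> trivial_strings L"
    and base_before: "s p = Some b \<Longrightarrow> \<beta> p = Triv (src L b) (- lstart L b)"
    and base_after: "s p = Some b \<Longrightarrow> \<beta> (p + 1) = Triv (tgt L b) (lend L b)"

text \<open>
Inverting turns the gap \<open>p\<close> into \<open>-p\<close>, so the letter from \<open>-p-1\<close> to \<open>-p\<close> becomes the one from \<open>p\<close> to \<open>p + 1\<close>.
\<close>

definition inv_seq :: "(int \<Rightarrow> 'e letter option) \<Rightarrow> int \<Rightarrow> 'e letter option" where
  "inv_seq s p = map_option linv (s (- p - 1))"

definition inv_base :: "(int \<Rightarrow> ('v, 'e) qstring) \<Rightarrow> int \<Rightarrow> ('v, 'e) qstring" where
  "inv_base \<beta> p = aut_bar (\<beta> (- p))"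

lemma tgt_linv [simp]: "tgt L (linv b) = src L b" and src_linv [simp]: "src L (linv b) = tgt L b"
  and lstart_linv [simp]: "lstart L (linv b) = lend L b" and lend_linv [simp]: "lend L (linv b) = lstart L b"
  by (cases b; simp)+

context string_line
begin

lemma defined_gaps: "s p = Some b \<Longrightarrow> p \<in> G \<and> p + 1 \<in> G"
  using defined_iff by auto

lemma gap_defined: "p \<in> G \<Longrightarrow> p + 1 \<in> G \<Longrightarrow> \<exists>b. s p = Some b"
  using defined_iff by blast

lemma defined_before: "s p = Some b \<Longrightarrow> q \<in> G \<Longrightarrow> q \<le> r \<Longrightarrow> r \<le> p \<Longrightarrow> \<exists>c. s r = Some c"
  using defined_gaps convex[of q "p + 1"] gap_defined[of r] by auto

lemma defined_after: "s p = Some b \<Longrightarrow> q \<in> G \<Longrightarrow> p \<le> r \<Longrightarrow> r < q \<Longrightarrow> \<exists>c. s r = Some c"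
  using defined_gaps convex[of p q] gap_defined[of r] by auto

lemma hnth_rhalf: "p \<in> G \<Longrightarrow> hnth (rhalf s p) n = s (p + int n)"
  unfolding rhalf_def
proof (rule hnth_hword_of)
  fix m n assume *: "p \<in> G" "s (p + int m) = None" "m \<le> n"
  show "s (p + int n) = None"
    using * defined_before[of "p + int n" _ p "p + int m"] by (cases "s (p + int n)") auto
qed

lemma hnth_lhalf: "p \<in> G \<Longrightarrow> hnth (lhalf s p) n = s (p - 1 - int n)"
  unfolding lhalf_def
proof (rule hnth_hword_of)
  fix m n assume *: "p \<in> G" "s (p - 1 - int m) = None" "m \<le> n"
  show "s (p - 1 - int n) = None"
    using * defined_after[of "p - 1 - int n" _ p "p - 1 - int m"] by (cases "s (p - 1 - int n)") auto
qed

lemma syllable: "s p = Some b \<Longrightarrow> b \<in> syllables L"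
  using segment_string[of "[b]" p] by (auto simp: finite_string_def)

lemma not_inverse: "s p = Some b \<Longrightarrow> s (p + 1) = Some c \<Longrightarrow> b \<noteq> linv c"
proof -
  assume *: "s p = Some b" "s (p + 1) = Some c"
  have "s (p + int k) = Some ([b, c] ! k)" if "k < length [b, c]" for k
    using that * by (cases k) auto
  then have "finite_string L [b, c]"
    by (intro segment_string) auto
  then show "b \<noteq> linv c"
    by (simp add: finite_string_def)
qed

lemma base_sign: "p \<in> G \<Longrightarrow> \<beta> p = Triv v i \<Longrightarrow> v \<in> verts (quiver L) \<and> (i = 1 \<or> i = - 1)"
  using base_trivial[of p] by (auto simp: trivial_strings_def)

lemma bar_base: "p \<in> G \<Longrightarrow> aut_bar (\<beta> p) \<in> trivial_strings L \<and> aut_bar (aut_bar (\<beta> p)) = \<beta> p \<and> aut_bar (\<beta> p) \<noteq> \<beta> p"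
  using base_trivial[of p] by (auto simp: trivial_strings_def)

lemma inverse_line: "string_line L (inv_seq s) (uminus ` G) (inv_base \<beta>)"
proof
  fix us p
  assume *: "us \<noteq> []" "\<And>k. k < length us \<Longrightarrow> inv_seq s (p + int k) = Some (us ! k)"
  have "finite_string L (rev (map linv us))"
  proof (rule segment_string)
    fix k assume k: "k < length (rev (map linv us))"
    have "inv_seq s (p + int (length us - 1 - k)) = Some (us ! (length us - 1 - k))"
      using k by (intro *(2)) auto
    moreover have eq: "- (p + int (length us - 1 - k)) - 1 = - p - int (length us) + int k"
      using k by auto
    ultimately obtain z where "s (- p - int (length us) + int k) = Some z" "linv z = us ! (length us - 1 - k)"
      unfolding inv_seq_def eq by auto
    then show "s (- p - int (length us) + int k) = Some (rev (map linv us) ! k)"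
      using k linv_linv[of z] by (simp add: rev_nth)
  qed (use * in auto)
  from finite_string_inverse[OF this] show "finite_string L us"
    by (simp add: rev_map o_def)
next
  show "inv_seq s p \<noteq> None \<longleftrightarrow> p \<in> uminus ` G \<and> p + 1 \<in> uminus ` G" for p
  proof -
    have "p \<in> uminus ` G \<longleftrightarrow> - p \<in> G" for p
      by force
    then show ?thesis
      using defined_iff[of "- p - 1"] by (auto simp: inv_seq_def)
  qed
  show "inv_base \<beta> p \<in> trivial_strings L" if "p \<in> uminus ` G" for p
    using that bar_base by (auto simp: inv_base_def)
  show "inv_base \<beta> p = Triv (src L b) (- lstart L b)" if "inv_seq s p = Some b" for p b
    using that base_after[of "- p - 1"] by (auto simp: inv_seq_def inv_base_def)
  show "inv_base \<beta> (p + 1) = Triv (tgt L b) (lend L b)" if "inv_seq s p = Some b" for p b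
    using that base_before[of "- p - 1"] by (auto simp: inv_seq_def inv_base_def)
next
  show "uminus ` G \<noteq> {}"
    using gaps_ne by simp
  fix p q r assume "p \<in> uminus ` G" "q \<in> uminus ` G" "p \<le> r" "r \<le> q"
  then have "- r \<in> G"
    using convex[of "- q" "- p" "- r"] by auto
  then show "r \<in> uminus ` G"
    by force
qed

end

text \<open>
Reading is deterministic in terms of base points, to the right and (below) to the left.
\<close>

lemma letters_eq_after:
  assumes "string_line L s G \<beta>" "string_line L s' G' \<beta>'" "\<beta> p = \<beta>' q"
    and "s p = Some b" "s' q = Some c" "map_letter delta b = map_letter delta c"
  shows "b = c" "\<beta> (p + 1) = \<beta>' (q + 1)"
proof -
  interpret S: string_line L s G \<beta> by fact
  interpret S': string_line L s' G' \<beta>' by fact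
  show "b = c"
    using S.base_before[OF assms(4)] S'.base_before[OF assms(5)] assms
    by (intro S.letter_eqI_src S.syllable[OF assms(4)] S'.syllable[OF assms(5)]) auto
  then show "\<beta> (p + 1) = \<beta>' (q + 1)"
    using S.base_after[OF assms(4)] S'.base_after[OF assms(5)] by simp
qed

lemma letters_eq_before:
  assumes "string_line L s G \<beta>" "string_line L s' G' \<beta>'" "\<beta> p = \<beta>' q"
    and "s (p - 1) = Some b" "s' (q - 1) = Some c" "map_letter delta b = map_letter delta c"
  shows "b = c" "\<beta> (p - 1) = \<beta>' (q - 1)"
proof -
  interpret S: string_line L s G \<beta> by fact
  interpret S': string_line L s' G' \<beta>' by fact
  show "b = c"
    using S.base_after[OF assms(4)] S'.base_after[OF assms(5)] assms
    by (intro S.letter_eqI_tgt S.syllable[OF assms(4)] S'.syllable[OF assms(5)]) auto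
  then show "\<beta> (p - 1) = \<beta>' (q - 1)"
    using S.base_before[OF assms(4)] S'.base_before[OF assms(5)] by simp
qed

text \<open>
The line with the gap \<open>p\<close> marked, as a word whose letters are renamed by \<open>f\<close>.
\<close>

definition based :: "('e letter \<Rightarrow> 'c letter) \<Rightarrow> (int \<Rightarrow> 'e letter option) \<Rightarrow> (int \<Rightarrow> ('v, 'e) qstring) \<Rightarrow> int
    \<Rightarrow> (('v, 'e) qstring, 'c) mword" where
  "based f s \<beta> p = (map_hword f (lhalf s p), \<beta> p, map_hword f (rhalf s p))"

locale line_reader = string_line L s G \<beta> + reader L M f
  for L :: "('v, 'e) string_data" and s G \<beta> and M :: "(('v, 'e) qstring, 'c) mia" and f
begin

lemma run_along:
  assumes "p \<in> G" "\<And>k. k < length cs \<Longrightarrow> map_option f (s (p + int k)) = Some (cs ! k)"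
  shows "p + int (length cs) \<in> G"
    "\<exists>x. run M (\<beta> p) cs = Some x \<and> aut_entry L x = \<beta> (p + int (length cs))"
proof -
  define us where "us = map (\<lambda>k. the (s (p + int k))) [0..<length cs]"
  have us: "s (p + int k) = Some (us ! k)" if "k < length us" for k
    using assms(2)[of k] that by (auto simp: us_def)
  have len: "length us = length cs"
    by (simp add: us_def)
  have cs: "cs = map f us"
  proof (rule nth_equalityI)
    fix k assume "k < length cs"
    then show "cs ! k = map f us ! k"
      using assms(2)[of k] us[of k] len by simp
  qed (simp add: len)
  show "p + int (length cs) \<in> G"
    using assms(1) us[of "length us - 1"] defined_gaps[of "p + int (length us - 1)"] len
    by (cases "length us") (auto simp: algebra_simps)
  show "\<exists>x. run M (\<beta> p) cs = Some x \<and> aut_entry L x = \<beta> (p + int (length cs))"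
  proof (cases "us = []")
    case True
    then show ?thesis
      using base_trivial[OF assms(1)] by (auto simp: cs trivial_strings_def)
  next
    case False
    have *: "s p = Some (hd us)" "s (p + int (length us) - 1) = Some (last us)"
      using us[of 0] us[of "length us - 1"] False
      by (auto simp: hd_conv_nth last_conv_nth Suc_leI algebra_simps)
    obtain ys where ys: "run M (\<beta> p) (map f us) = Some (Seq (Finite ys))" "ys \<noteq> []" "suffix ys us"
      using run_finite_string[OF segment_string[OF False us] base_before[OF *(1)]] by blast
    have "last ys = last us"
      using ys(2,3) by (auto simp: suffix_def)
    then show ?thesis
      using ys base_after[OF *(2)] by (simp add: cs)
  qed
qed

text \<open>
Reading is also deterministic backwards: if a run ends at the base point of \<open>p\<close> and its letters are
those to the left of \<open>p\<close>, then it started at the base point of the corresponding earlier gap. This is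
what identifies the words that are related to a marked line by moving the mark to the left.
\<close>

lemma run_into:
  assumes "p \<in> G" "run M v cs = Some x" "aut_entry L x = \<beta> p" "v \<in> trivial_strings L"
    and "\<And>k. k < length cs \<Longrightarrow> map_option f (s (p - int (length cs) + int k)) = Some (cs ! k)"
  shows "p - int (length cs) \<in> G" "v = \<beta> (p - int (length cs))"
proof -
  have "p - int (length cs) \<in> G \<and> v = \<beta> (p - int (length cs))"
    using assms(1-3,5)
  proof (induction cs arbitrary: p x rule: rev_induct)
    case Nil
    then show ?case
      using assms(4) by (auto simp: trivial_strings_def)
  next
    case (snoc c cs)
    obtain y b where y: "run M v cs = Some y" "f b = c" "aut_trans L y b = Some x"
      using snoc.prems(2) by (auto simp: run_snoc trans_iff split: bind_splits)
    have "map_option f (s (p - 1)) = Some c"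
      using snoc.prems(4)[of "length cs"] by simp
    then obtain b' where b': "s (p - 1) = Some b'" "f b' = c"
      by auto
    have ext: "y \<in> aut_states L" "extendable L y b"
      using y(3) by (auto simp: aut_trans_def split: if_splits)
    have "b = b'"
    proof (rule letter_eqI_tgt)
      show "b \<in> syllables L" "b' \<in> syllables L"
        using extendable_entry(1)[OF alg ext] syllable[OF b'(1)] by auto
      show "tgt L b = tgt L b'" "lend L b = lend L b'"
        using aut_trans_SomeD(2)[OF alg y(3)] snoc.prems(3) base_after[OF b'(1)] by auto
      show "map_letter delta b = map_letter delta b'"
        using f_delta[of b b'] y(2) b'(2) by simp
    qed
    then have "aut_entry L y = \<beta> (p - 1)"
      using extendable_entry(2,3)[OF alg ext] base_before[OF b'(1)]
      by (auto simp: trivial_strings_def)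
    then have "p - 1 - int (length cs) \<in> G \<and> v = \<beta> (p - 1 - int (length cs))"
    proof (intro snoc.IH)
      show "p - 1 \<in> G"
        using defined_gaps[OF b'(1)] by simp
      show "map_option f (s (p - 1 - int (length cs) + int k)) = Some (cs ! k)" if "k < length cs" for k
        using snoc.prems(4)[of k] that by (simp add: nth_append algebra_simps)
    qed (use y in auto)
    then show ?case
      by (simp add: algebra_simps)
  qed
  then show "p - int (length cs) \<in> G" "v = \<beta> (p - int (length cs))"
    by auto
qed

lemma prefix_rhalf:
  assumes "p \<in> G" "hprefix (HFin us) (map_hword f (rhalf s p))" "k < length us"
  shows "map_option f (s (p + int k)) = Some (us ! k)"
proof -
  have "hnth (HFin us) k \<noteq> None"
    using assms(3) by simp
  then have "hnth (map_hword f (rhalf s p)) k = hnth (HFin us) k"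
    using assms(2) unfolding hprefix_iff by blast
  then show ?thesis
    using assms(1,3) by (simp add: hnth_map hnth_rhalf)
qed

lemma right_word_rhalf: "p \<in> G \<Longrightarrow> right_word M (\<beta> p) (map_hword f (rhalf s p))"
  using run_along(2)[OF _ prefix_rhalf] base_trivial unfolding right_word_def M_initial by fastforce

end

lemma (in line_reader) inverse_reader: "line_reader L (inv_seq s) (uminus ` G) (inv_base \<beta>) M f"
  by (intro line_reader.intro inverse_line) unfold_locales

context line_reader
begin

lemma rhalf_inverse: "p \<in> G \<Longrightarrow> map_hword linv (map_hword f (lhalf s p)) = map_hword f (rhalf (inv_seq s) (- p))"
  and lhalf_inverse: "p \<in> G \<Longrightarrow> map_hword linv (map_hword f (rhalf s p)) = map_hword f (lhalf (inv_seq s) (- p))"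
proof -
  interpret I: line_reader L "inv_seq s" "uminus ` G" "inv_base \<beta>" M f
    by (rule inverse_reader)
  have *: "map_option linv (map_option f z) = map_option f (map_option linv z)" for z
    by (cases z) (auto simp: f_linv)
  assume p: "p \<in> G"
  then have "- p \<in> uminus ` G" by simp
  note h = I.hnth_rhalf[OF this] I.hnth_lhalf[OF this]
  show "map_hword linv (map_hword f (lhalf s p)) = map_hword f (rhalf (inv_seq s) (- p))"
    by (rule hword_eqI) (simp add: hnth_map hnth_lhalf p h inv_seq_def * algebra_simps)
  show "map_hword linv (map_hword f (rhalf s p)) = map_hword f (lhalf (inv_seq s) (- p))"
    by (rule hword_eqI) (simp add: hnth_map hnth_rhalf p h inv_seq_def * algebra_simps)
qed

lemma mword_inv_based: "p \<in> G \<Longrightarrow> mword_inv M (based f s \<beta> p) = based f (inv_seq s) (inv_base \<beta>) (- p)"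
  by (simp add: based_def rhalf_inverse lhalf_inverse M_bar inv_base_def)

lemma left_word_lhalf:
  assumes "p \<in> G"
  shows "left_word M (map_hword f (lhalf s p)) (\<beta> p)"
proof -
  interpret I: line_reader L "inv_seq s" "uminus ` G" "inv_base \<beta>" M f
    by (rule inverse_reader)
  have "right_word M (inv_base \<beta> (- p)) (map_hword f (rhalf (inv_seq s) (- p)))"
    using assms by (intro I.right_word_rhalf) auto
  then show ?thesis
    using assms base_trivial by (simp add: left_word_def M_bar M_initial rhalf_inverse inv_base_def)
qed

lemma happend_rev_lhalf:
  assumes "p \<in> G" "\<And>k. k < length us \<Longrightarrow> map_option f (s (p + int k)) = Some (us ! k)"
  shows "happend (rev us) (map_hword f (lhalf s p)) = map_hword f (lhalf s (p + int (length us)))"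
proof (rule hword_eqI)
  fix n
  show "hnth (happend (rev us) (map_hword f (lhalf s p))) n = hnth (map_hword f (lhalf s (p + int (length us)))) n"
  proof (cases "n < length us")
    case True
    then have lt: "length us - 1 - n < length us"
      and eq: "p + int (length us - 1 - n) = p + int (length us) - 1 - int n"
      by auto
    show ?thesis
      using assms(2)[OF lt, unfolded eq] run_along(1)[OF assms] True
      by (auto simp add: hnth_happend hnth_map hnth_lhalf rev_nth)
  next
    case False
    then show ?thesis
      using run_along(1)[OF assms]
      by (simp add: hnth_happend hnth_map hnth_lhalf[OF assms(1)] hnth_lhalf algebra_simps)
  qed
qed

lemma happend_rhalf:
  assumes "p \<in> G" "\<And>k. k < length us \<Longrightarrow> map_option f (s (p + int k)) = Some (us ! k)"
  shows "happend us (map_hword f (rhalf s (p + int (length us)))) = map_hword f (rhalf s p)"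
proof (rule hword_eqI)
  fix n
  have "p + int (length us) + int (n - length us) = p + int n" if "\<not> n < length us"
    using that by simp
  then show "hnth (happend us (map_hword f (rhalf s (p + int (length us))))) n = hnth (map_hword f (rhalf s p)) n"
    using assms(2)[of n] run_along(1)[OF assms]
    by (auto simp: hnth_happend hnth_map hnth_rhalf[OF assms(1)] hnth_rhalf)
qed

lemma based_in_words:
  assumes "p \<in> G"
  shows "based f s \<beta> p \<in> words M"
proof -
  have "left_word M (happend (rev us) (map_hword f (lhalf s p))) (entry M (the (run M (\<beta> p) us)))"
    if us: "hprefix (HFin us) (map_hword f (rhalf s p))" for us
  proof -
    note along = run_along[OF assms prefix_rhalf[OF assms us]]
    then have "entry M (the (run M (\<beta> p) us)) = \<beta> (p + int (length us))"
      by (auto simp: M_entry)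
    then show ?thesis
      using happend_rev_lhalf[OF assms prefix_rhalf[OF assms us]] left_word_lhalf[OF along(1)] by simp
  qed
  then show ?thesis
    using right_word_rhalf[OF assms] left_word_lhalf[OF assms] base_trivial[OF assms]
    by (simp add: based_def words_def M_initial)
qed

lemma segment:
  assumes "p \<in> G" "q \<in> G" "p \<le> q"
  obtains us where "q = p + int (length us)"
    "\<And>k. k < length us \<Longrightarrow> map_option f (s (p + int k)) = Some (us ! k)"
proof
  let ?us = "map (\<lambda>k. f (the (s (p + int k)))) [0..<nat (q - p)]"
  show "q = p + int (length ?us)"
    using assms by simp
  fix k assume k: "k < length ?us"
  then have "p + int k \<in> G" "p + int k + 1 \<in> G"
    using assms convex[of p q "p + int k"] convex[of p q "p + int k + 1"] by auto
  then show "map_option f (s (p + int k)) = Some (?us ! k)"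
    using gap_defined[of "p + int k"] k by auto
qed

lemma move_based:
  assumes "p \<in> G" "q \<in> G" "p \<le> q"
  shows "move M (based f s \<beta> q) (based f s \<beta> p)"
proof -
  obtain us where us: "q = p + int (length us)"
      "\<And>k. k < length us \<Longrightarrow> map_option f (s (p + int k)) = Some (us ! k)"
    using segment[OF assms] by blast
  have "map_option (entry M) (run M (\<beta> p) us) = Some (\<beta> q)"
    using run_along[OF assms(1) us(2)] us(1) by (auto simp: M_entry)
  then show ?thesis
    using happend_rhalf[OF assms(1) us(2)] happend_rev_lhalf[OF assms(1) us(2)] us(1)
    by (auto simp: based_def intro!: exI[of _ us])
qed

text \<open>
The \<open>\<sim>\<close>-class of a marked line consists of all its markings.
\<close>

lemma sim_based_iff:
  assumes "p \<in> G"
  shows "sim M w (based f s \<beta> p) \<longleftrightarrow> (\<exists>q \<in> G. w = based f s \<beta> q)"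
proof
  assume "\<exists>q \<in> G. w = based f s \<beta> q"
  then obtain q where "q \<in> G" "w = based f s \<beta> q"
    by blast
  then show "sim M w (based f s \<beta> p)"
    using move_based[of p q] move_based[of q p] based_in_words assms unfolding sim_def
    by (cases "p \<le> q") auto
next
  assume sim: "sim M w (based f s \<beta> p)"
  obtain l v r where w: "w = (l, v, r)"
    by (cases w)
  have v: "v \<in> trivial_strings L"
    using sim by (auto simp: w sim_def words_def M_initial)
  consider us where "l = happend (rev us) (map_hword f (lhalf s p))" "map_hword f (rhalf s p) = happend us r"
      "map_option (entry M) (run M (\<beta> p) us) = Some v"
    | us where "map_hword f (lhalf s p) = happend (rev us) l" "r = happend us (map_hword f (rhalf s p))"
      "map_option (entry M) (run M v us) = Some (\<beta> p)"
    using sim by (auto simp: sim_def w based_def)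
  then show "\<exists>q \<in> G. w = based f s \<beta> q"
  proof cases
    case 1
    have us: "map_option f (s (p + int k)) = Some (us ! k)" if "k < length us" for k
      using arg_cong[OF 1(2), of "\<lambda>h. hnth h k"] that by (simp add: hnth_map hnth_happend hnth_rhalf assms)
    define q where "q = p + int (length us)"
    have q: "q \<in> G" "v = \<beta> q"
      using run_along[OF assms us] 1(3) by (auto simp: q_def M_entry)
    have "l = map_hword f (lhalf s q)"
      using 1(1) happend_rev_lhalf[OF assms us] by (simp add: q_def)
    moreover have "r = map_hword f (rhalf s q)"
    proof (rule hword_eqI)
      fix n
      show "hnth r n = hnth (map_hword f (rhalf s q)) n"
        using arg_cong[OF 1(2), of "\<lambda>h. hnth h (n + length us)"]
        by (simp add: hnth_map hnth_happend hnth_rhalf[OF assms] hnth_rhalf[OF q(1)])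
          (simp add: q_def algebra_simps)
    qed
    ultimately show ?thesis
      using q by (auto simp: w based_def)
  next
    case 2
    have us: "map_option f (s (p - int (length us) + int k)) = Some (us ! k)" if "k < length us" for k
    proof -
      have eq: "p - 1 - int (length us - 1 - k) = p - int (length us) + int k"
        using that by auto
      have "hnth (map_hword f (lhalf s p)) (length us - 1 - k) = Some (us ! k)"
        unfolding 2(1) using that by (auto simp: hnth_happend rev_nth)
      then show ?thesis
        by (simp only: hnth_map hnth_lhalf[OF assms] eq)
    qed
    define q where "q = p - int (length us)"
    obtain x where "run M v us = Some x" "aut_entry L x = \<beta> p"
      using 2(3) by (auto simp: M_entry)
    note q = run_into[OF assms this v us, folded q_def]
    have p: "p = q + int (length us)"
      by (simp add: q_def)
    have "r = map_hword f (rhalf s q)"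
      using 2(2) happend_rhalf[OF q(1) us[folded q_def]] by (simp add: p)
    moreover have "l = map_hword f (lhalf s q)"
    proof (rule hword_eqI)
      fix n
      show "hnth l n = hnth (map_hword f (lhalf s q)) n"
        using arg_cong[OF 2(1), of "\<lambda>h. hnth h (n + length us)"]
        by (simp add: hnth_map hnth_happend hnth_lhalf[OF assms] hnth_lhalf[OF q(1)])
          (simp add: q_def algebra_simps)
    qed
    ultimately show ?thesis
      using q by (auto simp: w based_def)
  qed
qed

end

section \<open>Periodicity\<close>

definition eventually_periodic :: "(int \<Rightarrow> 'b option) \<Rightarrow> bool" where
  "eventually_periodic s \<longleftrightarrow> (\<exists>n N. N > 0 \<and> (\<forall>i \<ge> n. s i \<noteq> None \<and> s (i + N) = s i))"

text \<open>
Neither the right nor the left end is periodic; \<open>inv_seq\<close> turns the left end into a right one.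
\<close>

definition aperiodic_seq :: "(int \<Rightarrow> 'e letter option) \<Rightarrow> bool" where
  "aperiodic_seq s \<longleftrightarrow> \<not> eventually_periodic s \<and> \<not> eventually_periodic (inv_seq s)"

lemma almost_periodic_iff:
  "almost_periodic t \<longleftrightarrow> (\<exists>n N. N > 0 \<and> (\<forall>i \<ge> n. t !! (i + N) = t !! i))"
proof
  assume "almost_periodic t"
  then obtain n us where us: "us \<noteq> []" "sdrop n t = cycle us"
    by (auto simp: almost_periodic_def)
  have "t !! (i + length us) = t !! i" if "n \<le> i" for i
  proof -
    have "cycle us !! ((i - n) + length us) = cycle us !! (i - n)"
      by (subst cycle_decomp[OF us(1)]) (simp add: shift_snth)
    then show ?thesis
      using that by (simp add: us(2)[symmetric] sdrop_snth)
  qed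
  then show "\<exists>n N. N > 0 \<and> (\<forall>i \<ge> n. t !! (i + N) = t !! i)"
    using us(1) by (intro exI[of _ n] exI[of _ "length us"]) auto
next
  assume "\<exists>n N. N > 0 \<and> (\<forall>i \<ge> n. t !! (i + N) = t !! i)"
  then obtain n N where N: "N > 0" "\<And>i. n \<le> i \<Longrightarrow> t !! (i + N) = t !! i"
    by blast
  define us where "us = stake N (sdrop n t)"
  have us: "us \<noteq> []" "length us = N"
    using N(1) by (auto simp: us_def)
  have "sdrop n t !! i = cycle us !! i" for i
  proof (induction i rule: less_induct)
    case (less i)
    show ?case
    proof (cases "i < N")
      case True
      then show ?thesis
        by (subst cycle_decomp[OF us(1)]) (simp add: shift_snth us us_def)
    next
      case False
      then have "sdrop n t !! i = sdrop n t !! (i - N)"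
        using N(2)[of "n + (i - N)"] by (simp add: sdrop_snth add.commute)
      also have "\<dots> = cycle us !! (i - N)"
        using False N(1) by (intro less) simp
      also have "\<dots> = cycle us !! i"
        using False by (subst (2) cycle_decomp[OF us(1)]) (simp add: shift_snth us(2))
      finally show ?thesis .
    qed
  qed
  then have "(!!) (sdrop n t) = (!!) (cycle us)"
    by (rule ext)
  then have "sdrop n t = cycle us"
    using stream_smap_nats[of "sdrop n t"] stream_smap_nats[of "cycle us"] by simp
  then show "almost_periodic t"
    using us(1) by (auto simp: almost_periodic_def)
qed

text \<open>
Only the letters from some gap on matter; the letters before \<open>c\<close> are arbitrary.
\<close>

lemma eventually_periodic_stream:
  assumes "\<And>i. s (c + int i) = Some (t !! i)"
  shows "eventually_periodic s \<longleftrightarrow> almost_periodic t"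
proof
  assume "eventually_periodic s"
  then obtain n N where N: "N > 0" "\<And>i. n \<le> i \<Longrightarrow> s (i + N) = s i"
    by (auto simp: eventually_periodic_def)
  have "t !! (i + nat N) = t !! i" if "nat (n - c) \<le> i" for i
    using N(2)[of "c + int i"] that assms[of i] assms[of "i + nat N"] N(1) by (simp add: add.assoc)
  then show "almost_periodic t"
    unfolding almost_periodic_iff using N(1) by (intro exI[of _ "nat (n - c)"] exI[of _ "nat N"]) auto
next
  assume "almost_periodic t"
  then obtain n N where N: "N > 0" "\<And>i. n \<le> i \<Longrightarrow> t !! (i + N) = t !! i"
    by (auto simp: almost_periodic_iff)
  have "s i \<noteq> None \<and> s (i + int N) = s i" if "c + int n \<le> i" for i
    using that N(2)[of "nat (i - c)"] assms[of "nat (i - c)"] assms[of "nat (i - c) + N"]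
    by (simp add: algebra_simps)
  then show "eventually_periodic s"
    unfolding eventually_periodic_def using N(1)
    by (intro exI[of _ "c + int n"] exI[of _ "int N"]) auto
qed

lemma not_eventually_periodic: "(\<And>i. m \<le> i \<Longrightarrow> s i = None) \<Longrightarrow> \<not> eventually_periodic s"
  unfolding eventually_periodic_def by (metis linorder_le_cases)

lemma aperiodic_iff: "aperiodic w \<longleftrightarrow> aperiodic_seq (letter_at w)"
proof (cases w)
  case (Finite ws)
  have "\<not> eventually_periodic (letter_at w)" "\<not> eventually_periodic (inv_seq (letter_at w))"
    by (rule not_eventually_periodic[of "int (length ws)"]; simp add: Finite inv_seq_def)+
  then show ?thesis
    by (simp add: aperiodic_seq_def Finite)
next
  case (Right t)
  have "\<not> eventually_periodic (inv_seq (letter_at w))"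
    by (rule not_eventually_periodic[of 0]) (simp add: Right inv_seq_def)
  moreover have "eventually_periodic (letter_at w) \<longleftrightarrow> almost_periodic t"
    by (rule eventually_periodic_stream[of _ 0]) (simp add: Right)
  ultimately show ?thesis
    by (simp add: aperiodic_seq_def Right)
next
  case (Left t)
  have "\<not> eventually_periodic (letter_at w)"
    by (rule not_eventually_periodic[of 0]) (simp add: Left)
  moreover have "eventually_periodic (inv_seq (letter_at w)) \<longleftrightarrow> almost_periodic (smap linv t)"
    by (rule eventually_periodic_stream[of _ 0]) (simp add: Left inv_seq_def)
  ultimately show ?thesis
    by (simp add: aperiodic_seq_def Left)
next
  case (Bi g)
  have nats: "siterate Suc 0 !! i = i" for i
    by simp
  have "eventually_periodic (letter_at w) \<longleftrightarrow> almost_periodic (smap (\<lambda>n. g (int n)) (siterate Suc 0))"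
    by (rule eventually_periodic_stream[of _ 0]) (simp add: Bi nats)
  moreover have "eventually_periodic (inv_seq (letter_at w)) \<longleftrightarrow>
      almost_periodic (smap (\<lambda>n. linv (g (- int n - 1))) (siterate Suc 0))"
    by (rule eventually_periodic_stream[of _ 0]) (simp add: Bi inv_seq_def nats)
  ultimately show ?thesis
    by (simp add: aperiodic_seq_def Bi)
qed

lemma eventually_periodic_shift:
  assumes "\<And>j. s' (c + j) = s j"
  shows "eventually_periodic s' \<longleftrightarrow> eventually_periodic s"
proof
  assume "eventually_periodic s'"
  then obtain n N where "N > 0" "\<And>i. n \<le> i \<Longrightarrow> s' i \<noteq> None \<and> s' (i + N) = s' i"
    by (auto simp: eventually_periodic_def)
  then have "\<forall>i \<ge> n - c. s i \<noteq> None \<and> s (i + N) = s i"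
    unfolding assms[symmetric] by (auto simp: add.assoc[symmetric])
  then show "eventually_periodic s"
    using \<open>N > 0\<close> by (auto simp: eventually_periodic_def)
next
  assume "eventually_periodic s"
  then obtain n N where N: "N > 0" "\<And>i. n \<le> i \<Longrightarrow> s i \<noteq> None \<and> s (i + N) = s i"
    by (auto simp: eventually_periodic_def)
  have "s' i = s (i - c)" for i
    using assms[of "i - c"] by simp
  then have "\<forall>i \<ge> n + c. s' i \<noteq> None \<and> s' (i + N) = s' i"
    using N(2)[of "_ - c"] by (simp add: algebra_simps)
  then show "eventually_periodic s'"
    using \<open>N > 0\<close> by (auto simp: eventually_periodic_def)
qed

context string_line
begin

lemma finite_bases: "finite (\<beta> ` G)"
proof (rule finite_subset)
  show "\<beta> ` G \<subseteq> case_prod Triv ` (verts (quiver L) \<times> {- 1, 1})"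
    using base_trivial by (fastforce simp: trivial_strings_def)
qed auto

text \<open>
If the directions of the letters repeat with period \<open>N\<close>, then among the base points at the gaps
\<open>n, n + N, n + 2 N, \<dots>\<close> two coincide, because there are only finitely many. From these two gaps on the
letters agree by determinism.
\<close>

lemma eventually_periodic_delta:
  assumes "eventually_periodic (\<lambda>i. map_option (map_letter delta) (s i))"
  shows "eventually_periodic s"
proof -
  obtain n N where N: "N > 0" "\<And>i. n \<le> i \<Longrightarrow> s i \<noteq> None"
      "\<And>i. n \<le> i \<Longrightarrow> map_option (map_letter delta) (s (i + N)) = map_option (map_letter delta) (s i)"
    using assms by (auto simp: eventually_periodic_def)
  \<comment> \<open>the gaps at which one of the periods begins\<close>
  define P where "P k = n + int k * N" for k
  have P: "n \<le> P k" for k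
    using N(1) by (simp add: P_def)
  have per: "map_option (map_letter delta) (s (i + int k * N)) = map_option (map_letter delta) (s i)" if "n \<le> i" for i k
  proof (induction k)
    case (Suc k)
    have "n \<le> i + int k * N"
      using that N(1) by (simp add: add_increasing2)
    from N(3)[OF this] Suc show ?case
      by (simp add: algebra_simps)
  qed simp
  have "\<beta> ` range P \<subseteq> \<beta> ` G"
    using P N(2) defined_iff by blast
  then have "finite (range (\<lambda>k. \<beta> (P k)))"
    using finite_bases finite_subset by (metis image_image)
  then obtain k where "infinite {j. \<beta> (P j) = \<beta> (P k)}"
    using pigeonhole_infinite[of UNIV "\<lambda>k. \<beta> (P k)"] by auto
  then obtain j where j: "k < j" "\<beta> (P j) = \<beta> (P k)"
    using finite_nat_set_iff_bounded_le by (metis (mono_tags, lifting) mem_Collect_eq not_le)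
  \<comment> \<open>a multiple of the period after which the base point recurs\<close>
  define D where "D = int (j - k) * N"
  have PD: "P j = P k + D"
    using j(1) by (simp add: P_def D_def algebra_simps)
  have D: "D > 0"
    using j(1) N(1) by (simp add: D_def)
  have step: "s (i + D) = s i \<and> \<beta> (i + D + 1) = \<beta> (i + 1)" if "n \<le> i" "\<beta> (i + D) = \<beta> i" for i
  proof -
    have "n \<le> i + D"
      using that(1) D by simp
    then obtain b c where bc: "s (i + D) = Some b" "s i = Some c"
      using N(2)[OF \<open>n \<le> i\<close>] N(2)[of "i + D"] by blast
    have "map_letter delta b = map_letter delta c"
      using per[OF that(1), of "j - k"] bc by (simp add: D_def)
    from letters_eq_after[OF string_line_axioms string_line_axioms that(2) bc this] bc
    show ?thesis
      by simp
  qed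
  have tail: "s (P k + int m + D) = s (P k + int m) \<and> \<beta> (P k + int m + D) = \<beta> (P k + int m)" for m
  proof (induction m)
    case 0
    then show ?case
      using step[of "P k"] P[of k] j(2) by (simp add: PD)
  next
    case (Suc m)
    then have "\<beta> (P k + int (Suc m) + D) = \<beta> (P k + int (Suc m))"
      using step[of "P k + int m"] P[of k] by (simp add: algebra_simps)
    then show ?case
      using step[of "P k + int (Suc m)"] P[of k] by simp
  qed
  have "s (i + D) = s i" if "P k \<le> i" for i
    using tail[of "nat (i - P k)"] that by simp
  moreover have "s i \<noteq> None" if "P k \<le> i" for i
    using that P[of k] N(2)[of i] by simp
  ultimately show ?thesis
    using D unfolding eventually_periodic_def by blast
qed

end

section \<open>The line and the word class of a string\<close>

fun word_gaps :: "'b word \<Rightarrow> int set" where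
  "word_gaps (Finite ws) = {0..int (length ws)}"
| "word_gaps (Right s) = {0..}"
| "word_gaps (Left s) = {..0}"
| "word_gaps (Bi g) = UNIV"

fun gaps :: "('v, 'e) qstring \<Rightarrow> int set" where
  "gaps (Triv v i) = {0}"
| "gaps (Seq w) = word_gaps w"

text \<open>
At a gap of a string with at least one syllable, at least one of the two adjacent letters exists; the
one to the right is preferred, and \<open>string_line_string\<close> shows that the choice does not matter.
\<close>

fun base_at :: "('v, 'e) string_data \<Rightarrow> ('v, 'e) qstring \<Rightarrow> int \<Rightarrow> ('v, 'e) qstring" where
  "base_at L (Triv v i) p = Triv v i"
| "base_at L (Seq w) p = (case letter_at w p of Some b \<Rightarrow> Triv (src L b) (- lstart L b)
     | None \<Rightarrow> (case letter_at w (p - 1) of Some b \<Rightarrow> Triv (tgt L b) (lend L b)))"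

lemma letter_at_defined_iff: "letter_at w p \<noteq> None \<longleftrightarrow> p \<in> word_gaps w \<and> p + 1 \<in> word_gaps w"
  by (cases w) auto

lemma string_segment:
  assumes "Seq w \<in> strings L" "us \<noteq> []" "\<And>k. k < length us \<Longrightarrow> letter_at w (p + int k) = Some (us ! k)"
  shows "finite_string L us"
proof (cases w)
  case (Finite ws)
  then have ws: "finite_string L ws"
    using assms(1) by (auto simp: strings_def trivial_strings_def infinite_word_def)
  have "0 \<le> p"
    using assms(2) assms(3)[of 0] by (auto simp: Finite split: if_splits)
  have nth: "nat p + k < length ws \<and> us ! k = ws ! (nat p + k)" if "k < length us" for k
    using assms(3)[OF that] \<open>0 \<le> p\<close> by (auto simp: Finite nat_add_distrib split: if_splits)
  have "us = take (length us) (drop (nat p) ws)"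
  proof (rule nth_equalityI)
    have "nat p + (length us - 1) < length ws"
      using assms(2) by (intro nth[THEN conjunct1]) simp
    then show "length us = length (take (length us) (drop (nat p) ws))"
      using assms(2) by (cases us) auto
    fix k assume "k < length us"
    then show "us ! k = take (length us) (drop (nat p) ws) ! k"
      using nth[of k] by simp
  qed
  then have "sublist us ws"
    by (metis sublist_drop sublist_take sublist_order.order.trans)
  then show ?thesis
    using ws finite_string_sublist assms(2) by blast
next
  case (Right t)
  then show ?thesis
    using assms by (auto simp: strings_def trivial_strings_def)
next
  case (Left t)
  then show ?thesis
    using assms by (auto simp: strings_def trivial_strings_def)
next
  case (Bi g)
  then show ?thesis
    using assms by (auto simp: strings_def trivial_strings_def)
qed

lemma (in string_algebra) base_trivial_letter:
  assumes "b \<in> syllables L"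
  shows "Triv (tgt L b) (lend L b) \<in> trivial_strings L" "Triv (src L b) (- lstart L b) \<in> trivial_strings L"
  using assms signs by (cases b; fastforce simp: syllables_def signed_def trivial_strings_def)+

lemma string_algebra_adjacent:
  assumes "string_algebra L" "finite_string L [b, c]"
  shows "src L c = tgt L b" "- lstart L c = lend L b"
proof -
  have "Seq (Finite [b]) \<in> aut_states L" "extendable L (Seq (Finite [b])) c"
    using assms(2) by (auto simp: aut_states_def finite_string_def)
  from extendable_entry(3)[OF assms(1) this]
  show "src L c = tgt L b" "- lstart L c = lend L b"
    by auto
qed

text \<open>
The base points computed from both sides of a gap agree: this is the sign condition for two arrows that
can be composed or, at a change of direction, the one for two arrows with a common end.
\<close>

lemma string_line_string:
  assumes alg: "string_algebra L" and x: "x \<in> strings L"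
  shows "string_line L (syllable_at x) (gaps x) (base_at L x)"
proof -
  interpret string_algebra L by fact
  have seg: "finite_string L us"
    if "us \<noteq> []" "\<And>k. k < length us \<Longrightarrow> syllable_at x (p + int k) = Some (us ! k)" for us p
    using that string_segment[of _ L us p] x by (cases x) auto
  have syl: "b \<in> syllables L" if "syllable_at x p = Some b" for b p
    using that seg[of "[b]" p] by (auto simp: finite_string_def)
  have before: "base_at L x p = Triv (src L b) (- lstart L b)" if "syllable_at x p = Some b" for p b
    using that by (cases x) auto
  have after: "base_at L x (p + 1) = Triv (tgt L b) (lend L b)" if b: "syllable_at x p = Some b" for p b
  proof (cases "syllable_at x (p + 1)")
    case None
    then show ?thesis
      using b by (cases x) auto
  next
    case (Some c)
    have "syllable_at x (p + int k) = Some ([b, c] ! k)" if "k < length [b, c]" for k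
      using that b Some by (cases k) auto
    then have "finite_string L [b, c]"
      by (intro seg) auto
    then show ?thesis
      using before[OF Some] string_algebra_adjacent[OF alg] by auto
  qed
  have dom: "syllable_at x p \<noteq> None \<longleftrightarrow> p \<in> gaps x \<and> p + 1 \<in> gaps x" for p
    using letter_at_defined_iff by (cases x) auto
  have triv: "base_at L x p \<in> trivial_strings L" if p: "p \<in> gaps x" for p
  proof (cases x)
    case (Triv v i)
    then show ?thesis
      using x by (auto simp: strings_def)
  next
    case (Seq w)
    have "p + 1 \<in> gaps x \<or> p - 1 \<in> gaps x"
      using p x by (cases w) (auto simp: Seq strings_def trivial_strings_def infinite_word_def finite_string_def neq_Nil_conv)
    then consider b where "syllable_at x p = Some b" | b where "syllable_at x (p - 1) = Some b"
      using p dom[of p] dom[of "p - 1"] by auto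
    then show ?thesis
    proof cases
      case 1
      then show ?thesis
        using before[OF 1] base_trivial_letter[OF syl[OF 1]] by simp
    next
      case 2
      then show ?thesis
        using after[OF 2] base_trivial_letter[OF syl[OF 2]] by simp
    qed
  qed
  have conv: "r \<in> gaps x" if "p \<in> gaps x" "q \<in> gaps x" "p \<le> r" "r \<le> q" for p q r
  proof (cases x)
    case (Seq w)
    then show ?thesis
      using that by (cases w) auto
  qed (use that in auto)
  have ne: "gaps x \<noteq> {}"
  proof (cases x)
    case (Seq w)
    then show ?thesis
      by (cases w) auto
  qed auto
  show ?thesis
    by (rule string_line.intro[OF alg], rule string_line_axioms.intro)
      (fact ne conv dom seg triv before after)+
qed

text \<open>
The gap of \<open>glue l r\<close> at which the two halves meet. It is not \<open>0\<close> in general, since finite and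
right-infinite words are numbered from their first gap and left-infinite ones from their last.
\<close>

fun glue_base :: "'b hword \<Rightarrow> 'b hword \<Rightarrow> int" where
  "glue_base (HFin us) r = int (length us)"
| "glue_base (HInf s) (HFin ws) = - int (length ws)"
| "glue_base (HInf s) (HInf t) = 0"

lemma letter_at_glue:
  "letter_at (glue l r) (glue_base l r + int n) = hnth r n"
  "letter_at (glue l r) (glue_base l r - 1 - int n) = hnth l n"
  "glue_base l r \<in> word_gaps (glue l r)"
  by (cases l; cases r; auto simp: nth_append shift_snth rev_nth nat_diff_distrib nat_add_distrib Suc_diff_Suc algebra_simps)+

lemma same_word_letter_at:
  assumes "same_word w w'"
  obtains k where "\<And>i. letter_at w' i = letter_at w (i + k)" "\<And>p. p \<in> word_gaps w \<Longrightarrow> p - k \<in> word_gaps w'"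
proof (cases "\<exists>f g. w = Bi f \<and> w' = Bi g")
  case True
  then obtain f g k where "w = Bi f" "w' = Bi g" "\<And>i. g i = f (i + k)"
    using assms by auto
  then show ?thesis
    using that[of k] by simp
next
  case False
  then have "w = w'"
    using assms by (cases w; cases w') auto
  then show ?thesis
    using that[of 0] by simp
qed

lemma (in string_algebra) base_of_right_word:
  assumes "right_word (string_mia L) v r" "hnth r 0 = Some b"
  shows "v = Triv (src L b) (- lstart L b)"
proof -
  have alg: "string_algebra L"
    by unfold_locales
  have "hprefix (HFin [b]) r"
    using assms(2) by (auto simp: hprefix_iff)
  then have "run (string_mia L) v ([] @ [b]) \<noteq> None"
    using assms(1) unfolding right_word_def by simp
  then obtain y where y: "aut_trans L v b = Some y"
    unfolding run_snoc by (auto simp: string_mia_def)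
  have v: "v \<in> trivial_strings L"
    using assms(1) by (simp add: right_word_def string_mia_def)
  have "v \<in> aut_states L" "extendable L v b"
    using y by (auto simp: aut_trans_def split: if_splits)
  then show ?thesis
    using v by (auto simp: trivial_strings_def)
qed

lemma gap_neighbour:
  assumes "Seq w \<in> strings L" "p \<in> word_gaps w"
  shows "letter_at w p \<noteq> None \<or> letter_at w (p - 1) \<noteq> None"
proof -
  have "p + 1 \<in> word_gaps w \<or> p - 1 \<in> word_gaps w"
    using assms by (cases w) (auto simp: strings_def trivial_strings_def infinite_word_def finite_string_def neq_Nil_conv)
  then show ?thesis
    using assms(2) unfolding letter_at_defined_iff by auto
qed

text \<open>
The letters of a word that represents \<open>x\<close> are those of \<open>x\<close> around some gap. Its base point is then
forced, since the automaton must be able to read a letter next to it.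
\<close>

lemma represents_based:
  assumes alg: "string_algebra L" and x: "x \<in> strings L"
    and W: "(l, v, r) \<in> words (string_mia L)" "represents L (l, v, r) x"
  obtains p where "p \<in> gaps x" "(l, v, r) = based id (syllable_at x) (base_at L x) p"
proof (cases x)
  case (Triv u i)
  interpret string_line L "syllable_at x" "gaps x" "base_at L x"
    by (rule string_line_string[OF alg x])
  have "0 \<in> gaps x"
    by (simp add: Triv)
  note h = hnth_lhalf[OF this] hnth_rhalf[OF this]
  have s: "syllable_at x q = None" for q
    by (simp add: Triv)
  have "lhalf (syllable_at x) 0 = HFin []" "rhalf (syllable_at x) 0 = HFin []"
    by (rule hword_eqI; simp add: h s)+
  then show ?thesis
    using W(2) that[of 0] by (simp add: Triv based_def)
next
  case (Seq w)
  interpret string_line L "syllable_at x" "gaps x" "base_at L x"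
    by (rule string_line_string[OF alg x])
  from W(2) have "same_word (glue l r) w"
    by (simp add: Seq)
  from same_word_letter_at[OF this] obtain k where k: "\<And>i. letter_at w i = letter_at (glue l r) (i + k)"
      "\<And>p. p \<in> word_gaps (glue l r) \<Longrightarrow> p - k \<in> word_gaps w"
    by blast
  define p where "p = glue_base l r - k"
  have p: "p \<in> gaps x"
    using k(2)[OF letter_at_glue(3)] by (simp add: p_def Seq)
  have r: "syllable_at x (p + int n) = hnth r n" for n
    using k(1)[of "p + int n"] letter_at_glue(1)[of l r n] by (simp add: p_def Seq)
  have l: "syllable_at x (p - 1 - int n) = hnth l n" for n
    using k(1)[of "p - 1 - int n"] letter_at_glue(2)[of l r n] by (simp add: p_def Seq algebra_simps)
  have "v = base_at L x p"
  proof -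
    from gap_neighbour[of w L p] p x
    consider b where "syllable_at x p = Some b" | b where "syllable_at x (p - 1) = Some b"
      by (auto simp: Seq)
    then show ?thesis
    proof cases
      case 1
      then show ?thesis
        using r[of 0] base_of_right_word[of v r b] W(1) base_before[OF 1] by (auto simp: words_def)
    next
      case 2
      have "right_word (string_mia L) (aut_bar v) (map_hword linv l)" "v \<in> trivial_strings L"
        using W(1) by (auto simp: words_def left_word_def string_mia_def)
      moreover have "hnth (map_hword linv l) 0 = Some (linv b)"
        using l[of 0] 2 by (simp add: hnth_map flip: l)
      ultimately have "aut_bar v = Triv (tgt L b) (- lend L b)" "v \<in> trivial_strings L"
        using base_of_right_word[of "aut_bar v" "map_hword linv l" "linv b"] by auto
      then show ?thesis
        using base_after[OF 2] by (auto simp: trivial_strings_def)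
    qed
  qed
  moreover have "l = map_hword id (lhalf (syllable_at x) p)" "r = map_hword id (rhalf (syllable_at x) p)"
    by (rule hword_eqI; simp add: hword.map_id hnth_lhalf hnth_rhalf p l r)+
  ultimately show ?thesis
    using that[OF p] by (simp add: based_def)
qed

lemma represents_based_0:
  assumes alg: "string_algebra L" and x: "x \<in> strings L"
  shows "0 \<in> gaps x" "represents L (based id (syllable_at x) (base_at L x) 0) x"
proof -
  interpret string_line L "syllable_at x" "gaps x" "base_at L x"
    by (rule string_line_string[OF alg x])
  show 0: "0 \<in> gaps x"
  proof (cases x)
    case (Seq w)
    then show ?thesis
      by (cases w) auto
  qed simp
  note h = hnth_lhalf[OF 0] hnth_rhalf[OF 0]
  show "represents L (based id (syllable_at x) (base_at L x) 0) x"
  proof (cases x)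
    case (Triv u i)
    then have s: "syllable_at x q = None" for q
      by simp
    have "lhalf (syllable_at x) 0 = HFin []" "rhalf (syllable_at x) 0 = HFin []"
      by (rule hword_eqI; simp add: h s)+
    then show ?thesis
      by (simp add: Triv based_def)
  next
    case (Seq w)
    then have s: "syllable_at x q = letter_at w q" for q
      by simp
    have "\<exists>l r. lhalf (syllable_at x) 0 = l \<and> rhalf (syllable_at x) 0 = r \<and> same_word (glue l r) w"
    proof (cases w)
      case (Finite ws)
      have "lhalf (syllable_at x) 0 = HFin []" "rhalf (syllable_at x) 0 = HFin ws"
        by (rule hword_eqI; simp add: h s Finite)+
      then show ?thesis
        by (simp add: Finite)
    next
      case (Right t)
      have "lhalf (syllable_at x) 0 = HFin []" "rhalf (syllable_at x) 0 = HInf t"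
        by (rule hword_eqI; simp add: h s Right)+
      then show ?thesis
        by (simp add: Right)
    next
      case (Left t)
      have "lhalf (syllable_at x) 0 = HInf t" "rhalf (syllable_at x) 0 = HFin []"
        by (rule hword_eqI; simp add: h s Left)+
      then show ?thesis
        by (simp add: Left)
    next
      case (Bi g)
      have "lhalf (syllable_at x) 0 = HInf (smap (\<lambda>n. g (- 1 - int n)) nats)"
          "rhalf (syllable_at x) 0 = HInf (smap (\<lambda>n. g (int n)) nats)"
        by (rule hword_eqI; simp add: h s Bi)+
      then show ?thesis
        by (auto simp: Bi intro!: exI[of _ 0])
    qed
    then show ?thesis
      by (simp add: Seq based_def hword.map_id)
  qed
qed

text \<open>
Together with \<open>Phi_based\<close> this reduces the theorem to the marked lines of \<open>x\<close>.
\<close>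

lemma word_class_eq:
  assumes alg: "string_algebra L" and x: "x \<in> strings L"
  shows "word_class L x = based id (syllable_at x) (base_at L x) ` gaps x"
proof -
  interpret R: reader L "string_mia L" id
    by (rule reader_string_mia[OF alg])
  interpret string_line L "syllable_at x" "gaps x" "base_at L x"
    by (rule string_line_string[OF alg x])
  interpret line_reader L "syllable_at x" "gaps x" "base_at L x" "string_mia L" id
    by unfold_locales
  show ?thesis
  proof
    show "word_class L x \<subseteq> based id (syllable_at x) (base_at L x) ` gaps x"
    proof
      fix W assume "W \<in> word_class L x"
      then obtain l v r where W: "(l, v, r) \<in> words (string_mia L)" "represents L (l, v, r) x"
          "sim (string_mia L) W (l, v, r)"
        by (auto simp: word_class_def)
      from represents_based[OF alg x W(1,2)] obtain p where
        "p \<in> gaps x" "(l, v, r) = based id (syllable_at x) (base_at L x) p" .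
      then show "W \<in> based id (syllable_at x) (base_at L x) ` gaps x"
        using W(3) sim_based_iff by auto
    qed
    show "based id (syllable_at x) (base_at L x) ` gaps x \<subseteq> word_class L x"
      using represents_based_0[OF alg x] sim_based_iff based_in_words unfolding word_class_def by blast
  qed
qed

abbreviation delta_pm :: "'e letter \<Rightarrow> nat letter" where
  "delta_pm \<equiv> map_letter delta"

lemma Phi_based: "Phi (based id s \<beta> p) = based delta_pm s \<beta> p"
  by (simp add: based_def hword.map_id)

lemma delta_pm_eq: "delta_pm b = Dir 0 \<longleftrightarrow> (\<exists>e. b = Dir e)" "delta_pm b = Inv 0 \<longleftrightarrow> (\<exists>e. b = Inv e)"
  by (cases b; simp add: delta_def)+

lemma aperiodic_seq_string:
  assumes "is_finite x \<or> (\<not> is_finite x \<and> aperiodic_string x)"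
  shows "aperiodic_seq (syllable_at x)"
proof (cases x)
  case (Triv v i)
  have "\<not> eventually_periodic (syllable_at x)" "\<not> eventually_periodic (inv_seq (syllable_at x))"
    by (rule not_eventually_periodic[of 0]; simp add: Triv inv_seq_def)+
  then show ?thesis
    by (simp add: aperiodic_seq_def)
next
  case (Seq w)
  then have "aperiodic w"
    using assms by (auto simp: infinite_word_def)
  then have "aperiodic_seq (letter_at w)"
    by (simp add: aperiodic_iff)
  moreover have "syllable_at x = letter_at w"
    by (rule ext) (simp add: Seq)
  ultimately show ?thesis
    by simp
qed

lemma (in string_line) aperiodic_based:
  assumes "aperiodic_seq s" "p \<in> G"
  shows "aperiodic (glue (map_hword delta_pm (lhalf s p)) (map_hword delta_pm (rhalf s p)))"
proof -
  let ?l = "map_hword delta_pm (lhalf s p)" and ?r = "map_hword delta_pm (rhalf s p)"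
  let ?w = "letter_at (glue ?l ?r)"
  have w: "?w (glue_base ?l ?r + j) = map_option delta_pm (s (p + j))" for j
  proof (cases "j \<ge> 0")
    case True
    then show ?thesis
      using letter_at_glue(1)[of ?l ?r "nat j"] by (simp add: hnth_map hnth_rhalf assms(2))
  next
    case False
    then have "glue_base ?l ?r - 1 - int (nat (- j - 1)) = glue_base ?l ?r + j" "p - 1 - int (nat (- j - 1)) = p + j"
      by auto
    then show ?thesis
      using letter_at_glue(2)[of ?l ?r "nat (- j - 1)"] by (simp only: hnth_map hnth_lhalf[OF assms(2)])
  qed
  have delta_pm_linv: "delta_pm (linv b) = linv (delta_pm b)" for b :: "'b letter"
    by (cases b) auto
  have iw: "inv_seq ?w (- glue_base ?l ?r + j) = map_option delta_pm (inv_seq s (- p + j))" for j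
    using w[of "- j - 1"] by (simp add: inv_seq_def algebra_simps option.map_comp o_def delta_pm_linv)
  have "\<not> eventually_periodic ?w"
  proof
    assume "eventually_periodic ?w"
    then have "eventually_periodic (\<lambda>j. map_option delta_pm (s (p + j)))"
      using eventually_periodic_shift[of ?w "glue_base ?l ?r" "\<lambda>j. map_option delta_pm (s (p + j))", OF w] by simp
    then have "eventually_periodic (\<lambda>j. map_option delta_pm (s j))"
      using eventually_periodic_shift[of "\<lambda>j. map_option delta_pm (s j)" p "\<lambda>j. map_option delta_pm (s (p + j))"] by simp
    then show False
      using eventually_periodic_delta assms(1) by (simp add: aperiodic_seq_def)
  qed
  moreover have "\<not> eventually_periodic (inv_seq ?w)"
  proof
    interpret I: string_line L "inv_seq s" "uminus ` G" "inv_base \<beta>"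
      by (rule inverse_line)
    assume "eventually_periodic (inv_seq ?w)"
    then have "eventually_periodic (\<lambda>j. map_option delta_pm (inv_seq s (- p + j)))"
      using eventually_periodic_shift[of "inv_seq ?w" "- glue_base ?l ?r" "\<lambda>j. map_option delta_pm (inv_seq s (- p + j))", OF iw] by simp
    then have "eventually_periodic (\<lambda>j. map_option delta_pm (inv_seq s j))"
      using eventually_periodic_shift[of "\<lambda>j. map_option delta_pm (inv_seq s j)" "- p" "\<lambda>j. map_option delta_pm (inv_seq s (- p + j))"] by simp
    then show False
      using I.eventually_periodic_delta assms(1) by (simp add: aperiodic_seq_def)
  qed
  ultimately show ?thesis
    by (simp add: aperiodic_iff aperiodic_seq_def)
qed

section \<open>Overlaps and brick words\<close>

text \<open>
Shifting \<open>I\<close> by \<open>d\<close> identifies a part of the first line with a part of the second one. At each end,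
the next letter of the first line, if there is one, is an arrow that leaves \<open>I\<close>, and the next letter of
the second line is an arrow that enters the shifted interval.
\<close>

definition overlap ::
    "(int \<Rightarrow> 'e letter option) \<Rightarrow> int set \<Rightarrow> (int \<Rightarrow> ('v, 'e) qstring) \<Rightarrow>
     (int \<Rightarrow> 'e letter option) \<Rightarrow> int set \<Rightarrow> (int \<Rightarrow> ('v, 'e) qstring) \<Rightarrow> int set \<Rightarrow> int \<Rightarrow> bool" where
  "overlap s G \<beta> s' G' \<beta>' I d \<longleftrightarrow>
     I \<noteq> {} \<and> I \<subseteq> G \<and> (\<forall>p q r. p \<in> I \<and> q \<in> I \<and> p \<le> r \<and> r \<le> q \<longrightarrow> r \<in> I) \<and>
     (\<forall>k \<in> I. k + d \<in> G' \<and> \<beta> k = \<beta>' (k + d)) \<and>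
     (\<forall>k. k \<in> I \<and> k + 1 \<in> I \<longrightarrow> s k = s' (k + d)) \<and>
     (\<forall>k. k \<in> I \<and> k + 1 \<notin> I \<longrightarrow>
        (s k = None \<or> (\<exists>e. s k = Some (Dir e))) \<and> (s' (k + d) = None \<or> (\<exists>e. s' (k + d) = Some (Inv e)))) \<and>
     (\<forall>k. k + 1 \<in> I \<and> k \<notin> I \<longrightarrow>
        (s k = None \<or> (\<exists>e. s k = Some (Inv e))) \<and> (s' (k + d) = None \<or> (\<exists>e. s' (k + d) = Some (Dir e))))"

lemma overlapD:
  assumes "overlap s G \<beta> s' G' \<beta>' I d"
  shows "I \<noteq> {}" "I \<subseteq> G" "\<lbrakk>p \<in> I; q \<in> I; p \<le> r; r \<le> q\<rbrakk> \<Longrightarrow> r \<in> I"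
    "k \<in> I \<Longrightarrow> k + d \<in> G'" "k \<in> I \<Longrightarrow> \<beta> k = \<beta>' (k + d)"
    "k \<in> I \<Longrightarrow> k + 1 \<in> I \<Longrightarrow> s k = s' (k + d)"
    "k \<in> I \<Longrightarrow> k + 1 \<notin> I \<Longrightarrow> s k = None \<or> (\<exists>e. s k = Some (Dir e))"
    "k \<in> I \<Longrightarrow> k + 1 \<notin> I \<Longrightarrow> s' (k + d) = None \<or> (\<exists>e. s' (k + d) = Some (Inv e))"
    "k + 1 \<in> I \<Longrightarrow> k \<notin> I \<Longrightarrow> s k = None \<or> (\<exists>e. s k = Some (Inv e))"
    "k + 1 \<in> I \<Longrightarrow> k \<notin> I \<Longrightarrow> s' (k + d) = None \<or> (\<exists>e. s' (k + d) = Some (Dir e))"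
  using assms unfolding overlap_def by meson+

text \<open>
The part of a line above an interval of gaps is again a line, and its marked gaps are the common
subwords that belong to an overlap.
\<close>

definition restrict_seq :: "(int \<Rightarrow> 'b option) \<Rightarrow> int set \<Rightarrow> int \<Rightarrow> 'b option" where
  "restrict_seq s I k = (if k \<in> I \<and> k + 1 \<in> I then s k else None)"

context string_line
begin

lemma line_restrict:
  assumes "I \<noteq> {}" "I \<subseteq> G" "\<And>p q r. \<lbrakk>p \<in> I; q \<in> I; p \<le> r; r \<le> q\<rbrakk> \<Longrightarrow> r \<in> I"
  shows "string_line L (restrict_seq s I) I \<beta>"
proof
  show "restrict_seq s I p \<noteq> None \<longleftrightarrow> p \<in> I \<and> p + 1 \<in> I" for p
    using assms(2) defined_iff[of p] by (auto simp: restrict_seq_def)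
  show "finite_string L us" if "us \<noteq> []" "\<And>k. k < length us \<Longrightarrow> restrict_seq s I (p + int k) = Some (us ! k)" for us p
  proof (rule segment_string[OF that(1)])
    show "s (p + int k) = Some (us ! k)" if "k < length us" for k
      using \<open>\<And>k. k < length us \<Longrightarrow> restrict_seq s I (p + int k) = Some (us ! k)\<close>[OF that]
      by (simp add: restrict_seq_def split: if_splits)
  qed
  show "\<beta> p = Triv (src L b) (- lstart L b)" "\<beta> (p + 1) = Triv (tgt L b) (lend L b)"
    if "restrict_seq s I p = Some b" for p b
    using that base_before[of p b] base_after[of p b] by (simp_all add: restrict_seq_def split: if_splits)
  show "r \<in> I" if "p \<in> I" "q \<in> I" "p \<le> r" "r \<le> q" for p q r
    using assms(3) that by blast
next
  show "I \<noteq> {}"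
    by (rule assms(1))
  show "\<beta> p \<in> trivial_strings L" if "p \<in> I" for p
    using that assms(2) by (intro base_trivial) blast
qed

end

text \<open>
If two lines have the same base point at \<open>a\<close> and \<open>b\<close>, then agreement of the directions of the next \<open>n\<close>
letters implies agreement of the letters.
\<close>

lemma match_right:
  assumes "string_line L s G \<beta>" "string_line L s' G' \<beta>'" "\<beta> a = \<beta>' b"
    and "\<And>m. m < n \<Longrightarrow> s (a + int m) \<noteq> None \<and> map_option delta_pm (s (a + int m)) = map_option delta_pm (s' (b + int m))"
  shows "\<beta> (a + int n) = \<beta>' (b + int n) \<and> (\<forall>m < n. s (a + int m) = s' (b + int m))"
  using assms(4)
proof (induction n)
  case (Suc n)
  then have IH: "\<beta> (a + int n) = \<beta>' (b + int n)" "\<forall>m < n. s (a + int m) = s' (b + int m)"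
    by auto
  obtain x y where xy: "s (a + int n) = Some x" "s' (b + int n) = Some y" "delta_pm x = delta_pm y"
    using Suc.prems[of n] by (cases "s (a + int n)"; cases "s' (b + int n)") auto
  from letters_eq_after[OF assms(1,2) IH(1) xy] xy(1,2) IH(2) show ?case
    by (auto simp: less_Suc_eq algebra_simps)
qed (simp add: assms(3))

lemma match_left:
  assumes "string_line L s G \<beta>" "string_line L s' G' \<beta>'" "\<beta> a = \<beta>' b"
    and "\<And>m. m < n \<Longrightarrow> s (a - 1 - int m) \<noteq> None \<and> map_option delta_pm (s (a - 1 - int m)) = map_option delta_pm (s' (b - 1 - int m))"
  shows "\<beta> (a - int n) = \<beta>' (b - int n) \<and> (\<forall>m < n. s (a - 1 - int m) = s' (b - 1 - int m))"
  using assms(4)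
proof (induction n)
  case (Suc n)
  then have IH: "\<beta> (a - int n) = \<beta>' (b - int n)" "\<forall>m < n. s (a - 1 - int m) = s' (b - 1 - int m)"
    by auto
  obtain x y where xy: "s (a - int n - 1) = Some x" "s' (b - int n - 1) = Some y" "delta_pm x = delta_pm y"
    using Suc.prems[of n]
    by (cases "s (a - int n - 1)"; cases "s' (b - int n - 1)") (auto simp: algebra_simps)
  from letters_eq_before[OF assms(1,2) IH(1) xy] xy(1,2) IH(2) show ?case
    by (auto simp: less_Suc_eq algebra_simps)
qed (simp add: assms(3))

lemma based_eqD:
  assumes S: "string_line L s G \<beta>" and S': "string_line L s' G' \<beta>'"
    and "a \<in> G" "b \<in> G'" "based delta_pm s \<beta> a = based delta_pm s' \<beta>' b"
  shows "\<beta> a = \<beta>' b" "s (a + j) = s' (b + j)"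
proof -
  interpret S: string_line L s G \<beta> by fact
  interpret S': string_line L s' G' \<beta>' by fact
  show \<beta>: "\<beta> a = \<beta>' b"
    using assms(5) by (simp add: based_def)
  have h: "map_hword delta_pm (lhalf s a) = map_hword delta_pm (lhalf s' b)"
      "map_hword delta_pm (rhalf s a) = map_hword delta_pm (rhalf s' b)"
    using assms(5) by (simp_all add: based_def)
  have r: "map_option delta_pm (s (a + int n)) = map_option delta_pm (s' (b + int n))" for n
    using arg_cong[OF h(2), of "\<lambda>h. hnth h n"]
    by (simp add: hnth_map S.hnth_rhalf[OF assms(3)] S'.hnth_rhalf[OF assms(4)])
  have l: "map_option delta_pm (s (a - 1 - int n)) = map_option delta_pm (s' (b - 1 - int n))" for n
    using arg_cong[OF h(1), of "\<lambda>h. hnth h n"]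
    by (simp add: hnth_map S.hnth_lhalf[OF assms(3)] S'.hnth_lhalf[OF assms(4)])
  have "s (a + int n) = s' (b + int n)" for n
  proof (cases "s (a + int n)")
    case None
    then show ?thesis using r[of n] by simp
  next
    case (Some x)
    have "s (a + int m) \<noteq> None \<and> map_option delta_pm (s (a + int m)) = map_option delta_pm (s' (b + int m))"
      if "m < Suc n" for m
      using S.defined_before[OF Some assms(3), of "a + int m"] that r by auto
    from match_right[OF S S' \<beta> this] show ?thesis
      by blast
  qed
  moreover have "s (a - 1 - int n) = s' (b - 1 - int n)" for n
  proof (cases "s (a - 1 - int n)")
    case None
    then show ?thesis using l[of n] by simp
  next
    case (Some x)
    have "s (a - 1 - int m) \<noteq> None \<and> map_option delta_pm (s (a - 1 - int m)) = map_option delta_pm (s' (b - 1 - int m))"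
      if "m < Suc n" for m
      using S.defined_after[OF Some assms(3), of "a - 1 - int m"] that l by auto
    from match_left[OF S S' \<beta> this] show ?thesis
      by blast
  qed
  ultimately have "s (a + int (nat j)) = s' (b + int (nat j))"
      "s (a - 1 - int (nat (- j - 1))) = s' (b - 1 - int (nat (- j - 1)))"
    by blast+
  then show "s (a + j) = s' (b + j)"
    by (cases "j \<ge> 0") (auto simp: algebra_simps)
qed

lemma alphabet_delta: "alphabet (delta_mia L) = {0}"
  by (simp add: delta_mia_def)

lemma overlap_subword:
  assumes S: "string_line L s G \<beta>" and S': "string_line L s' G' \<beta>'"
    and ov: "overlap s G \<beta> s' G' \<beta>' I d" and a: "a \<in> I" and p: "p \<in> G" and q: "q \<in> G'"
  defines "w \<equiv> based delta_pm (restrict_seq s I) \<beta> a"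
  shows "w \<in> words (delta_mia L)"
    "factor_subword (delta_mia L) w (based delta_pm s \<beta> p)"
    "image_subword (delta_mia L) w (based delta_pm s' \<beta>' q)"
proof -
  interpret S: string_line L s G \<beta> by fact
  interpret S': string_line L s' G' \<beta>' by fact
  let ?s = "restrict_seq s I"
  have line: "string_line L ?s I \<beta>"
    by (rule S.line_restrict[OF overlapD(1,2)[OF ov]]) (rule overlapD(3)[OF ov])
  interpret I: line_reader L ?s I \<beta> "delta_mia L" delta_pm
    by (rule line_reader.intro[OF line reader_delta_mia[OF S.string_algebra_axioms]])
  interpret R: line_reader L s G \<beta> "delta_mia L" delta_pm
    by (rule line_reader.intro[OF S.string_line_axioms reader_delta_mia[OF S.string_algebra_axioms]])
  interpret R': line_reader L s' G' \<beta>' "delta_mia L" delta_pm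
    by (rule line_reader.intro[OF S'.string_line_axioms reader_delta_mia[OF S.string_algebra_axioms]])
  have aG: "a \<in> G" "a + d \<in> G'" "\<beta> a = \<beta>' (a + d)"
    using overlapD(2,4,5)[OF ov] a by blast+
  have s: "?s k \<noteq> None \<Longrightarrow> s k = ?s k" "?s k \<noteq> None \<Longrightarrow> s' (k + d) = ?s k" for k
    using overlapD(6)[OF ov, of k] by (simp_all add: restrict_seq_def split: if_splits)
  have right_end: "a + int n \<in> I \<and> a + int n + 1 \<notin> I" if "hend (map_hword delta_pm (rhalf ?s a)) n" for n
  proof -
    have e: "?s (a + int m) = None \<longleftrightarrow> n \<le> m" for m
      using that by (simp add: hend_def hnth_map I.hnth_rhalf[OF a])
    have "a + int n \<in> I"
      using e[of "n - 1"] a I.defined_gaps[of "a + int (n - 1)"] by (cases n) (auto simp: algebra_simps)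
    then show ?thesis
      using e[of n] I.gap_defined[of "a + int n"] by auto
  qed
  have left_end: "a - 1 - int n + 1 \<in> I \<and> a - 1 - int n \<notin> I" if "hend (map_hword delta_pm (lhalf ?s a)) n" for n
  proof -
    have e: "?s (a - 1 - int m) = None \<longleftrightarrow> n \<le> m" for m
      using that by (simp add: hend_def hnth_map I.hnth_lhalf[OF a])
    have "a - int n \<in> I"
      using e[of "n - 1"] a I.defined_gaps[of "a - 1 - int (n - 1)"] by (cases n) (auto simp: algebra_simps)
    then show ?thesis
      using e[of n] I.gap_defined[of "a - 1 - int n"] by auto
  qed
  show "w \<in> words (delta_mia L)"
    unfolding w_def by (rule I.based_in_words[OF a])
  have bd: "k \<in> I \<Longrightarrow> k + 1 \<notin> I \<Longrightarrow>
        (s k = None \<or> (\<exists>e. s k = Some (Dir e))) \<and> (s' (k + d) = None \<or> (\<exists>e. s' (k + d) = Some (Inv e)))"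
     "k + 1 \<in> I \<Longrightarrow> k \<notin> I \<Longrightarrow>
        (s k = None \<or> (\<exists>e. s k = Some (Inv e))) \<and> (s' (k + d) = None \<or> (\<exists>e. s' (k + d) = Some (Dir e)))" for k
    using overlapD(7-10)[OF ov, of k] by blast+
  show "factor_subword (delta_mia L) w (based delta_pm s \<beta> p)"
    unfolding w_def based_def[of delta_pm ?s] factor_subword_iff alphabet_delta
  proof (intro exI conjI allI impI)
    show "sim (delta_mia L) (map_hword delta_pm (lhalf s a), \<beta> a, map_hword delta_pm (rhalf s a)) (based delta_pm s \<beta> p)"
      using R.sim_based_iff[OF p] aG(1) by (auto simp: based_def)
    show "hprefix (map_hword delta_pm (lhalf ?s a)) (map_hword delta_pm (lhalf s a))"
      using s(1) by (auto simp: hprefix_iff hnth_map I.hnth_lhalf a S.hnth_lhalf aG)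
    show "hprefix (map_hword delta_pm (rhalf ?s a)) (map_hword delta_pm (rhalf s a))"
      using s(1) by (auto simp: hprefix_iff hnth_map I.hnth_rhalf a S.hnth_rhalf aG)
    show "hnth (map_hword delta_pm (lhalf s a)) n = None \<or> (\<exists>b\<in>{0}. hnth (map_hword delta_pm (lhalf s a)) n = Some (Inv b))"
      if "hend (map_hword delta_pm (lhalf ?s a)) n" for n
      using bd(2)[of "a - 1 - int n"] left_end[OF that] by (auto simp: hnth_map S.hnth_lhalf aG delta_def)
    show "hnth (map_hword delta_pm (rhalf s a)) n = None \<or> (\<exists>b\<in>{0}. hnth (map_hword delta_pm (rhalf s a)) n = Some (Dir b))"
      if "hend (map_hword delta_pm (rhalf ?s a)) n" for n
      using bd(1)[of "a + int n"] right_end[OF that] by (auto simp: hnth_map S.hnth_rhalf aG delta_def)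
  qed
  show "image_subword (delta_mia L) w (based delta_pm s' \<beta>' q)"
    unfolding w_def based_def[of delta_pm ?s] image_subword_iff alphabet_delta
  proof (intro exI conjI allI impI)
    show "sim (delta_mia L) (map_hword delta_pm (lhalf s' (a + d)), \<beta> a, map_hword delta_pm (rhalf s' (a + d))) (based delta_pm s' \<beta>' q)"
      using R'.sim_based_iff[OF q] aG by (auto simp: based_def)
    have eq: "a + d - 1 - int n = a - 1 - int n + d" "a + d + int n = a + int n + d" for n
      by auto
    show "hprefix (map_hword delta_pm (lhalf ?s a)) (map_hword delta_pm (lhalf s' (a + d)))"
      using s(2) by (auto simp: hprefix_iff hnth_map I.hnth_lhalf a S'.hnth_lhalf aG eq)
    show "hprefix (map_hword delta_pm (rhalf ?s a)) (map_hword delta_pm (rhalf s' (a + d)))"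
      using s(2) by (auto simp: hprefix_iff hnth_map I.hnth_rhalf a S'.hnth_rhalf aG eq)
    show "hnth (map_hword delta_pm (lhalf s' (a + d))) n = None \<or> (\<exists>b\<in>{0}. hnth (map_hword delta_pm (lhalf s' (a + d))) n = Some (Dir b))"
      if "hend (map_hword delta_pm (lhalf ?s a)) n" for n
      using bd(2)[of "a - 1 - int n"] left_end[OF that] by (auto simp: hnth_map S'.hnth_lhalf aG delta_def eq)
    show "hnth (map_hword delta_pm (rhalf s' (a + d))) n = None \<or> (\<exists>b\<in>{0}. hnth (map_hword delta_pm (rhalf s' (a + d))) n = Some (Inv b))"
      if "hend (map_hword delta_pm (rhalf ?s a)) n" for n
      using bd(1)[of "a + int n"] right_end[OF that] by (auto simp: hnth_map S'.hnth_rhalf aG delta_def eq)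
  qed
qed

text \<open>
Conversely, every common factor and image subword comes from an overlap. The last conclusion is
used to recognise the one trivial overlap of a line with itself.
\<close>

lemma subword_overlap:
  assumes S: "string_line L s G \<beta>" and S': "string_line L s' G' \<beta>'"
    and p: "p \<in> G" and q: "q \<in> G'"
    and fac: "factor_subword (delta_mia L) w (based delta_pm s \<beta> p)"
    and im: "image_subword (delta_mia L) w (based delta_pm s' \<beta>' q)"
  obtains I d where "overlap s G \<beta> s' G' \<beta>' I d"
    "I = G \<Longrightarrow> sim (delta_mia L) w (based delta_pm s \<beta> p)"
proof -
  interpret S: string_line L s G \<beta> by fact
  interpret S': string_line L s' G' \<beta>' by fact
  interpret R: line_reader L s G \<beta> "delta_mia L" delta_pm
    by (rule line_reader.intro[OF S.string_line_axioms reader_delta_mia[OF S.string_algebra_axioms]])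
  interpret R': line_reader L s' G' \<beta>' "delta_mia L" delta_pm
    by (rule line_reader.intro[OF S'.string_line_axioms reader_delta_mia[OF S.string_algebra_axioms]])
  obtain l v r where w: "w = (l, v, r)"
    by (cases w)
  from fac[unfolded w factor_subword_iff alphabet_delta] obtain l1 r1 where
    1: "sim (delta_mia L) (l1, v, r1) (based delta_pm s \<beta> p)" "hprefix l l1" "hprefix r r1"
      "\<And>n. hend l n \<Longrightarrow> hnth l1 n = None \<or> hnth l1 n = Some (Inv 0)"
      "\<And>n. hend r n \<Longrightarrow> hnth r1 n = None \<or> hnth r1 n = Some (Dir 0)"
    by blast
  from im[unfolded w image_subword_iff alphabet_delta] obtain l2 r2 where
    2: "sim (delta_mia L) (l2, v, r2) (based delta_pm s' \<beta>' q)" "hprefix l l2" "hprefix r r2"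
      "\<And>n. hend l n \<Longrightarrow> hnth l2 n = None \<or> hnth l2 n = Some (Dir 0)"
      "\<And>n. hend r n \<Longrightarrow> hnth r2 n = None \<or> hnth r2 n = Some (Inv 0)"
    by blast
  obtain a where a: "a \<in> G" "l1 = map_hword delta_pm (lhalf s a)" "v = \<beta> a" "r1 = map_hword delta_pm (rhalf s a)"
    using 1(1) R.sim_based_iff[OF p] by (auto simp: based_def)
  obtain b where b: "b \<in> G'" "l2 = map_hword delta_pm (lhalf s' b)" "v = \<beta>' b" "r2 = map_hword delta_pm (rhalf s' b)"
    using 2(1) R'.sim_based_iff[OF q] by (auto simp: based_def)
  note h = hnth_map S.hnth_lhalf[OF a(1)] S.hnth_rhalf[OF a(1)] S'.hnth_lhalf[OF b(1)] S'.hnth_rhalf[OF b(1)]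
  have r: "map_option delta_pm (s (a + int n)) = hnth r n" "map_option delta_pm (s' (b + int n)) = hnth r n" if "hnth r n \<noteq> None" for n
    using that 1(3) 2(3) unfolding hprefix_iff a b h by auto
  have l: "map_option delta_pm (s (a - 1 - int n)) = hnth l n" "map_option delta_pm (s' (b - 1 - int n)) = hnth l n" if "hnth l n \<noteq> None" for n
    using that 1(2) 2(2) unfolding hprefix_iff a b h by auto
  \<comment> \<open>the gaps covered by \<open>w\<close> when its base point is put at \<open>a\<close>\<close>
  define I where "I = {k. k = a \<or> (a < k \<and> hnth r (nat (k - 1 - a)) \<noteq> None) \<or> (k < a \<and> hnth l (nat (a - 1 - k)) \<noteq> None)}"
  define d where "d = b - a"
  have \<beta>: "\<beta> a = \<beta>' b"
    using a b by simp
  have right: "a + int n \<in> I \<longleftrightarrow> (\<forall>m < n. hnth r m \<noteq> None)" for n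
  proof (cases n)
    case (Suc m)
    have "a + int n \<in> I \<longleftrightarrow> hnth r m \<noteq> None"
      by (simp add: I_def Suc)
    also have "\<dots> \<longleftrightarrow> (\<forall>j < n. hnth r j \<noteq> None)"
      unfolding Suc less_Suc_eq_le by (metis hnth_None_mono le_refl)
    finally show ?thesis .
  qed (simp add: I_def)
  have left: "a - int n \<in> I \<longleftrightarrow> (\<forall>m < n. hnth l m \<noteq> None)" for n
  proof (cases n)
    case (Suc m)
    have "a - int n \<in> I \<longleftrightarrow> hnth l m \<noteq> None"
      by (simp add: I_def Suc)
    also have "\<dots> \<longleftrightarrow> (\<forall>j < n. hnth l j \<noteq> None)"
      unfolding Suc less_Suc_eq_le by (metis hnth_None_mono le_refl)
    finally show ?thesis .
  qed (simp add: I_def)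
  have right': "\<beta> (a + int n) = \<beta>' (b + int n) \<and> (\<forall>m < n. s (a + int m) = s' (b + int m) \<and> s (a + int m) \<noteq> None)"
    if "a + int n \<in> I" for n
  proof -
    have "s (a + int m) \<noteq> None \<and> map_option delta_pm (s (a + int m)) = map_option delta_pm (s' (b + int m))" if "m < n" for m
      using right[of n] \<open>a + int n \<in> I\<close> r[of m] that by (metis option.map_disc_iff)
    then show ?thesis
      using match_right[OF S.string_line_axioms S'.string_line_axioms \<beta>, of n] by blast
  qed
  have left': "\<beta> (a - int n) = \<beta>' (b - int n) \<and> (\<forall>m < n. s (a - 1 - int m) = s' (b - 1 - int m) \<and> s (a - 1 - int m) \<noteq> None)"
    if "a - int n \<in> I" for n
  proof -
    have "s (a - 1 - int m) \<noteq> None \<and> map_option delta_pm (s (a - 1 - int m)) = map_option delta_pm (s' (b - 1 - int m))" if "m < n" for m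
      using left[of n] \<open>a - int n \<in> I\<close> l[of m] that by (metis option.map_disc_iff)
    then show ?thesis
      using match_left[OF S.string_line_axioms S'.string_line_axioms \<beta>, of n] by blast
  qed
  have cases: "\<exists>n. k = a + int n \<or> k = a - int n" for k
    by (intro exI[of _ "nat \<bar>k - a\<bar>"]) auto
  have "I \<noteq> {}"
    by (auto simp: I_def)
  moreover have gaps: "k \<in> G \<and> k + d \<in> G' \<and> \<beta> k = \<beta>' (k + d)" if k: "k \<in> I" for k
  proof -
    from cases[of k] obtain n where "k = a + int n \<or> k = a - int n"
      by blast
    then show ?thesis
    proof
      assume n: "k = a + int n"
      have "k \<in> G \<and> k + d \<in> G'"
      proof (cases n)
        case 0
        then show ?thesis
          using n a b by (simp add: d_def)
      next
        case (Suc m)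
        then have "s (a + int m) = s' (b + int m) \<and> s (a + int m) \<noteq> None"
          using right'[of n] k n by blast
        then obtain z where z: "s (a + int m) = Some z" "s' (b + int m) = Some z"
          by (metis not_None_eq)
        show ?thesis
          using S.defined_gaps[OF z(1)] S'.defined_gaps[OF z(2)] n Suc by (simp add: d_def algebra_simps)
      qed
      then show ?thesis
        using right'[of n] k n by (simp add: d_def algebra_simps)
    next
      assume n: "k = a - int n"
      have "k \<in> G \<and> k + d \<in> G'"
      proof (cases n)
        case 0
        then show ?thesis
          using n a b by (simp add: d_def)
      next
        case (Suc m)
        then have "s (a - 1 - int m) = s' (b - 1 - int m) \<and> s (a - 1 - int m) \<noteq> None"
          using left'[of n] k n by blast
        then obtain z where z: "s (a - 1 - int m) = Some z" "s' (b - 1 - int m) = Some z"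
          by (metis not_None_eq)
        have e: "k = a - 1 - int m" "k + d = b - 1 - int m"
          using n Suc by (auto simp: d_def)
        have "k \<in> G"
          unfolding e(1) using S.defined_gaps[OF z(1)] by blast
        moreover have "k + d \<in> G'"
          unfolding e(2) using S'.defined_gaps[OF z(2)] by blast
        ultimately show ?thesis ..
      qed
      moreover have e: "a - int n = k" "b - int n = k + d"
        using n by (auto simp: d_def)
      ultimately show ?thesis
        using left'[of n, unfolded e] k by blast
    qed
  qed
  moreover have "k \<in> I" if "i \<in> I" "j \<in> I" "i \<le> k" "k \<le> j" for i j k
  proof (cases "a \<le> k")
    case True
    define n where "n = nat (k - a)"
    define m where "m = nat (j - a)"
    have "k = a + int n" "j = a + int m" "n \<le> m"
      using True that by (auto simp: n_def m_def)
    then show ?thesis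
      using that right[of n] right[of m] by auto
  next
    case False
    define n where "n = nat (a - k)"
    define m where "m = nat (a - i)"
    have "k = a - int n" "i = a - int m" "n \<le> m"
      using False that by (auto simp: n_def m_def)
    then show ?thesis
      using that left[of n] left[of m] by auto
  qed
  moreover have "s k = s' (k + d)" if "k \<in> I" "k + 1 \<in> I" for k
  proof (cases "a \<le> k")
    case True
    define n where "n = nat (k - a)"
    have e: "a + int n = k" "b + int n = k + d" "a + int (Suc n) = k + 1"
      using True by (auto simp: n_def d_def)
    have "s (a + int n) = s' (b + int n)"
      using right'[of "Suc n", unfolded e(3)] that(2) by blast
    then show ?thesis
      unfolding e .
  next
    case False
    define n where "n = nat (a - 1 - k)"
    have e: "a - 1 - int n = k" "b - 1 - int n = k + d" "a - int (Suc n) = k"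
      using False by (auto simp: n_def d_def)
    have "s (a - 1 - int n) = s' (b - 1 - int n)"
      using left'[of "Suc n", unfolded e(3)] that(1) by blast
    then show ?thesis
      unfolding e .
  qed
  moreover have "(s k = None \<or> (\<exists>e. s k = Some (Dir e))) \<and> (s' (k + d) = None \<or> (\<exists>e. s' (k + d) = Some (Inv e)))"
    if "k \<in> I" "k + 1 \<notin> I" for k
  proof (cases "a \<le> k")
    case True
    define n where "n = nat (k - a)"
    have e: "a + int n = k" "b + int n = k + d" "a + int (Suc n) = k + 1"
      using True by (auto simp: n_def d_def)
    have "\<forall>m < n. hnth r m \<noteq> None" "\<not> (\<forall>m < Suc n. hnth r m \<noteq> None)"
      using that right[of n, unfolded e] right[of "Suc n", unfolded e] by blast+
    then have "hend r n"
      using hnth_None_mono[of r n] unfolding hend_def less_Suc_eq by (metis not_le)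
    from 1(5)[OF this, unfolded a(4) h e] 2(5)[OF this, unfolded b(4) h e] show ?thesis
      by (auto simp: delta_pm_eq)
  next
    case False
    define n where "n = nat (a - 1 - k)"
    have e: "a - 1 - int n = k" "b - 1 - int n = k + d" "a - int (Suc n) = k" "a - int n = k + 1"
      using False by (auto simp: n_def d_def)
    show ?thesis
      using that left[of n, unfolded e] left[of "Suc n", unfolded e] by auto
  qed
  moreover have "(s k = None \<or> (\<exists>e. s k = Some (Inv e))) \<and> (s' (k + d) = None \<or> (\<exists>e. s' (k + d) = Some (Dir e)))"
    if "k + 1 \<in> I" "k \<notin> I" for k
  proof (cases "a \<le> k")
    case True
    define n where "n = nat (k - a)"
    have e: "a + int n = k" "b + int n = k + d" "a + int (Suc n) = k + 1"
      using True by (auto simp: n_def d_def)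
    show ?thesis
      using that right[of n, unfolded e] right[of "Suc n", unfolded e] by auto
  next
    case False
    define n where "n = nat (a - 1 - k)"
    have e: "a - 1 - int n = k" "b - 1 - int n = k + d" "a - int (Suc n) = k" "a - int n = k + 1"
      using False by (auto simp: n_def d_def)
    have "\<forall>m < n. hnth l m \<noteq> None" "\<not> (\<forall>m < Suc n. hnth l m \<noteq> None)"
      using that left[of n, unfolded e] left[of "Suc n", unfolded e] by blast+
    then have "hend l n"
      using hnth_None_mono[of l n] unfolding hend_def less_Suc_eq by (metis not_le)
    from 1(4)[OF this, unfolded a(2) h e] 2(4)[OF this, unfolded b(2) h e] show ?thesis
      by (auto simp: delta_pm_eq)
  qed
  ultimately have "overlap s G \<beta> s' G' \<beta>' I d"
    unfolding overlap_def by blast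
  moreover have "sim (delta_mia L) w (based delta_pm s \<beta> p)" if "I = G"
  proof -
    have "r = r1"
    proof (rule hword_eqI)
      fix n
      show "hnth r n = hnth r1 n"
      proof (cases "hnth r n")
        case None
        then have "a + int (Suc n) \<notin> G"
          using right[of "Suc n"] that by blast
        then show ?thesis
          using None S.defined_gaps[of "a + int n"] by (cases "s (a + int n)") (auto simp: a h algebra_simps)
      qed (use r[of n] in \<open>auto simp: a h\<close>)
    qed
    moreover have "l = l1"
    proof (rule hword_eqI)
      fix n
      show "hnth l n = hnth l1 n"
      proof (cases "hnth l n")
        case None
        then have "a - int (Suc n) \<notin> G"
          using left[of "Suc n"] that by blast
        then show ?thesis
          using None S.defined_gaps[of "a - 1 - int n"] by (cases "s (a - 1 - int n)") (auto simp: a h algebra_simps)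
      qed (use l[of n] in \<open>auto simp: a h\<close>)
    qed
    ultimately show ?thesis
      using 1(1) w by simp
  qed
  ultimately show ?thesis
    using that by blast
qed

context string_line
begin

text \<open>
A string is not its own inverse. The reflection that exchanges both fixes the middle syllable, which
would be its own inverse, or the middle gap, whose two adjacent syllables would be mutually inverse. If
there are no syllables, the sign at the only gap distinguishes the two.
\<close>

lemma based_ne_inverse:
  assumes "c \<in> G" "c' \<in> uminus ` G"
  shows "based delta_pm s \<beta> c \<noteq> based delta_pm (inv_seq s) (inv_base \<beta>) c'"
proof
  assume eq: "based delta_pm s \<beta> c = based delta_pm (inv_seq s) (inv_base \<beta>) c'"
  define e where "e = c - c'"
  note D = based_eqD[OF string_line_axioms inverse_line assms eq]
  \<comment> \<open>the reflection; it sends the gap \<open>k\<close> to \<open>e - k\<close>\<close>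
  have refl: "s k = map_option linv (s (e - 1 - k))" for k
    using D(2)[of "k - c"] by (simp add: inv_seq_def e_def algebra_simps)
  have e: "e - c \<in> G"
    using assms(2) by (auto simp: e_def)
  have mem: "r \<in> G" if "min c (e - c) \<le> r" "r \<le> max c (e - c)" for r
    using convex[of c "e - c" r] convex[of "e - c" c r] e assms(1) that
    by (cases "c \<le> e - c") simp_all
  have letter: "linv b \<noteq> b" for b :: "'b letter"
    by (cases b) auto
  show False
  proof (cases "even e")
    case True
    then obtain m where m: "e = 2 * m"
      by (elim evenE)
    show False
    proof (cases "c = m")
      case True
      then have "c' = - c"
        using m by (simp add: e_def)
      then show False
        using D(1) bar_base[OF assms(1)] by (simp add: inv_base_def)
    next
      case False
      then have "m - 1 \<in> G" "m \<in> G" "m + 1 \<in> G"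
        using mem[of "m - 1"] mem[of m] mem[of "m + 1"] by (simp_all add: m min_def max_def split: if_splits)
      then obtain b b' where "s (m - 1) = Some b" "s (m - 1 + 1) = Some b'"
        using gap_defined[of "m - 1"] gap_defined[of m] by (metis diff_add_cancel)
      moreover from this have "b' = linv b"
        using refl[of m] by (simp add: m)
      ultimately show False
        using not_inverse[of "m - 1" b b'] by simp
    qed
  next
    case False
    then obtain m where m: "e = 2 * m + 1"
      by (elim oddE)
    have "m \<in> G" "m + 1 \<in> G"
      using mem[of m] mem[of "m + 1"] by (simp_all add: m min_def max_def split: if_splits)
    then obtain b where "s m = Some b"
      using gap_defined by blast
    moreover have "s m = map_option linv (s m)"
      by (subst (1) refl) (simp add: m)
    ultimately have "Some b = Some (linv b)"
      by (metis option.map(2))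
    then show False
      using letter[of b] by simp
  qed
qed

text \<open>
For \<open>d = 0\<close> the conditions at an end of \<open>I\<close> contradict each other unless the line ends there, too.
\<close>

lemma overlap_zero:
  assumes "overlap s G \<beta> s G \<beta> I 0"
  shows "I = G"
proof -
  note ov = overlapD[OF assms, simplified]
  obtain a where a: "a \<in> I"
    using ov(1) by blast
  have "a \<in> G"
    using a ov(2) by blast
  have right: "a + int n \<in> G \<Longrightarrow> a + int n \<in> I" for n
  proof (induction n)
    case (Suc n)
    then have "a + int n \<in> G" "a + int n + 1 \<in> G"
      using convex[of a "a + int (Suc n)" "a + int n"] \<open>a \<in> G\<close> by (auto simp: algebra_simps)
    then show ?case
      using Suc.IH ov(7,8)[of "a + int n"] gap_defined[of "a + int n"] by (force simp: algebra_simps)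
  qed (simp add: a)
  have left: "a - int n \<in> G \<Longrightarrow> a - int n \<in> I" for n
  proof (induction n)
    case (Suc n)
    define k where "k = a - int (Suc n)"
    have k: "a - int n = k + 1"
      by (simp add: k_def)
    have "k \<in> G" "k + 1 \<in> G"
      using convex[of k a "k + 1"] \<open>a \<in> G\<close> Suc.prems by (auto simp: k_def)
    then have "k \<in> I"
      using Suc.IH[unfolded k] ov(9,10)[of k] gap_defined[of k] by force
    then show ?case
      by (simp add: k_def)
  qed (simp add: a)
  have "k \<in> I" if "k \<in> G" for k
    using right[of "nat (k - a)"] left[of "nat (a - k)"] that by (cases "a \<le> k") auto
  then show ?thesis
    using ov(2) by blast
qed

text \<open>
Suppose that the part above \<open>I\<close>, marked at \<open>a\<close>, is the whole line, marked at \<open>c\<close>. If \<open>I\<close> is unbounded to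
one side, the shift by \<open>d\<close> makes this end of the line periodic. Otherwise both ends of \<open>I\<close> and of its
shift lie within the whole line, which extends from \<open>c\<close> as far as \<open>I\<close> does from \<open>a\<close>; this forces
\<open>a = c = a + d\<close>.
\<close>

lemma overlap_not_sim:
  assumes "aperiodic_seq s" "overlap s G \<beta> s G \<beta> I d" "d \<noteq> 0" "a \<in> I" "c \<in> G"
  shows "based delta_pm (restrict_seq s I) \<beta> a \<noteq> based delta_pm s \<beta> c"
proof
  assume eq: "based delta_pm (restrict_seq s I) \<beta> a = based delta_pm s \<beta> c"
  note ov = overlapD[OF assms(2)]
  let ?s = "restrict_seq s I"
  have line: "string_line L ?s I \<beta>"
    by (rule line_restrict[OF ov(1,2)]) (rule ov(3))
  interpret I: string_line L ?s I \<beta>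
    by (rule line)
  have same: "?s (a + j) = s (c + j)" for j
    using based_eqD(2)[OF line string_line_axioms assms(4,5) eq] .
  have I: "?s k \<noteq> None \<Longrightarrow> s k = ?s k \<and> s (k + d) = s k" for k
    using ov(6)[of k] by (auto simp: restrict_seq_def split: if_splits)
  have ad: "a \<in> G" "a + d \<in> G"
    using ov(2,4) assms(4) by blast+
  have "\<exists>n. ?s (a + int n) = None"
  proof (rule ccontr)
    assume no: "\<nexists>n. ?s (a + int n) = None"
    have *: "s k \<noteq> None \<and> s (k + d) = s k" if "a \<le> k" for k
    proof -
      have "a + int (nat (k - a)) = k"
        using that by simp
      then have "?s k \<noteq> None"
        using no by metis
      then show ?thesis
        using I[of k] by simp
    qed
    have "eventually_periodic s"
    proof (cases "d > 0")
      case True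
      then show ?thesis
        unfolding eventually_periodic_def using * by (intro exI[of _ a] exI[of _ d]) simp
    next
      case False
      have "s k \<noteq> None \<and> s (k + - d) = s k" if "a - d \<le> k" for k
        using *[of k] *[of "k - d"] that False assms(3) by auto
      then show ?thesis
        unfolding eventually_periodic_def using False assms(3)
        by (intro exI[of _ "a - d"] exI[of _ "- d"]) simp
    qed
    then show False
      using assms(1) by (simp add: aperiodic_seq_def)
  qed
  then obtain n where n: "?s (a + int n) = None" "\<And>m. m < n \<Longrightarrow> ?s (a + int m) \<noteq> None"
    using exists_least_iff[of "\<lambda>n. ?s (a + int n) = None"] by blast
  have nI: "a + int n \<in> I"
  proof (cases n)
    case (Suc m)
    then show ?thesis
      using n(2)[of m] by (auto simp: restrict_seq_def algebra_simps split: if_splits)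
  qed (simp add: assms(4))
  have cn: "c + int n \<in> G" "c + int n + 1 \<notin> G"
  proof -
    show G: "c + int n \<in> G"
    proof (cases n)
      case (Suc m)
      then have "s (c + int m) \<noteq> None"
        using n(2)[of m] same[of "int m"] by simp
      then show ?thesis
        using defined_iff[of "c + int m"] Suc by (simp add: algebra_simps)
    qed (simp add: assms(5))
    show "c + int n + 1 \<notin> G"
      using gap_defined[OF G] n(1) same[of "int n"] by auto
  qed
  have up: "k \<le> c + int n" if "k \<in> G" for k
    using convex[OF cn(1) that, of "c + int n + 1"] cn(2) by fastforce
  have "a + int n \<le> c + int n" "a + int n + d \<le> c + int n"
    using up nI ov(2,4) by blast+
  moreover have "\<exists>n. ?s (a - 1 - int n) = None"
  proof (rule ccontr)
    assume no: "\<nexists>n. ?s (a - 1 - int n) = None"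
    have *: "s k \<noteq> None \<and> s (k + d) = s k" if "k < a" for k
    proof -
      have "a - 1 - int (nat (a - 1 - k)) = k"
        using that by simp
      then have "?s k \<noteq> None"
        using no by metis
      then show ?thesis
        using I[of k] by simp
    qed
    have inv: "inv_seq s i \<noteq> None \<and> inv_seq s (i - d) = inv_seq s i" if "- a \<le> i" for i
      using *[of "- i - 1"] that by (auto simp: inv_seq_def algebra_simps)
    have "eventually_periodic (inv_seq s)"
    proof (cases "d < 0")
      case True
      have "inv_seq s i \<noteq> None \<and> inv_seq s (i + - d) = inv_seq s i" if "- a \<le> i" for i
        using inv[OF that] by simp
      then show ?thesis
        unfolding eventually_periodic_def using True by (intro exI[of _ "- a"] exI[of _ "- d"]) simp
    next
      case False
      have "inv_seq s i \<noteq> None \<and> inv_seq s (i + d) = inv_seq s i" if "- a \<le> i" for i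
        using inv[OF that] inv[of "i + d"] that False by simp
      then show ?thesis
        unfolding eventually_periodic_def using False assms(3)
        by (intro exI[of _ "- a"] exI[of _ d]) simp
    qed
    then show False
      using assms(1) by (simp add: aperiodic_seq_def)
  qed
  then obtain m where m: "?s (a - 1 - int m) = None" "\<And>j. j < m \<Longrightarrow> ?s (a - 1 - int j) \<noteq> None"
    using exists_least_iff[of "\<lambda>n. ?s (a - 1 - int n) = None"] by blast
  have mI: "a - int m \<in> I"
  proof (cases m)
    case (Suc j)
    then show ?thesis
      using m(2)[of j] by (auto simp: restrict_seq_def algebra_simps split: if_splits)
  qed (simp add: assms(4))
  have cm: "c - int m \<in> G" "c - int m - 1 \<notin> G"
  proof -
    show G: "c - int m \<in> G"
    proof (cases m)
      case (Suc j)
      then have "s (c - 1 - int j) \<noteq> None"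
        using m(2)[of j] same[of "- 1 - int j"] by (simp add: algebra_simps)
      then show ?thesis
        using defined_iff[of "c - 1 - int j"] Suc by (simp add: algebra_simps)
    qed (simp add: assms(5))
    have "s (c - int m - 1) = None"
      using m(1) same[of "- 1 - int m"] by (simp add: algebra_simps)
    then show "c - int m - 1 \<notin> G"
      using gap_defined[of "c - int m - 1"] G by auto
  qed
  have down: "c - int m \<le> k" if "k \<in> G" for k
    using convex[OF that cm(1), of "c - int m - 1"] cm(2) by fastforce
  have "c - int m \<le> a - int m" "c - int m \<le> a - int m + d"
    using down mI ov(2,4) by blast+
  ultimately show False
    using assms(3) by simp
qed

lemma brick_word_based_iff:
  assumes "aperiodic_seq s" "p \<in> G"
  shows "brick_word (delta_mia L) (based delta_pm s \<beta> p) \<longleftrightarrow>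
    \<not> (\<exists>I d. d \<noteq> 0 \<and> overlap s G \<beta> s G \<beta> I d) \<and>
    \<not> (\<exists>I d. overlap s G \<beta> (inv_seq s) (uminus ` G) (inv_base \<beta>) I d)"
proof -
  interpret R: line_reader L s G \<beta> "delta_mia L" delta_pm
    by (rule line_reader.intro[OF string_line_axioms reader_delta_mia[OF string_algebra_axioms]])
  interpret R': line_reader L "inv_seq s" "uminus ` G" "inv_base \<beta>" "delta_mia L" delta_pm
    by (rule R.inverse_reader)
  let ?w = "based delta_pm s \<beta> p" and ?u = "based delta_pm (inv_seq s) (inv_base \<beta>) (- p)"
  have p': "- p \<in> uminus ` G"
    using assms(2) by simp
  note line = string_line_axioms and line' = inverse_line
  have word: "?w \<in> words (delta_mia L)"
    by (rule R.based_in_words[OF assms(2)])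
  have aper: "aperiodic (glue (fst ?w) (snd (snd ?w)))"
    using aperiodic_based[OF assms] by (simp add: based_def)
  have u: "mword_inv (delta_mia L) ?w = ?u"
    by (rule R.mword_inv_based[OF assms(2)])
  show ?thesis
  proof
    assume brick: "brick_word (delta_mia L) ?w"
    have False if d: "d \<noteq> 0" and ov: "overlap s G \<beta> s G \<beta> I d" for I d
    proof -
      obtain a where a: "a \<in> I"
        using overlapD(1)[OF ov] by blast
      note sub = overlap_subword[OF line line ov a assms(2,2)]
      have "\<not> sim (delta_mia L) (based delta_pm (restrict_seq s I) \<beta> a) ?w"
        using overlap_not_sim[OF assms(1) ov d a] unfolding R.sim_based_iff[OF assms(2)] by blast
      then show False
        using brick sub unfolding brick_word_iff by blast
    qed
    moreover have False if ov: "overlap s G \<beta> (inv_seq s) (uminus ` G) (inv_base \<beta>) I d" for I d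
    proof -
      obtain a where a: "a \<in> I"
        using overlapD(1)[OF ov] by blast
      let ?w' = "based delta_pm (restrict_seq s I) \<beta> a"
      note sub = overlap_subword[OF line line' ov a assms(2) p']
      have "\<not> (sim (delta_mia L) ?w' ?w \<and> sim (delta_mia L) ?w' ?u)"
      proof
        assume "sim (delta_mia L) ?w' ?w \<and> sim (delta_mia L) ?w' ?u"
        then obtain c c' where "c \<in> G" "c' \<in> uminus ` G" "?w' = based delta_pm s \<beta> c"
            "?w' = based delta_pm (inv_seq s) (inv_base \<beta>) c'"
          unfolding R.sim_based_iff[OF assms(2)] R'.sim_based_iff[OF p'] by blast
        then show False
          using based_ne_inverse by metis
      qed
      then show False
        using brick sub unfolding brick_word_iff u by blast
    qed
    ultimately show "\<not> (\<exists>I d. d \<noteq> 0 \<and> overlap s G \<beta> s G \<beta> I d) \<and>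
        \<not> (\<exists>I d. overlap s G \<beta> (inv_seq s) (uminus ` G) (inv_base \<beta>) I d)"
      by blast
  next
    assume no: "\<not> (\<exists>I d. d \<noteq> 0 \<and> overlap s G \<beta> s G \<beta> I d) \<and>
        \<not> (\<exists>I d. overlap s G \<beta> (inv_seq s) (uminus ` G) (inv_base \<beta>) I d)"
    have "sim (delta_mia L) w' ?w" if sub: "factor_subword (delta_mia L) w' ?w" "image_subword (delta_mia L) w' ?w" for w'
    proof -
      obtain I d where I: "overlap s G \<beta> s G \<beta> I d" "I = G \<Longrightarrow> sim (delta_mia L) w' ?w"
        using subword_overlap[OF line line assms(2,2) sub] by blast
      then have "overlap s G \<beta> s G \<beta> I 0"
        using no by (cases "d = 0") auto
      then show ?thesis
        using I(2) overlap_zero by blast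
    qed
    moreover have "\<not> (factor_subword (delta_mia L) w' ?w \<and> image_subword (delta_mia L) w' ?u)" for w'
    proof
      assume *: "factor_subword (delta_mia L) w' ?w \<and> image_subword (delta_mia L) w' ?u"
      show False
        by (rule subword_overlap[OF line line' assms(2) p' *[THEN conjunct1] *[THEN conjunct2]]) (use no in blast)
    qed
    ultimately show "brick_word (delta_mia L) ?w"
      unfolding brick_word_iff u using word aper by blast
  qed
qed

end

section \<open>Overlaps and arrows\<close>

text \<open>
The arrow \<open>a\<close> sends the basis vector at the gap \<open>p\<close> to the one at \<open>q\<close>.
\<close>

definition arr :: "(int \<Rightarrow> 'e letter option) \<Rightarrow> 'e \<Rightarrow> int \<Rightarrow> int \<Rightarrow> bool" where
  "arr s a p q \<longleftrightarrow> (s p = Some (Dir a) \<and> q = p + 1) \<or> (s (p - 1) = Some (Inv a) \<and> q = p - 1)"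

fun vertex_of :: "('v, 'e) qstring \<Rightarrow> 'v" where
  "vertex_of (Triv v i) = v"

lemma arr_inv_seq: "arr (inv_seq s) a p q \<longleftrightarrow> arr s a (- p) (- q)"
proof -
  have "linv b = Dir a \<longleftrightarrow> b = Inv a" "linv b = Inv a \<longleftrightarrow> b = Dir a" for b :: "'a letter"
    by (cases b; auto)+
  note inv = this
  have "inv_seq s p = Some (Dir a) \<longleftrightarrow> s (- p - 1) = Some (Inv a)" for p
    by (auto simp: inv_seq_def inv)
  moreover have "inv_seq s (p - 1) = Some (Inv a) \<longleftrightarrow> s (- p) = Some (Dir a)" for p
    by (auto simp: inv_seq_def inv)
  ultimately show ?thesis
    unfolding arr_def by auto
qed

context string_line
begin

lemma arr_right_unique: "arr s a p q \<Longrightarrow> arr s a p q' \<Longrightarrow> q = q'"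
  using not_inverse[of "p - 1" "Inv a" "Dir a"] by (auto simp: arr_def)

lemma arr_left_unique: "arr s a p q \<Longrightarrow> arr s a p' q \<Longrightarrow> p = p'"
  using not_inverse[of "q - 1" "Dir a" "Inv a"] by (auto simp: arr_def)

lemma arr_base:
  assumes "arr s a p q"
  shows "p \<in> G" "q \<in> G" "a \<in> arcs (quiver L)"
    "vertex_of (\<beta> p) = tail (quiver L) a" "vertex_of (\<beta> q) = head (quiver L) a"
proof -
  from assms consider "s p = Some (Dir a)" "q = p + 1" | "s (p - 1) = Some (Inv a)" "q = p - 1"
    unfolding arr_def by blast
  then have "p \<in> G \<and> q \<in> G \<and> a \<in> arcs (quiver L) \<and>
    vertex_of (\<beta> p) = tail (quiver L) a \<and> vertex_of (\<beta> q) = head (quiver L) a"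
  proof cases
    case 1
    then show ?thesis
      using defined_gaps[OF 1(1)] base_before[OF 1(1)] base_after[OF 1(1)] syllable[OF 1(1)]
      by (auto simp: syllables_def signed_def)
  next
    case 2
    then show ?thesis
      using defined_gaps[OF 2(1)] base_before[OF 2(1)] base_after[OF 2(1)] syllable[OF 2(1)]
      by (auto simp: syllables_def signed_def)
  qed
  then show "p \<in> G" "q \<in> G" "a \<in> arcs (quiver L)"
    "vertex_of (\<beta> p) = tail (quiver L) a" "vertex_of (\<beta> q) = head (quiver L) a"
    by auto
qed

lemma vertex_base: "p \<in> G \<Longrightarrow> vertex_of (\<beta> p) \<in> verts (quiver L)"
  using base_trivial[of p] by (auto simp: trivial_strings_def)

lemma base_eq_or_bar:
  assumes "p \<in> G" "q \<in> G" "vertex_of (\<beta> p) = vertex_of (\<beta> q)"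
  shows "\<beta> p = \<beta> q \<or> \<beta> p = aut_bar (\<beta> q)"
  using base_trivial[OF assms(1)] base_trivial[OF assms(2)] assms(3) by (auto simp: trivial_strings_def)

end

text \<open>
The algebraic meaning of an overlap: \<open>I\<close> is closed under predecessors (it is a factor), its shift is
closed under successors (it is a submodule), and the arrows inside correspond to each other.
\<close>

lemma overlap_arr:
  assumes ov: "overlap s G \<beta> s' G' \<beta>' I d"
  shows "p \<in> I \<Longrightarrow> arr s a p' p \<Longrightarrow> p' \<in> I"
    "p \<in> I \<Longrightarrow> arr s' a (p + d) q \<Longrightarrow> \<exists>p' \<in> I. q = p' + d \<and> arr s a p p'"
    "p \<in> I \<Longrightarrow> p' \<in> I \<Longrightarrow> arr s a p p' \<Longrightarrow> arr s' a (p + d) (p' + d)"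
proof -
  note ov = overlapD(6-10)[OF ov]
  show "p' \<in> I" if "p \<in> I" "arr s a p' p"
    using that ov(2)[of p] ov(4)[of p'] by (force simp: arr_def)
  show "arr s' a (p + d) (p' + d)" if "p \<in> I" "p' \<in> I" "arr s a p p'"
    using that ov(1)[of p] ov(1)[of "p - 1"] by (auto simp: arr_def algebra_simps)
  show "\<exists>p' \<in> I. q = p' + d \<and> arr s a p p'" if p: "p \<in> I" and a: "arr s' a (p + d) q"
  proof -
    from a consider "s' (p + d) = Some (Dir a)" "q = p + d + 1"
      | "s' (p - 1 + d) = Some (Inv a)" "q = p - 1 + d"
      by (auto simp: arr_def algebra_simps)
    then show ?thesis
    proof cases
      case 1
      then have "p + 1 \<in> I"
        using ov(3)[of p] p by auto
      then show ?thesis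
        using ov(1)[of p] p 1 by (intro bexI[of _ "p + 1"]) (auto simp: arr_def)
    next
      case 2
      then have "p - 1 \<in> I"
        using ov(5)[of "p - 1"] p by auto
      then show ?thesis
        using ov(1)[of "p - 1"] p 2 by (intro bexI[of _ "p - 1"]) (auto simp: arr_def)
    qed
  qed
qed

text \<open>
Here \<open>C q p\<close> stands for the coefficient at the gap \<open>q\<close> of the second line of the image of the basis
vector at the gap \<open>p\<close> of the first line. The three rules for \<open>C\<close> are what it means to commute with the
arrows. Starting from a nonzero coefficient, one extends the gaps \<open>a\<close> and \<open>a + d\<close> to the largest interval
on which the two lines agree. The coefficient is carried along the interval by the first rule, so it is
nonzero at both ends, and there a letter of the wrong direction would contradict one of the other
rules.
\<close>

lemma overlap_of_coefficients:
  fixes C :: "int \<Rightarrow> int \<Rightarrow> 'k::zero"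
  assumes S: "string_line L s G \<beta>" and S': "string_line L s' G' \<beta>'"
    and move: "\<And>e p p' q q'. arr s e p p' \<Longrightarrow> arr s' e q q' \<Longrightarrow> C q' p' = C q p"
    and source: "\<And>e p p' q'. arr s e p p' \<Longrightarrow> q' \<in> G' \<Longrightarrow> (\<And>q. \<not> arr s' e q q') \<Longrightarrow> C q' p' = 0"
    and target: "\<And>e p q q'. arr s' e q q' \<Longrightarrow> p \<in> G \<Longrightarrow> vertex_of (\<beta> p) = vertex_of (\<beta>' q) \<Longrightarrow>
      (\<And>p'. \<not> arr s e p p') \<Longrightarrow> C q p = 0"
    and a: "a \<in> G" "a + d \<in> G'" "\<beta> a = \<beta>' (a + d)" "C (a + d) a \<noteq> 0"
  shows "\<exists>I. overlap s G \<beta> s' G' \<beta>' I d"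
proof -
  interpret S: string_line L s G \<beta> by fact
  interpret S': string_line L s' G' \<beta>' by fact
  define I where "I = {k. k \<in> G \<and> k + d \<in> G' \<and> (\<forall>j. a \<le> j \<and> j < k \<longrightarrow> s j = s' (j + d)) \<and>
    (\<forall>j. k \<le> j \<and> j < a \<longrightarrow> s j = s' (j + d))}"
  have aI: "a \<in> I"
    using a by (auto simp: I_def)
  have conv: "r \<in> I" if pq: "p \<in> I" "q \<in> I" "p \<le> r" "r \<le> q" for p q r
  proof -
    have "r \<in> G"
      using S.convex[of p q r] pq by (simp add: I_def)
    moreover have "r + d \<in> G'"
      using S'.convex[of "p + d" "q + d" "r + d"] pq by (simp add: I_def)
    ultimately show ?thesis
      using pq by (simp add: I_def)
  qed
  have step: "s k = s' (k + d)" if "k \<in> I" "k + 1 \<in> I" for k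
    using that by (cases "a \<le> k") (auto simp: I_def)
  have carry: "(\<beta> k = \<beta>' (k + d) \<and> \<beta> (k + 1) = \<beta>' (k + 1 + d)) \<and> C (k + 1 + d) (k + 1) = C (k + d) k"
    if k: "k \<in> I" "k + 1 \<in> I" for k
  proof -
    obtain b where b: "s k = Some b"
      using k S.gap_defined[of k] by (auto simp: I_def)
    then have b': "s' (k + d) = Some b"
      using step[OF k] by simp
    have "C (k + 1 + d) (k + 1) = C (k + d) k"
    proof (cases b)
      case (Dir e)
      then show ?thesis
        using b b' by (intro move[of e]) (auto simp: arr_def)
    next
      case (Inv e)
      then show ?thesis
        using b b' by (intro move[of e, symmetric]) (auto simp: arr_def algebra_simps)
    qed
    then show ?thesis
      using S.base_before[OF b] S.base_after[OF b] S'.base_before[OF b'] S'.base_after[OF b']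
      by (simp add: algebra_simps)
  qed
  have right: "a + int n \<in> I \<longrightarrow> \<beta> (a + int n) = \<beta>' (a + int n + d) \<and> C (a + int n + d) (a + int n) \<noteq> 0" for n
  proof (induction n)
    case (Suc n)
    show ?case
    proof
      assume I: "a + int (Suc n) \<in> I"
      have e: "a + int (Suc n) = a + int n + 1"
        by simp
      have "a + int n \<in> I"
        using conv[OF aI I] by simp
      then show "\<beta> (a + int (Suc n)) = \<beta>' (a + int (Suc n) + d) \<and> C (a + int (Suc n) + d) (a + int (Suc n)) \<noteq> 0"
        using Suc carry[of "a + int n"] I unfolding e by metis
    qed
  qed (simp add: a)
  have left: "a - int n \<in> I \<longrightarrow> \<beta> (a - int n) = \<beta>' (a - int n + d) \<and> C (a - int n + d) (a - int n) \<noteq> 0" for n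
  proof (induction n)
    case (Suc n)
    show ?case
    proof
      assume I: "a - int (Suc n) \<in> I"
      have e: "a - int n = a - int (Suc n) + 1"
        by simp
      have "a - int n \<in> I"
        using conv[OF I aI] by simp
      then show "\<beta> (a - int (Suc n)) = \<beta>' (a - int (Suc n) + d) \<and> C (a - int (Suc n) + d) (a - int (Suc n)) \<noteq> 0"
        using Suc carry[of "a - int (Suc n)"] I unfolding e by metis
    qed
  qed (simp add: a)
  have C: "\<beta> k = \<beta>' (k + d) \<and> C (k + d) k \<noteq> 0" if "k \<in> I" for k
    using right[of "nat (k - a)"] left[of "nat (a - k)"] that by (cases "a \<le> k") auto
  have IG: "k \<in> G" "k + d \<in> G'" if "k \<in> I" for k
    using that by (auto simp: I_def)
  \<comment> \<open>the interval cannot be enlarged\<close>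
  have neq: "s k \<noteq> Some b \<or> s' (k + d) \<noteq> Some b" if "k \<in> I \<and> k + 1 \<notin> I \<or> k + 1 \<in> I \<and> k \<notin> I" for k b
  proof (rule ccontr)
    assume "\<not> ?thesis"
    then have b: "s k = Some b" "s' (k + d) = Some b"
      by auto
    have g: "k \<in> G" "k + 1 \<in> G" "k + d \<in> G'" "k + 1 + d \<in> G'"
      using S.defined_gaps[OF b(1)] S'.defined_gaps[OF b(2)] by (auto simp: algebra_simps)
    have "k + 1 \<in> I" if I: "k \<in> I"
      unfolding I_def mem_Collect_eq
    proof (intro conjI allI impI)
      show "s j = s' (j + d)" if "a \<le> j \<and> j < k + 1" for j
        using that I b by (cases "j = k") (auto simp: I_def)
      show "s j = s' (j + d)" if "k + 1 \<le> j \<and> j < a" for j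
        using that I b by (cases "j = k") (auto simp: I_def)
    qed (fact g)+
    moreover
    have "k \<in> I" if I: "k + 1 \<in> I"
      unfolding I_def mem_Collect_eq
    proof (intro conjI allI impI)
      show "s j = s' (j + d)" if "a \<le> j \<and> j < k" for j
        using that I b by (cases "j = k") (auto simp: I_def)
      show "s j = s' (j + d)" if "k \<le> j \<and> j < a" for j
        using that I b by (cases "j = k") (auto simp: I_def)
    qed (fact g)+
    ultimately show False
      using that by blast
  qed
  \<comment> \<open>The outgoing letters at the two sides of a gap have opposite signs. Hence, at gaps with equal base
    points, a letter to the right of one is never the inverse of a letter to the left of the other.\<close>
  have sign: "\<not> (\<beta> p = Triv v i \<and> \<beta>' q = Triv v' (- i) \<and> p \<in> G \<and> \<beta> p = \<beta>' q)" for p q v v' i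
    using S.base_sign[of p] by auto
  have R1: "s k \<noteq> Some (Inv e)" if k: "k \<in> I" "k + 1 \<notin> I" for k e
  proof
    assume b: "s k = Some (Inv e)"
    have "\<not> arr s' e q (k + d)" for q
    proof
      assume "arr s' e q (k + d)"
      then consider "s' (k + d - 1) = Some (Dir e)" | "s' (k + d) = Some (Inv e)"
        by (auto simp: arr_def)
      then show False
      proof cases
        case 1
        then show False
          using sign[of k _ "- end_sign L e" "k + d"] S.base_before[OF b] S'.base_after[OF 1] C[OF k(1)] IG[OF k(1)] by auto
      qed (use neq k b in blast)
    qed
    then show False
      using source[of e "k + 1" k "k + d"] b C[OF k(1)] IG[OF k(1)] by (auto simp: arr_def)
  qed
  have R2: "s' (k + d) \<noteq> Some (Dir e)" if k: "k \<in> I" "k + 1 \<notin> I" for k e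
  proof
    assume b: "s' (k + d) = Some (Dir e)"
    have "\<not> arr s e k q" for q
    proof
      assume "arr s e k q"
      then consider "s (k - 1) = Some (Inv e)" | "s k = Some (Dir e)"
        by (auto simp: arr_def)
      then show False
      proof cases
        case 1
        then show False
          using sign[of k _ "start_sign L e" "k + d"] S.base_after[OF 1] S'.base_before[OF b] C[OF k(1)] IG[OF k(1)] by auto
      qed (use neq k b in blast)
    qed
    then show False
      using target[of e "k + d" "k + d + 1" k] b C[OF k(1)] IG[OF k(1)] by (auto simp: arr_def)
  qed
  have L1: "s k \<noteq> Some (Dir e)" if k: "k + 1 \<in> I" "k \<notin> I" for k e
  proof
    assume b: "s k = Some (Dir e)"
    have "\<not> arr s' e q (k + 1 + d)" for q
    proof
      assume "arr s' e q (k + 1 + d)"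
      then consider "s' (k + 1 + d) = Some (Inv e)" | "s' (k + d) = Some (Dir e)"
        by (auto simp: arr_def algebra_simps)
      then show False
      proof cases
        case 1
        then show False
          using sign[of "k + 1" _ "end_sign L e" "k + 1 + d"] S.base_after[OF b] S'.base_before[OF 1] C[OF k(1)] IG[OF k(1)] by auto
      qed (use neq k b in blast)
    qed
    then show False
      using source[of e k "k + 1" "k + 1 + d"] b C[OF k(1)] IG[OF k(1)] by (auto simp: arr_def)
  qed
  have L2: "s' (k + d) \<noteq> Some (Inv e)" if k: "k + 1 \<in> I" "k \<notin> I" for k e
  proof
    assume b: "s' (k + d) = Some (Inv e)"
    have "\<not> arr s e (k + 1) q" for q
    proof
      assume "arr s e (k + 1) q"
      then consider "s (k + 1) = Some (Dir e)" | "s k = Some (Inv e)"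
        by (auto simp: arr_def)
      then show False
      proof cases
        case 1
        have "\<beta>' (k + 1 + d) = Triv (tail (quiver L) e) (start_sign L e)"
          using S'.base_after[OF b] by (simp add: algebra_simps)
        then show False
          using sign[of "k + 1" _ "- start_sign L e" "k + 1 + d"] S.base_before[OF 1] C[OF k(1)] IG[OF k(1)] by auto
      qed (use neq k b in blast)
    qed
    then show False
      using target[of e "k + 1 + d" "k + d" "k + 1"] b C[OF k(1)] IG[OF k(1)] by (auto simp: arr_def algebra_simps)
  qed
  have letter: "(z = None \<or> (\<exists>e. z = Some (Dir e))) \<longleftrightarrow> (\<forall>e. z \<noteq> Some (Inv e))"
    "(z = None \<or> (\<exists>e. z = Some (Inv e))) \<longleftrightarrow> (\<forall>e. z \<noteq> Some (Dir e))" for z :: "'b letter option"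
    by (cases z; metis letter.exhaust letter.distinct(1) option.inject option.distinct(1))+
  have "overlap s G \<beta> s' G' \<beta>' I d"
    unfolding overlap_def letter
  proof (intro conjI allI ballI impI)
    show "I \<noteq> {}" "I \<subseteq> G"
      using aI IG by auto
  qed (use conv IG C step R1 R2 L1 L2 in blast)+
  then show ?thesis ..
qed

section \<open>The string module\<close>

lemma lookup_pscale: "Poly_Mapping.lookup (pscale c f) q = c * Poly_Mapping.lookup f q"
  by (auto simp: pscale_def Poly_Mapping.map.rep_eq when_def)

lemma lookup_single': "Poly_Mapping.lookup (Poly_Mapping.single p c) q = (if p = q then c else 0)"
  by (simp add: lookup_single when_def)

lemma pscale_single: "pscale c (Poly_Mapping.single p b) = Poly_Mapping.single p (c * b)"
  by (rule poly_mapping_eqI) (simp add: lookup_pscale lookup_single')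

lemma vector_space_pscale: "vector_space (pscale :: 'k::field \<Rightarrow> _)"
  by unfold_locales
    (auto intro!: poly_mapping_eqI simp: lookup_pscale lookup_add distrib_left distrib_right)

text \<open>
The generic names \<open>s\<close>, \<open>G\<close>, \<open>\<beta>\<close> now stand for the line of the string \<open>x\<close>.
\<close>

locale algebra_string = string_line L "syllable_at x" "gaps x" "base_at L x"
  for L :: "('v, 'e) string_data" and x :: "('v, 'e) qstring" +
  assumes string: "x \<in> strings L"
begin

lemma gaps_over: "gaps_over L x v = {p \<in> gaps x. vertex_of (base_at L x p) = v}"
proof (cases x)
  case (Seq w)
  show ?thesis
  proof (intro equalityI subsetI)
    fix p assume "p \<in> gaps_over L x v"
    then consider b where "syllable_at x p = Some b" "src L b = v"
      | b where "syllable_at x (p - 1) = Some b" "tgt L b = v"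
      by (auto simp: Seq)
    then show "p \<in> {p \<in> gaps x. vertex_of (base_at L x p) = v}"
    proof cases
      case 1
      then show ?thesis
        using defined_gaps[OF 1(1)] base_before[OF 1(1)] by simp
    next
      case 2
      then show ?thesis
        using defined_gaps[OF 2(1)] base_after[OF 2(1)] by simp
    qed
  next
    fix p assume p: "p \<in> {p \<in> gaps x. vertex_of (base_at L x p) = v}"
    then consider b where "syllable_at x p = Some b" | b where "syllable_at x (p - 1) = Some b"
      using gap_neighbour[of w L p] string by (auto simp: Seq)
    then show "p \<in> gaps_over L x v"
    proof cases
      case 1
      then show ?thesis
        using base_before[OF 1] p by (auto simp: Seq)
    next
      case 2
      then show ?thesis
        using base_after[OF 2] p by (auto simp: Seq)
    qed
  qed
qed auto

lemma space_iff:
  "z \<in> space (string_module L x :: ('k::field, 'v, 'e, int \<Rightarrow>\<^sub>0 'k) quiver_rep) v \<longleftrightarrow>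
    (\<forall>p. Poly_Mapping.lookup z p \<noteq> 0 \<longrightarrow> p \<in> gaps x \<and> vertex_of (base_at L x p) = v)"
  by (auto simp: string_module_def gaps_over subset_iff in_keys_iff)

lemma scl_eq: "scl (string_module L x) = pscale"
  by (simp add: string_module_def)

lemma lookup_basis_act:
  "Poly_Mapping.lookup (basis_act x a p :: int \<Rightarrow>\<^sub>0 'k::field) q = (if arr (syllable_at x) a p q then 1 else 0)"
  using not_inverse[of "p - 1" "Inv a" "Dir a"]
  by (auto simp: basis_act_def arr_def lookup_single')

text \<open>
Every gap has at most one predecessor under a given arrow, so the sum that defines the action has
at most one term in each coordinate.
\<close>

lemma lookup_act:
  fixes z :: "int \<Rightarrow>\<^sub>0 'k::field"
  shows "arr (syllable_at x) a p q \<Longrightarrow> Poly_Mapping.lookup (act (string_module L x) a z) q = Poly_Mapping.lookup z p"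
    and "(\<And>p. \<not> arr (syllable_at x) a p q) \<Longrightarrow> Poly_Mapping.lookup (act (string_module L x) a z) q = 0"
proof -
  have act: "Poly_Mapping.lookup (act (string_module L x) a z) q =
      (\<Sum>p \<in> Poly_Mapping.keys z. if arr (syllable_at x) a p q then Poly_Mapping.lookup z p else 0)"
    by (simp add: string_module_def lookup_sum lookup_pscale lookup_basis_act if_distrib cong: if_cong)
  show "Poly_Mapping.lookup (act (string_module L x) a z) q = Poly_Mapping.lookup z p"
    if a: "arr (syllable_at x) a p q"
  proof -
    have "arr (syllable_at x) a p' q \<longleftrightarrow> p' = p" for p'
      using a arr_left_unique by blast
    then show ?thesis
      by (simp add: act in_keys_iff)
  qed
  show "Poly_Mapping.lookup (act (string_module L x) a z) q = 0" if "\<And>p. \<not> arr (syllable_at x) a p q"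
    using that by (simp add: act)
qed

lemma act_eqI:
  assumes "\<And>p q. arr (syllable_at x) a p q \<Longrightarrow> Poly_Mapping.lookup y q = Poly_Mapping.lookup z p"
    and "\<And>q. (\<And>p. \<not> arr (syllable_at x) a p q) \<Longrightarrow> Poly_Mapping.lookup y q = 0"
  shows "act (string_module L x) a z = (y :: int \<Rightarrow>\<^sub>0 'k::field)"
proof (rule poly_mapping_eqI)
  fix q
  show "Poly_Mapping.lookup (act (string_module L x) a z) q = Poly_Mapping.lookup y q"
  proof (cases "\<exists>p. arr (syllable_at x) a p q")
    case True
    then obtain p where "arr (syllable_at x) a p q" ..
    then show ?thesis
      using assms(1) lookup_act(1) by simp
  next
    case False
    then have "\<not> arr (syllable_at x) a p q" for p
      by blast
    from assms(2)[OF this] lookup_act(2)[OF this] show ?thesis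
      by simp
  qed
qed

lemma act_linear:
  fixes y z :: "int \<Rightarrow>\<^sub>0 'k::field"
  shows "act (string_module L x) a (y + z) = act (string_module L x) a y + act (string_module L x) a z"
    "act (string_module L x) a (pscale c z) = pscale c (act (string_module L x) a z)"
    "act (string_module L x) a (0 :: int \<Rightarrow>\<^sub>0 'k) = 0"
  by (rule act_eqI; simp add: lookup_add lookup_pscale lookup_act)+

lemma act_single:
  "arr (syllable_at x) a p q \<Longrightarrow>
    act (string_module L x) a (Poly_Mapping.single p (1::'k::field)) = Poly_Mapping.single q 1"
  "(\<And>q. \<not> arr (syllable_at x) a p q) \<Longrightarrow>
    act (string_module L x) a (Poly_Mapping.single p (1::'k)) = 0"
proof -
  show "act (string_module L x) a (Poly_Mapping.single p (1::'k)) = Poly_Mapping.single q 1"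
    if a: "arr (syllable_at x) a p q"
    by (rule act_eqI) (use a arr_left_unique arr_right_unique in \<open>auto simp: lookup_single'\<close>)
  show "act (string_module L x) a (Poly_Mapping.single p (1::'k)) = 0"
    if a: "\<And>q. \<not> arr (syllable_at x) a p q"
    by (rule act_eqI) (use a in \<open>auto simp: lookup_single'\<close>)
qed

lemma act_space: "act (string_module L x) a z \<in> space (string_module L x :: ('k::field, 'v, 'e, int \<Rightarrow>\<^sub>0 'k) quiver_rep) (head (quiver L) a)"
  unfolding space_iff
proof (intro allI impI)
  fix q assume "Poly_Mapping.lookup (act (string_module L x) a z) q \<noteq> 0"
  then obtain p where "arr (syllable_at x) a p q"
    using lookup_act(2) by metis
  then show "q \<in> gaps x \<and> vertex_of (base_at L x q) = head (quiver L) a"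
    using arr_base by metis
qed

text \<open>
A path that does not annihilate the module runs along the string, and it cannot turn around, since a
direct syllable is not followed by its own inverse.
\<close>

lemma fold_act_nonzero:
  fixes z :: "int \<Rightarrow>\<^sub>0 'k::field"
  assumes "as \<noteq> []" "Poly_Mapping.lookup (fold (act (string_module L x)) as z) q \<noteq> 0"
  shows "\<exists>p. (\<forall>k < length as. syllable_at x (p + int k) = Some (Dir (as ! k))) \<and> q = p + int (length as) \<or>
    (\<forall>k < length as. syllable_at x (p - 1 - int k) = Some (Inv (as ! k))) \<and> q = p - int (length as)"
  using assms
proof (induction as arbitrary: q rule: rev_induct)
  case (snoc a as)
  let ?y = "fold (act (string_module L x)) as z"
  have "Poly_Mapping.lookup (act (string_module L x) a ?y) q \<noteq> 0"
    using snoc.prems(2) by simp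
  then obtain q' where a: "arr (syllable_at x) a q' q" and q': "Poly_Mapping.lookup ?y q' \<noteq> 0"
    using lookup_act by metis
  show ?case
  proof (cases "as = []")
    case True
    then show ?thesis
      using a by (auto simp: arr_def intro: exI[of _ q'])
  next
    case False
    from snoc.IH[OF False q'] obtain p where
      "(\<forall>k < length as. syllable_at x (p + int k) = Some (Dir (as ! k))) \<and> q' = p + int (length as) \<or>
       (\<forall>k < length as. syllable_at x (p - 1 - int k) = Some (Inv (as ! k))) \<and> q' = p - int (length as)"
      by blast
    then show ?thesis
    proof (elim disjE conjE)
      assume *: "\<forall>k < length as. syllable_at x (p + int k) = Some (Dir (as ! k))" "q' = p + int (length as)"
      have "p + int (length as - 1) = q' - 1"
        using False *(2) by (cases as) auto
      then have "syllable_at x (q' - 1) = Some (Dir (as ! (length as - 1)))"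
        using *(1) False by (metis diff_less length_greater_0_conv zero_less_one)
      then have "syllable_at x q' = Some (Dir a) \<and> q = q' + 1"
        using a by (auto simp: arr_def)
      then show ?thesis
        using * by (intro exI[of _ p] disjI1) (auto simp: nth_append less_Suc_eq)
    next
      assume *: "\<forall>k < length as. syllable_at x (p - 1 - int k) = Some (Inv (as ! k))" "q' = p - int (length as)"
      have "p - 1 - int (length as - 1) = q'"
        using False *(2) by (cases as) auto
      then have "syllable_at x q' = Some (Inv (as ! (length as - 1)))"
        using *(1) False by (metis diff_less length_greater_0_conv zero_less_one)
      then have "syllable_at x (q' - 1) = Some (Inv a) \<and> q = q' - 1"
        using a by (auto simp: arr_def)
      moreover have e: "q' - 1 = p - 1 - int (length as)"
        using *(2) by simp
      ultimately have "syllable_at x (p - 1 - int (length as)) = Some (Inv a)" "q = p - int (length (as @ [a]))"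
        unfolding e by auto
      then show ?thesis
        using *(1) by (intro exI[of _ p] disjI2) (auto simp: nth_append less_Suc_eq)
    qed
  qed
qed simp

lemma fold_act_rels:
  fixes z :: "int \<Rightarrow>\<^sub>0 'k::field"
  assumes r: "r \<in> rels L"
  shows "fold (act (string_module L x)) r z = 0"
proof (rule poly_mapping_eqI, rule ccontr)
  fix q
  assume "Poly_Mapping.lookup (fold (act (string_module L x)) r z) q \<noteq> Poly_Mapping.lookup 0 q"
  moreover have ne: "r \<noteq> []"
    using rels_paths[OF r] by auto
  ultimately obtain p where
    "(\<forall>k < length r. syllable_at x (p + int k) = Some (Dir (r ! k))) \<and> q = p + int (length r) \<or>
     (\<forall>k < length r. syllable_at x (p - 1 - int k) = Some (Inv (r ! k))) \<and> q = p - int (length r)"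
    using fold_act_nonzero[of r z q] by auto
  then show False
  proof (elim disjE conjE)
    assume *: "\<forall>k < length r. syllable_at x (p + int k) = Some (Dir (r ! k))"
    have "finite_string L (map Dir r)"
      using ne * by (intro segment_string[of _ p]) auto
    then show False
      using r unfolding finite_string_def by blast
  next
    assume *: "\<forall>k < length r. syllable_at x (p - 1 - int k) = Some (Inv (r ! k))"
    have "finite_string L (rev (map Inv r))"
    proof (rule segment_string[of _ "p - int (length r)"])
      fix k assume k: "k < length (rev (map Inv r))"
      then have e: "p - 1 - int (length r - 1 - k) = p - int (length r) + int k"
        by auto
      have "syllable_at x (p - 1 - int (length r - 1 - k)) = Some (Inv (r ! (length r - 1 - k)))"
        using k by (intro *[rule_format]) auto
      then show "syllable_at x (p - int (length r) + int k) = Some (rev (map Inv r) ! k)"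
        unfolding e using k by (simp add: rev_nth)
    qed (simp add: ne)
    from finite_string_inverse[OF this] have "finite_string L (map Dir r)"
      by (simp add: rev_map o_def)
    then show False
      using r unfolding finite_string_def by blast
  qed
qed

lemma space_add:
  assumes "y \<in> space (string_module L x) v" "z \<in> space (string_module L x) v"
  shows "y + z \<in> space (string_module L x :: ('k::field, 'v, 'e, int \<Rightarrow>\<^sub>0 'k) quiver_rep) v"
  using assms unfolding space_iff lookup_add by (metis add.right_neutral)

lemma representation_string_module: "representation L (string_module L x :: ('k::field, 'v, 'e, int \<Rightarrow>\<^sub>0 'k) quiver_rep)"
proof -
  have "Modules.module (pscale :: 'k \<Rightarrow> _)"
    using vector_space_pscale module_iff_vector_space by blast
  note sub = Modules.module.subspace_def[OF this]
  show ?thesis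
    unfolding representation_def scl_eq linear_between_def sub
    by (auto simp: vector_space_pscale act_linear fold_act_rels act_space space_add)
      (auto simp: space_iff lookup_pscale)
qed

section \<open>Endomorphisms and overlaps\<close>

definition scalar :: "'k::field \<Rightarrow> 'v \<Rightarrow> (int \<Rightarrow>\<^sub>0 'k) \<Rightarrow> (int \<Rightarrow>\<^sub>0 'k)" where
  "scalar c = (\<lambda>v \<in> verts (quiver L). \<lambda>z \<in> space (string_module L x) v. pscale c z)"

lemma space_pscale:
  "z \<in> space (string_module L x) v \<Longrightarrow> pscale c z \<in> space (string_module L x :: ('k::field, 'v, 'e, int \<Rightarrow>\<^sub>0 'k) quiver_rep) v"
  by (auto simp: space_iff lookup_pscale)

lemma space_zero: "0 \<in> space (string_module L x :: ('k::field, 'v, 'e, int \<Rightarrow>\<^sub>0 'k) quiver_rep) v"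
  by (simp add: space_iff)

lemma space_single:
  "p \<in> gaps x \<Longrightarrow> vertex_of (base_at L x p) = v \<Longrightarrow>
    Poly_Mapping.single p c \<in> space (string_module L x :: ('k::field, 'v, 'e, int \<Rightarrow>\<^sub>0 'k) quiver_rep) v"
  by (auto simp: space_iff lookup_single' split: if_splits)

text \<open>
A single linear map that respects the grading by vertices induces an endomorphism.
\<close>

lemma endomorphismI:
  fixes T :: "(int \<Rightarrow>\<^sub>0 'k::field) \<Rightarrow> (int \<Rightarrow>\<^sub>0 'k)"
  assumes "\<And>v z. z \<in> space (string_module L x :: ('k, 'v, 'e, int \<Rightarrow>\<^sub>0 'k) quiver_rep) v \<Longrightarrow> T z \<in> space (string_module L x :: ('k, 'v, 'e, int \<Rightarrow>\<^sub>0 'k) quiver_rep) v"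
    and "\<And>y z. T (y + z) = T y + T z" "\<And>c z. T (pscale c z) = pscale c (T z)"
    and "\<And>a z. a \<in> arcs (quiver L) \<Longrightarrow> T (act (string_module L x) a z) = act (string_module L x) a (T z)"
  shows "(\<lambda>v \<in> verts (quiver L). \<lambda>z \<in> space (string_module L x) v. T z) \<in> endomorphisms L (string_module L x)"
  unfolding endomorphisms_def linear_between_def scl_eq
  by (auto simp: assms space_add space_pscale act_space)

lemma scalar_endomorphism: "scalar (c::'k::field) \<in> endomorphisms L (string_module L x)"
  unfolding scalar_def
  by (rule endomorphismI) (auto intro!: poly_mapping_eqI simp: space_pscale act_linear lookup_pscale lookup_add distrib_left)

lemma endomorphismD:
  fixes f :: "'v \<Rightarrow> (int \<Rightarrow>\<^sub>0 'k::field) \<Rightarrow> (int \<Rightarrow>\<^sub>0 'k)"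
  assumes "f \<in> endomorphisms L (string_module L x)" "v \<in> verts (quiver L)"
  shows "z \<in> space (string_module L x) v \<Longrightarrow> f v z \<in> space (string_module L x :: ('k, 'v, 'e, int \<Rightarrow>\<^sub>0 'k) quiver_rep) v"
    and "y \<in> space (string_module L x :: ('k, 'v, 'e, int \<Rightarrow>\<^sub>0 'k) quiver_rep) v \<Longrightarrow> z \<in> space (string_module L x :: ('k, 'v, 'e, int \<Rightarrow>\<^sub>0 'k) quiver_rep) v \<Longrightarrow> f v (y + z) = f v y + f v z"
    and "z \<in> space (string_module L x :: ('k, 'v, 'e, int \<Rightarrow>\<^sub>0 'k) quiver_rep) v \<Longrightarrow> f v (pscale c z) = pscale c (f v z)"
  using assms unfolding endomorphisms_def linear_between_def scl_eq by blast+

lemma endomorphism_commute: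
  fixes f :: "'v \<Rightarrow> (int \<Rightarrow>\<^sub>0 'k::field) \<Rightarrow> (int \<Rightarrow>\<^sub>0 'k)"
  assumes "f \<in> endomorphisms L (string_module L x)" "a \<in> arcs (quiver L)"
    "z \<in> space (string_module L x :: ('k, 'v, 'e, int \<Rightarrow>\<^sub>0 'k) quiver_rep) (tail (quiver L) a)"
  shows "f (head (quiver L) a) (act (string_module L x) a z) = act (string_module L x) a (f (tail (quiver L) a) z)"
  using assms unfolding endomorphisms_def by blast

lemma endomorphism_zero:
  fixes f :: "'v \<Rightarrow> (int \<Rightarrow>\<^sub>0 'k::field) \<Rightarrow> (int \<Rightarrow>\<^sub>0 'k)"
  assumes "f \<in> endomorphisms L (string_module L x)" "v \<in> verts (quiver L)"
  shows "f v 0 = 0"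
proof -
  have "pscale 0 z = 0" for z :: "int \<Rightarrow>\<^sub>0 'k"
    by (rule poly_mapping_eqI) (simp add: lookup_pscale)
  then show ?thesis
    using endomorphismD(3)[OF assms space_zero, of 0] by simp
qed

definition coefficient :: "('v \<Rightarrow> (int \<Rightarrow>\<^sub>0 'k::field) \<Rightarrow> (int \<Rightarrow>\<^sub>0 'k)) \<Rightarrow> int \<Rightarrow> int \<Rightarrow> 'k" where
  "coefficient f q p = Poly_Mapping.lookup (f (vertex_of (base_at L x p)) (Poly_Mapping.single p 1)) q"

text \<open>
An endomorphism is determined by its coefficients, because the basis vectors span the module and each
element involves only finitely many of them.
\<close>

lemma lookup_endomorphism:
  fixes f :: "'v \<Rightarrow> (int \<Rightarrow>\<^sub>0 'k::field) \<Rightarrow> (int \<Rightarrow>\<^sub>0 'k)"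
  assumes f: "f \<in> endomorphisms L (string_module L x)" and v: "v \<in> verts (quiver L)"
    and z: "z \<in> space (string_module L x :: ('k, 'v, 'e, int \<Rightarrow>\<^sub>0 'k) quiver_rep) v"
  shows "Poly_Mapping.lookup (f v z) q = (\<Sum>p \<in> Poly_Mapping.keys z. Poly_Mapping.lookup z p * coefficient f q p)"
proof -
  have v_p: "p \<in> gaps x" "vertex_of (base_at L x p) = v" if "p \<in> Poly_Mapping.keys z" for p
    using z that by (auto simp: space_iff in_keys_iff)
  have "(\<Sum>p\<in>A. Poly_Mapping.single p (Poly_Mapping.lookup z p)) \<in> space (string_module L x :: ('k, 'v, 'e, int \<Rightarrow>\<^sub>0 'k) quiver_rep) v \<and>
      Poly_Mapping.lookup (f v (\<Sum>p\<in>A. Poly_Mapping.single p (Poly_Mapping.lookup z p))) q =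
      (\<Sum>p\<in>A. Poly_Mapping.lookup z p * coefficient f q p)" if "A \<subseteq> Poly_Mapping.keys z" for A
    using finite_subset[OF that finite_keys] that
  proof (induction A rule: finite_induct)
    case empty
    then show ?case
      by (simp add: space_zero endomorphism_zero[OF f v])
  next
    case (insert p A)
    have p: "p \<in> gaps x" "vertex_of (base_at L x p) = v"
      using insert.prems v_p by auto
    note sp = space_single[OF p, where ?'k = 'k]
    have "Poly_Mapping.single p (Poly_Mapping.lookup z p) = pscale (Poly_Mapping.lookup z p) (Poly_Mapping.single p 1)"
      by (simp add: pscale_single)
    then have "Poly_Mapping.lookup (f v (Poly_Mapping.single p (Poly_Mapping.lookup z p))) q = Poly_Mapping.lookup z p * coefficient f q p"
      using endomorphismD(3)[OF f v sp] by (simp add: coefficient_def p lookup_pscale)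
    then show ?case
      using insert endomorphismD(2)[OF f v sp] space_add[OF sp] by (simp add: lookup_add)
  qed
  moreover have "(\<Sum>p \<in> Poly_Mapping.keys z. Poly_Mapping.single p (Poly_Mapping.lookup z p)) = z"
    by (rule poly_mapping_eqI) (simp add: lookup_sum lookup_single' in_keys_iff)
  ultimately show ?thesis
    by (metis order_refl)
qed

lemma coefficient_gaps:
  fixes f :: "'v \<Rightarrow> (int \<Rightarrow>\<^sub>0 'k::field) \<Rightarrow> (int \<Rightarrow>\<^sub>0 'k)"
  assumes "f \<in> endomorphisms L (string_module L x)" "p \<in> gaps x" "coefficient f q p \<noteq> 0"
  shows "q \<in> gaps x" "vertex_of (base_at L x q) = vertex_of (base_at L x p)"
  using endomorphismD(1)[OF assms(1) vertex_base[OF assms(2)] space_single[OF assms(2) refl, of 1]] assms(3)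
  by (auto simp: space_iff coefficient_def)

text \<open>
Each rule compares \<open>f (a z) = a (f z)\<close> for one basis vector \<open>z\<close> in one coordinate.
\<close>

lemma coefficient_arr:
  fixes f :: "'v \<Rightarrow> (int \<Rightarrow>\<^sub>0 'k::field) \<Rightarrow> (int \<Rightarrow>\<^sub>0 'k)"
  assumes f: "f \<in> endomorphisms L (string_module L x)"
  shows "arr (syllable_at x) a p p' \<Longrightarrow> arr (syllable_at x) a q q' \<Longrightarrow> coefficient f q' p' = coefficient f q p"
    and "arr (syllable_at x) a p p' \<Longrightarrow> (\<And>q. \<not> arr (syllable_at x) a q q') \<Longrightarrow> coefficient f q' p' = 0"
    and "arr (syllable_at x) a q q' \<Longrightarrow> p \<in> gaps x \<Longrightarrow> vertex_of (base_at L x p) = vertex_of (base_at L x q) \<Longrightarrow>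
      (\<And>p'. \<not> arr (syllable_at x) a p p') \<Longrightarrow> coefficient f q p = 0"
proof -
  have from_p: "coefficient f q' p' = Poly_Mapping.lookup (act (string_module L x) a (f (tail (quiver L) a) (Poly_Mapping.single p 1))) q'"
    if a: "arr (syllable_at x) a p p'" for p p' q'
    using endomorphism_commute[OF f arr_base(3)[OF a] space_single[OF arr_base(1,4)[OF a], of 1]]
    by (simp add: coefficient_def arr_base[OF a] act_single(1)[OF a])
  show "coefficient f q' p' = coefficient f q p" if "arr (syllable_at x) a p p'" "arr (syllable_at x) a q q'"
    using from_p[OF that(1)] lookup_act(1)[OF that(2)] arr_base[OF that(1)] by (simp add: coefficient_def)
  show "coefficient f q' p' = 0" if "arr (syllable_at x) a p p'" "\<And>q. \<not> arr (syllable_at x) a q q'"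
    using from_p[OF that(1)] lookup_act(2)[OF that(2)] by simp
  show "coefficient f q p = 0" if a: "arr (syllable_at x) a q q'" "p \<in> gaps x"
    "vertex_of (base_at L x p) = vertex_of (base_at L x q)" "\<And>p'. \<not> arr (syllable_at x) a p p'"
  proof -
    have t: "vertex_of (base_at L x p) = tail (quiver L) a"
      using a(3) arr_base[OF a(1)] by simp
    have head: "head (quiver L) a \<in> verts (quiver L)"
      using arr_base(2,5)[OF a(1)] vertex_base by metis
    have "f (head (quiver L) a) (act (string_module L x) a (Poly_Mapping.single p 1)) =
        act (string_module L x) a (f (tail (quiver L) a) (Poly_Mapping.single p 1))"
      by (rule endomorphism_commute[OF f arr_base(3)[OF a(1)] space_single[OF a(2) t]])
    then have "act (string_module L x) a (f (tail (quiver L) a) (Poly_Mapping.single p 1)) = 0"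
      unfolding act_single(2)[OF a(4)] endomorphism_zero[OF f head] by (rule sym)
    then show ?thesis
      using lookup_act(1)[OF a(1), of "f (tail (quiver L) a) (Poly_Mapping.single p 1)"] by (simp add: coefficient_def t)
  qed
qed

lemma scalar_inj: "scalar (c::'k::field) = scalar c' \<Longrightarrow> c = c'"
proof -
  assume eq: "scalar c = scalar c'"
  obtain p where p: "p \<in> gaps x"
    using gaps_ne by blast
  have "pscale c (Poly_Mapping.single p 1) = pscale c' (Poly_Mapping.single p (1::'k))"
    using fun_cong[OF fun_cong[OF eq, of "vertex_of (base_at L x p)"], of "Poly_Mapping.single p 1"]
      vertex_base[OF p] space_single[OF p refl, of "1::'k"] by (simp add: scalar_def)
  then show "c = c'"
    by (metis lookup_pscale lookup_single_eq mult.right_neutral)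
qed

text \<open>
The ground field is embedded into the endomorphism algebra by \<open>scalar\<close>. An isomorphism of algebras with
the ground field has to be the inverse of this embedding.
\<close>

lemma brick_iff_scalar:
  "brick L (string_module L x :: ('k::field, 'v, 'e, int \<Rightarrow>\<^sub>0 'k) quiver_rep) \<longleftrightarrow>
    endomorphisms L (string_module L x) \<subseteq> range (scalar :: 'k \<Rightarrow> _)"
proof -
  let ?V = "string_module L x :: ('k, 'v, 'e, int \<Rightarrow>\<^sub>0 'k) quiver_rep"
  let ?A = "endomorphism_algebra L ?V"
  have carrier: "carrier ?A = endomorphisms L ?V" "carrier (ground_algebra :: ('k, 'k) module) = UNIV"
    by (simp_all add: endomorphism_algebra_def ground_algebra_def)
  have ops: "scalar c \<otimes>\<^bsub>?A\<^esub> scalar c' = scalar (c * c')" "scalar c \<oplus>\<^bsub>?A\<^esub> scalar c' = scalar (c + c')"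
    "\<one>\<^bsub>?A\<^esub> = scalar 1" "smult ?A c (scalar c') = scalar (c * c')" for c c' :: 'k
    by (auto simp: endomorphism_algebra_def scalar_def scl_eq restrict_def space_pscale lookup_pscale lookup_add
        distrib_right mult.assoc fun_eq_iff intro!: poly_mapping_eqI)
  show ?thesis
  proof
    assume "brick L ?V"
    then obtain h where h: "h \<in> ring_iso ?A ground_algebra"
        "\<And>c f. f \<in> carrier ?A \<Longrightarrow> h (smult ?A c f) = smult (ground_algebra :: ('k, 'k) module) c (h f)"
      by (auto simp: brick_def algebra_isomorphic_def)
    have inj: "inj_on h (endomorphisms L ?V)"
      using h(1) carrier by (simp add: ring_iso_def bij_betw_def)
    have "h (scalar 1) = 1"
      using h(1) ops(3) by (simp add: ring_iso_def ring_hom_def ground_algebra_def)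
    then have hc: "h (scalar c) = c" for c
      using h(2)[of "scalar 1" c, unfolded carrier, OF scalar_endomorphism] ops(4)[of c 1]
      by (simp add: ground_algebra_def)
    show "endomorphisms L ?V \<subseteq> range scalar"
    proof
      fix f assume "f \<in> endomorphisms L ?V"
      then have "f = scalar (h f)"
        using inj hc scalar_endomorphism by (metis inj_onD)
      then show "f \<in> range scalar"
        by blast
    qed
  next
    assume "endomorphisms L ?V \<subseteq> range scalar"
    then have E: "endomorphisms L ?V = range scalar"
      using scalar_endomorphism by blast
    define h where "h = the_inv (scalar :: 'k \<Rightarrow> _)"
    have inj: "inj (scalar :: 'k \<Rightarrow> _)"
      using scalar_inj by (auto intro: injI)
    have hc: "h (scalar c) = c" for c
      unfolding h_def by (rule the_inv_f_f[OF inj])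
    have "bij_betw h (range scalar) UNIV"
      unfolding bij_betw_def inj_on_def using hc by (metis (mono_tags, lifting) UNIV_eq_I image_eqI rangeE rangeI)
    then have "h \<in> ring_iso ?A ground_algebra"
      by (auto simp: ring_iso_def ring_hom_def carrier E ops hc) (simp_all add: ground_algebra_def)
    moreover have "h (smult ?A c f) = smult ground_algebra c (h f)" if "f \<in> carrier ?A" for c f
      using that by (auto simp: carrier E ops hc ground_algebra_def)
    ultimately show "brick L ?V"
      using representation_string_module by (auto simp: brick_def algebra_isomorphic_def)
  qed
qed

text \<open>
If all coefficients off the diagonal vanish, the diagonal is constant, since any two neighbouring gaps are
joined by an arrow.
\<close>

lemma nonscalar_coefficient:
  fixes f :: "'v \<Rightarrow> (int \<Rightarrow>\<^sub>0 'k::field) \<Rightarrow> (int \<Rightarrow>\<^sub>0 'k)"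
  assumes f: "f \<in> endomorphisms L (string_module L x)" "f \<notin> range scalar"
  obtains p q where "p \<in> gaps x" "p \<noteq> q" "coefficient f q p \<noteq> 0"
proof (rule ccontr)
  assume "\<not> thesis"
  then have off: "coefficient f q p = 0" if "p \<in> gaps x" "p \<noteq> q" for p q
    using that \<open>\<And>p q. \<lbrakk>p \<in> gaps x; p \<noteq> q; coefficient f q p \<noteq> 0\<rbrakk> \<Longrightarrow> thesis\<close> by blast
  obtain p0 where p0: "p0 \<in> gaps x"
    using gaps_ne by blast
  have adj: "coefficient f (p + 1) (p + 1) = coefficient f p p" if pq: "p \<in> gaps x" "p + 1 \<in> gaps x" for p
  proof -
    obtain b where b: "syllable_at x p = Some b"
      using gap_defined[OF pq] by blast
    show ?thesis
    proof (cases b)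
      case (Dir e)
      then have "arr (syllable_at x) e p (p + 1)"
        using b by (simp add: arr_def)
      from coefficient_arr(1)[OF f(1) this this] show ?thesis .
    next
      case (Inv e)
      then have "arr (syllable_at x) e (p + 1) p"
        using b by (simp add: arr_def)
      from coefficient_arr(1)[OF f(1) this this] show ?thesis by simp
    qed
  qed
  have right: "p0 + int n \<in> gaps x \<longrightarrow> coefficient f (p0 + int n) (p0 + int n) = coefficient f p0 p0" for n
  proof (induction n)
    case (Suc n)
    show ?case
      using Suc adj[of "p0 + int n"] convex[OF p0, of "p0 + int (Suc n)" "p0 + int n"] by (simp add: algebra_simps)
  qed simp
  have left: "p0 - int n \<in> gaps x \<longrightarrow> coefficient f (p0 - int n) (p0 - int n) = coefficient f p0 p0" for n
  proof (induction n)
    case (Suc n)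
    have e: "p0 - int n = p0 - int (Suc n) + 1"
      by simp
    show ?case
      using Suc adj[of "p0 - int (Suc n)"] convex[OF _ p0, of "p0 - int (Suc n)" "p0 - int n"] unfolding e by simp
  qed simp
  have diag: "coefficient f p p = coefficient f p0 p0" if "p \<in> gaps x" for p
    using right[of "nat (p - p0)"] left[of "nat (p0 - p)"] that by (cases "p0 \<le> p") auto
  have "f = scalar (coefficient f p0 p0)"
  proof (rule ext, rule ext)
    fix v z
    have ext: "f \<in> extensional (verts (quiver L))" "v \<in> verts (quiver L) \<Longrightarrow> f v \<in> extensional (space (string_module L x :: ('k, 'v, 'e, int \<Rightarrow>\<^sub>0 'k) quiver_rep) v)"
      using f(1) by (auto simp: endomorphisms_def PiE_def Pi_def)
    show "f v z = scalar (coefficient f p0 p0) v z"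
    proof (cases "v \<in> verts (quiver L) \<and> z \<in> space (string_module L x :: ('k, 'v, 'e, int \<Rightarrow>\<^sub>0 'k) quiver_rep) v")
      case False
      then show ?thesis
        using ext by (auto simp: scalar_def extensional_def restrict_def)
    next
      case True
      then have vz: "v \<in> verts (quiver L)" "z \<in> space (string_module L x :: ('k, 'v, 'e, int \<Rightarrow>\<^sub>0 'k) quiver_rep) v"
        by auto
      have "f v z = pscale (coefficient f p0 p0) z"
      proof (rule poly_mapping_eqI)
        fix q
        have "Poly_Mapping.lookup (f v z) q = (\<Sum>p \<in> Poly_Mapping.keys z. Poly_Mapping.lookup z p * coefficient f q p)"
          by (rule lookup_endomorphism[OF f(1) vz])
        also have "\<dots> = (\<Sum>p \<in> Poly_Mapping.keys z. if p = q then Poly_Mapping.lookup z p * coefficient f p0 p0 else 0)"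
        proof (rule sum.cong[OF refl])
          fix p assume "p \<in> Poly_Mapping.keys z"
          then have "p \<in> gaps x"
            using vz(2) by (auto simp: space_iff in_keys_iff)
          then show "Poly_Mapping.lookup z p * coefficient f q p = (if p = q then Poly_Mapping.lookup z p * coefficient f p0 p0 else 0)"
            using off diag by auto
        qed
        also have "\<dots> = Poly_Mapping.lookup (pscale (coefficient f p0 p0) z) q"
          by (simp add: lookup_pscale in_keys_iff)
        finally show "Poly_Mapping.lookup (f v z) q = Poly_Mapping.lookup (pscale (coefficient f p0 p0) z) q" .
      qed
      then show ?thesis
        using vz by (simp add: scalar_def)
    qed
  qed
  then show False
    using f(2) by blast
qed

text \<open>
The overlap may be one with the string itself (\<open>sg = 1\<close>) or with its inverse (\<open>sg = - 1\<close>), where the gap \<open>p\<close>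
of the inverse is the gap \<open>- p\<close> of the string. In both cases the endomorphism sends the basis vector at
\<open>p \<in> I\<close> to the one at \<open>sg * (p + d)\<close>, and it is not a scalar because it moves the gap \<open>a0\<close>.
\<close>

lemma overlap_nonscalar:
  assumes ov: "overlap (syllable_at x) (gaps x) (base_at L x) s' G' \<beta>' I d"
    and sg: "sg = 1 \<or> sg = - 1"
    and s': "\<And>a p q. arr s' a p q \<longleftrightarrow> arr (syllable_at x) a (sg * p) (sg * q)"
    and vertex: "\<And>p. p \<in> I \<Longrightarrow> sg * (p + d) \<in> gaps x \<and> vertex_of (base_at L x (sg * (p + d))) = vertex_of (base_at L x p)"
    and moved: "a0 \<in> I" "sg * (a0 + d) \<noteq> a0"
  shows "\<not> endomorphisms L (string_module L x) \<subseteq> range (scalar :: 'k::field \<Rightarrow> _)"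
proof -
  let ?V = "string_module L x :: ('k, 'v, 'e, int \<Rightarrow>\<^sub>0 'k) quiver_rep"
  define \<sigma> where "\<sigma> p = sg * (p + d)" for p
  \<comment> \<open>the inverse of \<open>\<sigma>\<close>\<close>
  define \<tau> where "\<tau> q = sg * q - d" for q
  have \<sigma>\<tau>: "\<sigma> p = q \<longleftrightarrow> p = \<tau> q" for p q
    using sg by (auto simp: \<sigma>_def \<tau>_def)
  have \<tau>\<sigma>: "\<tau> (\<sigma> p) = p" for p
    using \<sigma>\<tau> by metis
  have sgsg: "sg * (sg * p) = p" for p
    using sg by auto
  define T where "T z = (\<Sum>p \<in> Poly_Mapping.keys z. if p \<in> I then Poly_Mapping.single (\<sigma> p) (Poly_Mapping.lookup z p) else 0)"
    for z :: "int \<Rightarrow>\<^sub>0 'k"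
  have T: "Poly_Mapping.lookup (T z) q = (if \<tau> q \<in> I then Poly_Mapping.lookup z (\<tau> q) else 0)" for z q
  proof -
    have "Poly_Mapping.lookup (T z) q =
        (\<Sum>p \<in> Poly_Mapping.keys z. if p = \<tau> q then (if p \<in> I then Poly_Mapping.lookup z p else 0) else 0)"
      unfolding T_def lookup_sum by (intro sum.cong refl) (simp add: lookup_single' \<sigma>\<tau>)
    then show ?thesis
      by (simp add: in_keys_iff)
  qed
  note A = overlap_arr(1)[OF ov]
  have B: "\<exists>p' \<in> I. q = \<sigma> p' \<and> arr (syllable_at x) a p p'" if p: "p \<in> I" and a: "arr (syllable_at x) a (\<sigma> p) q" for p a q
  proof -
    have "arr s' a (p + d) (sg * q)"
      using a by (simp add: s' \<sigma>_def sgsg)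
    then obtain p' where p': "p' \<in> I" "sg * q = p' + d" "arr (syllable_at x) a p p'"
      using overlap_arr(2)[OF ov p] by blast
    then have "q = \<sigma> p'"
      using sgsg[of q] by (simp add: \<sigma>_def)
    then show ?thesis
      using p' by blast
  qed
  have C: "arr (syllable_at x) a (\<sigma> p) (\<sigma> p')" if "p \<in> I" "p' \<in> I" "arr (syllable_at x) a p p'" for p p' a
    using overlap_arr(3)[OF ov that] by (simp add: s' \<sigma>_def)
  define f where "f = (\<lambda>v \<in> verts (quiver L). \<lambda>z \<in> space ?V v. T z)"
  have "f \<in> endomorphisms L ?V"
    unfolding f_def
  proof (rule endomorphismI)
    show "T z \<in> space ?V v" if z: "z \<in> space ?V v" for v z
      unfolding space_iff
    proof (intro allI impI)
      fix q assume "Poly_Mapping.lookup (T z) q \<noteq> 0"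
      then have q: "\<tau> q \<in> I" "Poly_Mapping.lookup z (\<tau> q) \<noteq> 0"
        by (auto simp: T split: if_splits)
      have "\<sigma> (\<tau> q) = q"
        by (simp add: \<sigma>\<tau>)
      then show "q \<in> gaps x \<and> vertex_of (base_at L x q) = v"
        using vertex[OF q(1)] z q(2) by (auto simp: space_iff \<sigma>_def)
    qed
    show "T (y + z) = T y + T z" for y z
      by (rule poly_mapping_eqI) (simp add: T lookup_add)
    show "T (pscale c z) = pscale c (T z)" for c z
      by (rule poly_mapping_eqI) (simp add: T lookup_pscale)
    show "T (act (string_module L x) a z) = act (string_module L x) a (T z)" for a z
    proof (rule act_eqI[symmetric])
      fix q0 q assume a: "arr (syllable_at x) a q0 q"
      show "Poly_Mapping.lookup (T (act (string_module L x) a z)) q = Poly_Mapping.lookup (T z) q0"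
      proof (cases "\<tau> q0 \<in> I")
        case True
        have "\<sigma> (\<tau> q0) = q0"
          by (simp add: \<sigma>\<tau>)
        then obtain p' where p': "p' \<in> I" "q = \<sigma> p'" "arr (syllable_at x) a (\<tau> q0) p'"
          using B[OF True, of a q] a by auto
        then show ?thesis
          using True lookup_act(1)[OF p'(3)] by (simp add: T \<tau>\<sigma>)
      next
        case False
        have "\<not> arr (syllable_at x) a p (\<tau> q)" if "\<tau> q \<in> I" for p
        proof
          assume p: "arr (syllable_at x) a p (\<tau> q)"
          then have "p \<in> I"
            using A that by blast
          moreover have "\<sigma> (\<tau> q) = q"
            by (simp add: \<sigma>\<tau>)
          ultimately have "\<sigma> p = q0"
            using C[OF _ that p] a arr_left_unique by auto
          then have "p = \<tau> q0"
            using \<sigma>\<tau>[of p q0] by simp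
          then show False
            using False \<open>p \<in> I\<close> by simp
        qed
        then show ?thesis
          using False lookup_act(2)[of a "\<tau> q" z] by (auto simp: T)
      qed
    next
      fix q assume none: "\<And>p. \<not> arr (syllable_at x) a p q"
      have "\<not> arr (syllable_at x) a p (\<tau> q)" if "\<tau> q \<in> I" for p
      proof
        assume p: "arr (syllable_at x) a p (\<tau> q)"
        then have "p \<in> I"
          using A that by blast
        moreover have "\<sigma> (\<tau> q) = q"
          by (simp add: \<sigma>\<tau>)
        ultimately show False
          using C[OF _ that p] none by auto
      qed
      then show "Poly_Mapping.lookup (T (act (string_module L x) a z)) q = 0"
        using lookup_act(2)[of a "\<tau> q" z] by (auto simp: T)
    qed
  qed
  moreover have "f \<noteq> scalar c" for c
  proof
    assume eq: "f = scalar c"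
    have a0: "a0 \<in> gaps x"
      using overlapD(2)[OF ov] moved(1) by blast
    have "T (Poly_Mapping.single a0 1) = pscale c (Poly_Mapping.single a0 1)"
      using fun_cong[OF fun_cong[OF eq, of "vertex_of (base_at L x a0)"], of "Poly_Mapping.single a0 1"]
        vertex_base[OF a0] space_single[OF a0 refl, of "1::'k"] by (simp add: scalar_def f_def)
    then have "Poly_Mapping.lookup (T (Poly_Mapping.single a0 1)) (\<sigma> a0) = Poly_Mapping.lookup (pscale c (Poly_Mapping.single a0 1)) (\<sigma> a0)"
      by simp
    moreover have "\<sigma> a0 \<noteq> a0"
      using moved(2) by (simp add: \<sigma>_def)
    ultimately show False
      using moved(1) by (simp add: T \<tau>\<sigma> lookup_pscale lookup_single')
  qed
  ultimately show ?thesis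
    by blast
qed

text \<open>
A nonzero coefficient relates gaps over the same vertex. The base points there are equal or
opposite, which decides whether the overlap is one with the string itself or with its inverse.
\<close>

lemma brick_iff_no_overlap:
  "brick L (string_module L x :: ('k::field, 'v, 'e, int \<Rightarrow>\<^sub>0 'k) quiver_rep) \<longleftrightarrow>
    \<not> (\<exists>I d. d \<noteq> 0 \<and> overlap (syllable_at x) (gaps x) (base_at L x) (syllable_at x) (gaps x) (base_at L x) I d) \<and>
    \<not> (\<exists>I d. overlap (syllable_at x) (gaps x) (base_at L x)
         (inv_seq (syllable_at x)) (uminus ` gaps x) (inv_base (base_at L x)) I d)"
proof -
  let ?s = "syllable_at x" and ?G = "gaps x" and ?\<beta> = "base_at L x"
  have "\<not> endomorphisms L (string_module L x) \<subseteq> range (scalar :: 'k \<Rightarrow> _)"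
    if d: "d \<noteq> 0" and ov: "overlap ?s ?G ?\<beta> ?s ?G ?\<beta> I d" for I d
  proof -
    obtain a where "a \<in> I"
      using overlapD(1)[OF ov] by blast
    then show ?thesis
      using overlapD(4,5)[OF ov] d by (intro overlap_nonscalar[OF ov, of 1 a]) simp_all
  qed
  moreover have "\<not> endomorphisms L (string_module L x) \<subseteq> range (scalar :: 'k \<Rightarrow> _)"
    if ov: "overlap ?s ?G ?\<beta> (inv_seq ?s) (uminus ` ?G) (inv_base ?\<beta>) I d" for I d
  proof -
    obtain a where a: "a \<in> I"
      using overlapD(1)[OF ov] by blast
    have gap: "- (p + d) \<in> ?G" if "p \<in> I" for p
      using overlapD(4)[OF ov that] by (elim imageE) (simp only: minus_minus)
    have base: "?\<beta> p = aut_bar (?\<beta> (- (p + d)))" if "p \<in> I" for p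
      using overlapD(5)[OF ov that] by (simp add: inv_base_def)
    show ?thesis
    proof (rule overlap_nonscalar[OF ov, of "- 1" a])
      show "- 1 * (p + d) \<in> ?G \<and> vertex_of (?\<beta> (- 1 * (p + d))) = vertex_of (?\<beta> p)" if "p \<in> I" for p
        using gap[OF that] base[OF that] base_trivial[OF gap[OF that]] by (auto simp: trivial_strings_def)
      show "- 1 * (a + d) \<noteq> a"
      proof
        assume "- 1 * (a + d) = a"
        then have e: "- (a + d) = a"
          by simp
        show False
          using base[OF a] bar_base[OF gap[OF a]] unfolding e by metis
      qed
    qed (simp_all add: arr_inv_seq a)
  qed
  moreover have "(\<exists>I d. d \<noteq> 0 \<and> overlap ?s ?G ?\<beta> ?s ?G ?\<beta> I d) \<or>
      (\<exists>I d. overlap ?s ?G ?\<beta> (inv_seq ?s) (uminus ` ?G) (inv_base ?\<beta>) I d)"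
    if "\<not> endomorphisms L (string_module L x) \<subseteq> range (scalar :: 'k \<Rightarrow> _)"
  proof -
    from that obtain f :: "'v \<Rightarrow> (int \<Rightarrow>\<^sub>0 'k) \<Rightarrow> (int \<Rightarrow>\<^sub>0 'k)" where
      f: "f \<in> endomorphisms L (string_module L x)" "f \<notin> range scalar"
      by blast
    from nonscalar_coefficient[OF f] obtain p q where pq: "p \<in> ?G" "p \<noteq> q" "coefficient f q p \<noteq> 0" .
    note q = coefficient_gaps[OF f(1) pq(1,3)]
    note line = string_line_axioms
    from base_eq_or_bar[OF pq(1) q(1) q(2)[symmetric]] show ?thesis
    proof
      assume eq: "?\<beta> p = ?\<beta> q"
      have "\<exists>I. overlap ?s ?G ?\<beta> ?s ?G ?\<beta> I (q - p)"
      proof (rule overlap_of_coefficients[OF line line, where C = "coefficient f" and a = p])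
      qed (use coefficient_arr[OF f(1)] pq q eq in simp_all)
      then show ?thesis
        using pq(2) by (metis eq_iff_diff_eq_0)
    next
      assume eq: "?\<beta> p = aut_bar (?\<beta> q)"
      have neg: "- r \<in> uminus ` ?G \<longleftrightarrow> r \<in> ?G" for r
        by auto
      have "\<exists>I. overlap ?s ?G ?\<beta> (inv_seq ?s) (uminus ` ?G) (inv_base ?\<beta>) I (- q - p)"
      proof (rule overlap_of_coefficients[OF line inverse_line, where C = "\<lambda>q. coefficient f (- q)" and a = p])
        show "coefficient f (- r') k' = coefficient f (- r) k" if "arr ?s e k k'" "arr (inv_seq ?s) e r r'" for e k k' r r'
          using that by (intro coefficient_arr(1)[OF f(1)]) (auto simp: arr_inv_seq)
        show "coefficient f (- r') k' = 0" if "arr ?s e k k'" "\<And>r. \<not> arr (inv_seq ?s) e r r'" for e k k' r'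
        proof (rule coefficient_arr(2)[OF f(1) that(1)])
          show "\<not> arr ?s e r (- r')" for r
            using that(2)[of "- r"] by (simp add: arr_inv_seq)
        qed
        show "coefficient f (- r) k = 0" if "arr (inv_seq ?s) e r r'" "k \<in> ?G"
          "vertex_of (?\<beta> k) = vertex_of (inv_base ?\<beta> r)" "\<And>k'. \<not> arr ?s e k k'" for e k r r'
        proof (rule coefficient_arr(3)[OF f(1)])
          show r: "arr ?s e (- r) (- r')"
            using that(1) by (simp add: arr_inv_seq)
          show "vertex_of (?\<beta> k) = vertex_of (?\<beta> (- r))"
            using that(3) base_trivial[OF arr_base(1)[OF r]] by (auto simp: inv_base_def trivial_strings_def)
        qed (use that in auto)
      qed (use pq q eq neg in \<open>simp_all add: inv_base_def\<close>)
      then show ?thesis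
        by blast
    qed
  qed
  ultimately show ?thesis
    unfolding brick_iff_scalar by blast
qed

end

theorem theorem1p3:
  fixes L :: "('v, 'e) string_data" and x :: "('v, 'e) qstring"
  assumes "string_algebra L"
    and "arcs (quiver L) \<noteq> {}"
    and "x \<in> strings L"
    and "is_finite x \<or> (\<not> is_finite x \<and> aperiodic_string x)"
  shows "brick L (string_module L x :: ('k::alg_closed_field, 'v, 'e, int \<Rightarrow>\<^sub>0 'k) quiver_rep)
     \<longleftrightarrow> (\<forall>W \<in> Phi ` word_class L x. brick_word (delta_mia L) W)"
proof -
  interpret algebra_string L x
    by (intro algebra_string.intro algebra_string_axioms.intro string_line_string assms)
  have "Phi ` word_class L x = based delta_pm (syllable_at x) (base_at L x) ` gaps x"
    by (simp add: word_class_eq[OF assms(1,3)] image_image Phi_based)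
  then show ?thesis
    using brick_word_based_iff[OF aperiodic_seq_string[OF assms(4)]] gaps_ne
    unfolding brick_iff_no_overlap by auto
qed

end
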